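(* For all integers $n > 1$, there is a complete Riemannian metric on $\mathbb{R}^n$ of quadratic curvature decay and slow volume growth.
   Context: Let $M$ be a connected $n$-dimensional manifold with a complete Riemannian metric, distance function $d$ and basepoint $m_0 \in M$; let $B_t$ be the metric ball of radius $t$ around $m_0$. The metric has quadratic curvature decay if there is a constant $C > 0$ such that for all $m \in M$ and all $2$-planes $P \subset T_mM$, the sectional curvature satisfies $|K(P)| \le C/d(m_0,m)^2$ (no condition at $m=m_0$). It has slow volume growth if $\liminf_{t\to\infty}\mathrm{vol}(B_t)/t^n = 0$. *)

theory Defs
  imports "HOL-Analysis.Analysis"
begin

definition partial_deriv :: "'n::finite \<Rightarrow> (real^'n \<Rightarrow> real) \<Rightarrow> real^'n \<Rightarrow> real" where
  "partial_deriv i f x = frechet_derivative f (at x) (axis i 1)"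

primrec Ck_fun :: "nat \<Rightarrow> (real^'n::finite \<Rightarrow> real) \<Rightarrow> bool" where
  "Ck_fun 0 f \<longleftrightarrow> continuous_on UNIV f"
| "Ck_fun (Suc k) f \<longleftrightarrow>
     f differentiable_on UNIV \<and> (\<forall>i. Ck_fun k (partial_deriv i f))"

definition smooth_fun :: "(real^'n::finite \<Rightarrow> real) \<Rightarrow> bool" where
  "smooth_fun f \<longleftrightarrow> (\<forall>k. Ck_fun k f)"

text \<open>A Riemannian metric on the manifold \<open>real^'n\<close> is given by its matrix \<open>g x $ i $ j\<close>
  in the standard global coordinates; every tangent space is identified with \<open>real^'n\<close>.\<close>

definition riemannian_metric :: "(real^'n::finite \<Rightarrow> real^'n^'n) \<Rightarrow> bool" where
  "riemannian_metric g \<longleftrightarrow>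
     (\<forall>i j. smooth_fun (\<lambda>x. g x $ i $ j)) \<and>
     (\<forall>x. transpose (g x) = g x) \<and>
     (\<forall>x v. v \<noteq> 0 \<longrightarrow> 0 < v \<bullet> (g x *v v))"

definition riem_inner ::
    "(real^'n::finite \<Rightarrow> real^'n^'n) \<Rightarrow> real^'n \<Rightarrow> real^'n \<Rightarrow> real^'n \<Rightarrow> real" where
  "riem_inner g x u v = u \<bullet> (g x *v v)"

text \<open>The derivative of a \<open>valid_path\<close> may be unbounded near its finitely many break points, so
  its length can be infinite.  The length is therefore an \<open>ennreal\<close>-valued integral: with
  \<open>integral\<close>, such a path would get length \<open>0\<close>.\<close>

definition riem_length :: "(real^'n::finite \<Rightarrow> real^'n^'n) \<Rightarrow> (real \<Rightarrow> real^'n) \<Rightarrow> ennreal" where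
  "riem_length g \<gamma> =
     (\<integral>\<^sup>+t\<in>{0..1}. ennreal (sqrt (riem_inner g (\<gamma> t)
        (vector_derivative \<gamma> (at t)) (vector_derivative \<gamma> (at t)))) \<partial>lborel)"

definition riem_dist :: "(real^'n::finite \<Rightarrow> real^'n^'n) \<Rightarrow> real^'n \<Rightarrow> real^'n \<Rightarrow> real" where
  "riem_dist g x y =
     enn2real (INF \<gamma>\<in>{\<gamma>. valid_path \<gamma> \<and> pathstart \<gamma> = x \<and> pathfinish \<gamma> = y}. riem_length g \<gamma>)"

definition complete_metric :: "(real^'n::finite \<Rightarrow> real^'n^'n) \<Rightarrow> bool" where
  "complete_metric g \<longleftrightarrow> Metric_space.mcomplete UNIV (riem_dist g)"

text \<open>\<open>christoffel g k i j\<close> is \<open>\<Gamma>\<^sup>k\<^sub>i\<^sub>j\<close>, the \<open>k\<close>-th coefficient of the Levi-Civita derivative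
  of the \<open>j\<close>-th coordinate field along the \<open>i\<close>-th one.\<close>

definition christoffel ::
    "(real^'n::finite \<Rightarrow> real^'n^'n) \<Rightarrow> 'n \<Rightarrow> 'n \<Rightarrow> 'n \<Rightarrow> real^'n \<Rightarrow> real" where
  "christoffel g k i j x =
     (\<Sum>l\<in>UNIV. matrix_inv (g x) $ k $ l *
        (partial_deriv i (\<lambda>y. g y $ j $ l) x
         + partial_deriv j (\<lambda>y. g y $ i $ l) x
         - partial_deriv l (\<lambda>y. g y $ i $ j) x)) / 2"

text \<open>\<open>riem_coeff g l i j k\<close> is the \<open>l\<close>-th coefficient of \<open>R(\<partial>\<^sub>i, \<partial>\<^sub>j)\<partial>\<^sub>k\<close>, where
  \<open>R(X, Y)Z = \<nabla>\<^sub>X \<nabla>\<^sub>Y Z - \<nabla>\<^sub>Y \<nabla>\<^sub>X Z - \<nabla>\<^bsub>[X, Y]\<^esub> Z\<close>.\<close>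

definition riem_coeff ::
    "(real^'n::finite \<Rightarrow> real^'n^'n) \<Rightarrow> 'n \<Rightarrow> 'n \<Rightarrow> 'n \<Rightarrow> 'n \<Rightarrow> real^'n \<Rightarrow> real" where
  "riem_coeff g l i j k x =
     partial_deriv i (christoffel g l j k) x - partial_deriv j (christoffel g l i k) x
     + (\<Sum>m\<in>UNIV. christoffel g l i m x * christoffel g m j k x
                   - christoffel g l j m x * christoffel g m i k x)"

definition riem_curvature ::
    "(real^'n::finite \<Rightarrow> real^'n^'n) \<Rightarrow> real^'n \<Rightarrow> real^'n \<Rightarrow> real^'n \<Rightarrow> real^'n \<Rightarrow> real^'n" where
  "riem_curvature g x u v w =
     (\<chi> l. \<Sum>i\<in>UNIV. \<Sum>j\<in>UNIV. \<Sum>k\<in>UNIV. riem_coeff g l i j k x * u $ i * v $ j * w $ k)"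

text \<open>The sectional curvature at \<open>x\<close> of the 2-plane spanned by \<open>u\<close> and \<open>v\<close>.\<close>

definition sectional_curvature ::
    "(real^'n::finite \<Rightarrow> real^'n^'n) \<Rightarrow> real^'n \<Rightarrow> real^'n \<Rightarrow> real^'n \<Rightarrow> real" where
  "sectional_curvature g x u v =
     riem_inner g x (riem_curvature g x u v v) u /
       (riem_inner g x u u * riem_inner g x v v - (riem_inner g x u v)\<^sup>2)"

text \<open>The 2-planes in a tangent space are the spans of the linearly independent pairs \<open>u\<close>, \<open>v\<close>;
  \<open>u \<noteq> v\<close> is needed since \<open>independent\<close> is a predicate on sets.\<close>

definition quadratic_curvature_decay :: "(real^'n::finite \<Rightarrow> real^'n^'n) \<Rightarrow> real^'n \<Rightarrow> bool" where
  "quadratic_curvature_decay g m0 \<longleftrightarrow>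
     (\<exists>C>0. \<forall>m u v. m \<noteq> m0 \<and> u \<noteq> v \<and> independent {u, v} \<longrightarrow>
        \<bar>sectional_curvature g m u v\<bar> \<le> C / (riem_dist g m0 m)\<^sup>2)"

definition riem_ball :: "(real^'n::finite \<Rightarrow> real^'n^'n) \<Rightarrow> real^'n \<Rightarrow> real \<Rightarrow> (real^'n) set" where
  "riem_ball g m0 t = {x. riem_dist g m0 x < t}"

definition riem_volume :: "(real^'n::finite \<Rightarrow> real^'n^'n) \<Rightarrow> (real^'n) set \<Rightarrow> ennreal" where
  "riem_volume g A = (\<integral>\<^sup>+x\<in>A. ennreal (sqrt (det (g x))) \<partial>lborel)"

definition slow_volume_growth :: "(real^'n::finite \<Rightarrow> real^'n^'n) \<Rightarrow> real^'n \<Rightarrow> bool" where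
  "slow_volume_growth g m0 \<longleftrightarrow>
     Liminf at_top (\<lambda>t::real. riem_volume g (riem_ball g m0 t) / ennreal (t ^ CARD('n))) = 0"

end

theory Submission imports Defs begin

text \<open>Quadratic curvature decay allows the metric to collapse along the orbits of a free circle
  action, but a large sphere in \<open>\<real>\<^sup>n\<close> need not carry such an action.  Instead the metric is collapsed
  near the boundaries, products of a circle and an \<open>(n-2)\<close>-sphere, of tubes around round circles of
  radius \<open>64 ^ k\<close> through the base point, each tube lying in a ball inside the next one.  In a collar
  of the boundary of the \<open>k\<close>-th tube the metric is conformal to the Euclidean one with factor
  \<open>exp (2 (p + 1) l)\<close>, \<open>p = 4 n\<close>, where \<open>l\<close> is a function of the distance to the core circle that
  increases from \<open>0\<close> to a large number \<open>M\<close>, except that the orbits of the rotation of the tube are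
  shrunk by the additional factor \<open>exp (- p l (1 - l / M))\<close>.  The function \<open>l\<close> is as steep as possible
  with \<open>l' = O(exp l)\<close> and \<open>l'' = O(exp (2 l))\<close>, so that the distance \<open>r\<close> to the base point is, up to
  the scale of the collar, of order \<open>exp (p l)\<close>, while the curvature is \<open>O(exp (- 2 p l))\<close>.  Where
  \<open>l = M / 2\<close>, the ball of radius \<open>r\<close> has volume \<open>O(exp (- n l) r\<^sup>n)\<close>, and \<open>M\<close> tends to infinity with
  \<open>k\<close>.  The curvature is estimated at one point at a time, in polar coordinates around the axis of the
  rotation whose angle is scaled so that the metric at this point becomes a multiple of the identity:
  there the first and second derivatives of the metric are bounded even though the orbits are short.\<close>

subsection \<open>Calculus of smooth functions\<close>

text \<open>Two requirements on \<open>l\<close> compete: the metric must be a multiple of the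
  Euclidean one at both ends of a collar, so that the next collar can start from a larger multiple,
  and in between it must be collapsed as strongly as the curvature permits. In a collar of scale
  \<open>L\<close> a derivative of \<open>l\<close> is of order \<open>exp l / L\<close>, while
  lengths carry the factor \<open>exp ((p + 1) * l)\<close>; the square of the quotient is the
  curvature. Solutions of \<open>l' = C * exp l\<close> have \<open>exp (- l)\<close> affine, whence
  the logarithm in \<open>log_growth\<close>, and integrating \<open>exp ((p + 1) * l)\<close> along
  such a solution gives a multiple of \<open>exp (p * l)\<close>, whence the distance. The choice
  \<open>p = 4 n\<close> pays for a crude volume estimate: a ball is put into a Euclidean ball of
  radius \<open>3 L\<close> with the largest density that occurs. Relative to \<open>r ^ n\<close>
  this loses \<open>exp (n * l)\<close>; at \<open>l = M / 2\<close> the short circles win back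
  \<open>exp (p * l / 2) = exp (2 * n * l)\<close>. The core circles pass through the base point so
  that a point of a tube can be reached from there inside the tube, at a cost governed by
  \<open>l\<close> alone.\<close>

primrec Ck_on :: "nat \<Rightarrow> (real^'n::finite) set \<Rightarrow> (real^'n \<Rightarrow> real) \<Rightarrow> bool" where
  "Ck_on 0 U f \<longleftrightarrow> continuous_on U f"
| "Ck_on (Suc k) U f \<longleftrightarrow>
     (\<forall>x\<in>U. f differentiable (at x)) \<and> (\<forall>i. Ck_on k U (partial_deriv i f))"

text \<open>Smoothness on a set is needed because the metric is glued from pieces whose formulas are
  valid only on open sets, for instance off the axis of rotation. Differentiability is that in the
  full space at the points of \<open>U\<close>, so rules comparing two functions assume
  \<open>U\<close> open.\<close>

definition smooth_on :: "(real^'n::finite) set \<Rightarrow> (real^'n \<Rightarrow> real) \<Rightarrow> bool" where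
  "smooth_on U f \<longleftrightarrow> (\<forall>k. Ck_on k U f)"

lemma Ck_fun_iff: "Ck_fun k f \<longleftrightarrow> Ck_on k UNIV f"
  by (induction k arbitrary: f) (auto simp: differentiable_on_def)

lemma smooth_fun_iff: "smooth_fun f \<longleftrightarrow> smooth_on UNIV f"
  by (simp add: smooth_fun_def smooth_on_def Ck_fun_iff)

lemma partial_deriv_eqI:
  "(f has_derivative f') (at x) \<Longrightarrow> partial_deriv i f x = f' (axis i 1)"
  unfolding partial_deriv_def using frechet_derivative_at by metis

lemma partial_deriv_cong_open:
  assumes "open U" "x \<in> U" "\<And>y. y \<in> U \<Longrightarrow> f y = h y"
  shows "partial_deriv i f x = partial_deriv i h x"
proof -
  \<comment> \<open>Both functions have the same derivatives at \<open>x\<close>, so the choice made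
    by \<open>frechet_derivative\<close> agrees, even at a point where there are none.\<close>
  have "(f has_derivative D) (at x) \<longleftrightarrow> (h has_derivative D) (at x)" for D
    using assms has_derivative_transform_within_open[of f D x UNIV U h]
      has_derivative_transform_within_open[of h D x UNIV U f] by auto
  then show ?thesis
    by (simp add: partial_deriv_def frechet_derivative_def)
qed

lemma differentiable_cong_open:
  assumes "open U" "x \<in> U" "\<And>y. y \<in> U \<Longrightarrow> f y = h y" "f differentiable (at x)"
  shows "h differentiable (at x)"
  using assms has_derivative_transform_within_open[of f _ x UNIV U h]
  unfolding differentiable_def by blast

lemma Ck_on_cong:
  assumes "open U" "\<And>x. x \<in> U \<Longrightarrow> f x = h x"
  shows "Ck_on k U f \<longleftrightarrow> Ck_on k U h"
  using assms(2)
proof (induction k arbitrary: f h)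
  case 0
  then show ?case by (simp cong: continuous_on_cong)
next
  case (Suc k)
  have "Ck_on k U (partial_deriv i f) \<longleftrightarrow> Ck_on k U (partial_deriv i h)" for i
    by (rule Suc.IH) (use Suc.prems assms(1) partial_deriv_cong_open in blast)
  moreover have "f differentiable (at x) \<longleftrightarrow> h differentiable (at x)" if "x \<in> U" for x
    using differentiable_cong_open[OF assms(1) that] Suc.prems by metis
  ultimately show ?case by simp
qed

lemma Ck_on_SucD: "Ck_on (Suc k) U f \<Longrightarrow> Ck_on k U f"
proof (induction k arbitrary: f)
  case 0
  then show ?case
    by (simp add: continuous_at_imp_continuous_on differentiable_imp_continuous_within)
next
  case (Suc k)
  then show ?case by auto
qed

lemma Ck_on_subset: "Ck_on k U f \<Longrightarrow> V \<subseteq> U \<Longrightarrow> Ck_on k V f"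
  by (induction k arbitrary: f) (auto intro: continuous_on_subset)

lemma smooth_on_subset: "smooth_on U f \<Longrightarrow> V \<subseteq> U \<Longrightarrow> smooth_on V f"
  using Ck_on_subset unfolding smooth_on_def by blast

lemma smooth_on_cong:
  assumes "open U" "\<And>x. x \<in> U \<Longrightarrow> f x = h x"
  shows "smooth_on U f \<longleftrightarrow> smooth_on U h"
  using Ck_on_cong[OF assms] by (simp add: smooth_on_def)

lemma smooth_on_locally:
  assumes "\<And>x. x \<in> U \<Longrightarrow> \<exists>V. open V \<and> x \<in> V \<and> smooth_on V f"
  shows "smooth_on U f"
proof -
  have "Ck_on k U f" if "\<And>x. x \<in> U \<Longrightarrow> \<exists>V. open V \<and> x \<in> V \<and> Ck_on k V f" for k
    using that
  proof (induction k arbitrary: f)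
    case 0
    then show ?case
      by (metis Ck_on.simps(1) at_within_open continuous_at_imp_continuous_on
          continuous_on_eq_continuous_within)
  next
    case (Suc k)
    show ?case
    proof (simp, safe)
      show "f differentiable (at x)" if "x \<in> U" for x
        using Suc.prems[OF that] by auto
      show "Ck_on k U (partial_deriv i f)" for i
        by (rule Suc.IH) (use Suc.prems in fastforce)
    qed
  qed
  then show ?thesis using assms unfolding smooth_on_def by meson
qed

lemma smooth_on_differentiable: "smooth_on U f \<Longrightarrow> x \<in> U \<Longrightarrow> f differentiable (at x)"
  unfolding smooth_on_def by (metis Ck_on.simps(2))

lemma smooth_on_partial: "smooth_on U f \<Longrightarrow> smooth_on U (partial_deriv i f)"
  unfolding smooth_on_def by (metis Ck_on.simps(2))

lemma smooth_on_continuous: "smooth_on U f \<Longrightarrow> continuous_on U f"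
  unfolding smooth_on_def by (metis Ck_on.simps(1))

lemma partial_deriv_add:
  "f differentiable (at x) \<Longrightarrow> h differentiable (at x) \<Longrightarrow>
   partial_deriv i (\<lambda>x. f x + h x) x = partial_deriv i f x + partial_deriv i h x"
  using partial_deriv_eqI[OF has_derivative_add] frechet_derivative_works
  unfolding partial_deriv_def by blast

lemma partial_deriv_mult:
  "f differentiable (at x) \<Longrightarrow> h differentiable (at x) \<Longrightarrow>
   partial_deriv i (\<lambda>x. f x * h x) x = f x * partial_deriv i h x + partial_deriv i f x * h x"
  using partial_deriv_eqI[OF has_derivative_mult] frechet_derivative_works
  unfolding partial_deriv_def by blast

lemma Ck_on_const [simp]: "Ck_on k U (\<lambda>x. c)"
proof (induction k arbitrary: c)
  case (Suc k)
  have "partial_deriv i (\<lambda>x. c) = (\<lambda>x::real^'a. 0)" for i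
    by (simp add: partial_deriv_def fun_eq_iff)
  then show ?case using Suc by simp
qed simp

lemma Ck_on_add:
  assumes "open U"
  shows "Ck_on k U f \<Longrightarrow> Ck_on k U h \<Longrightarrow> Ck_on k U (\<lambda>x. f x + h x)"
proof (induction k arbitrary: f h)
  case (Suc k)
  have "Ck_on k U (partial_deriv i (\<lambda>x. f x + h x)) \<longleftrightarrow>
        Ck_on k U (\<lambda>x. partial_deriv i f x + partial_deriv i h x)" for i
    by (rule Ck_on_cong[OF assms]) (use Suc.prems in \<open>simp add: partial_deriv_add\<close>)
  then show ?case using Suc by (auto intro!: differentiable_add)
qed (auto intro: continuous_intros)

lemma Ck_on_mult:
  assumes "open U"
  shows "Ck_on k U f \<Longrightarrow> Ck_on k U h \<Longrightarrow> Ck_on k U (\<lambda>x. f x * h x)"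
proof (induction k arbitrary: f h)
  case (Suc k)
  have "Ck_on k U (partial_deriv i (\<lambda>x. f x * h x)) \<longleftrightarrow>
        Ck_on k U (\<lambda>x. f x * partial_deriv i h x + partial_deriv i f x * h x)" for i
    by (rule Ck_on_cong[OF assms]) (use Suc.prems in \<open>simp add: partial_deriv_mult\<close>)
  moreover have "Ck_on k U f" "Ck_on k U h" using Suc.prems Ck_on_SucD by blast+
  ultimately show ?case using Suc by (auto intro!: differentiable_mult Ck_on_add[OF assms])
qed (auto intro: continuous_intros)

lemma smooth_on_const [simp]: "smooth_on U (\<lambda>x. c)"
  by (simp add: smooth_on_def)

lemma smooth_on_add:
  "open U \<Longrightarrow> smooth_on U f \<Longrightarrow> smooth_on U h \<Longrightarrow> smooth_on U (\<lambda>x. f x + h x)"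
  by (simp add: smooth_on_def Ck_on_add)

lemma smooth_on_mult:
  "open U \<Longrightarrow> smooth_on U f \<Longrightarrow> smooth_on U h \<Longrightarrow> smooth_on U (\<lambda>x. f x * h x)"
  by (simp add: smooth_on_def Ck_on_mult)

lemma smooth_on_uminus: "open U \<Longrightarrow> smooth_on U f \<Longrightarrow> smooth_on U (\<lambda>x. - f x)"
  using smooth_on_mult[of U "\<lambda>_. -1" f] by simp

lemma smooth_on_diff:
  "open U \<Longrightarrow> smooth_on U f \<Longrightarrow> smooth_on U h \<Longrightarrow> smooth_on U (\<lambda>x. f x - h x)"
  using smooth_on_add[of U f "\<lambda>x. - h x"] smooth_on_uminus[of U h] by simp

lemma smooth_on_power: "open U \<Longrightarrow> smooth_on U f \<Longrightarrow> smooth_on U (\<lambda>x. f x ^ m)"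
  by (induction m) (auto intro: smooth_on_mult)

lemma smooth_on_sum:
  "open U \<Longrightarrow> (\<And>a. a \<in> A \<Longrightarrow> smooth_on U (f a)) \<Longrightarrow> smooth_on U (\<lambda>x. \<Sum>a\<in>A. f a x)"
  by (induction A rule: infinite_finite_induct) (auto intro: smooth_on_add)

lemma smooth_on_prod:
  "open U \<Longrightarrow> (\<And>a. a \<in> A \<Longrightarrow> smooth_on U (f a)) \<Longrightarrow> smooth_on U (\<lambda>x. \<Prod>a\<in>A. f a x)"
  by (induction A rule: infinite_finite_induct) (auto intro: smooth_on_mult)

lemma smooth_on_component [simp]: "smooth_on U (\<lambda>x. x $ i)"
proof -
  have d: "((\<lambda>x. x $ i) has_derivative (\<lambda>x. x $ i)) (at x)" for x :: "real^'a"
    by (auto intro!: bounded_linear_imp_has_derivative bounded_linear_vec_nth)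
  have "partial_deriv j (\<lambda>x. x $ i) = (\<lambda>x::real^'a. axis j 1 $ i)" for j
    using partial_deriv_eqI[OF d] by (simp add: fun_eq_iff)
  then have "Ck_on (Suc k) U (\<lambda>x. x $ i)" for k
    using d by (auto simp: differentiable_def)
  then show ?thesis
    unfolding smooth_on_def using Ck_on_SucD by blast
qed

section \<open>Smooth functions of one real variable, and composition with them\<close>

primrec rC_on :: "nat \<Rightarrow> real set \<Rightarrow> (real \<Rightarrow> real) \<Rightarrow> bool" where
  "rC_on 0 U f \<longleftrightarrow> continuous_on U f"
| "rC_on (Suc k) U f \<longleftrightarrow>
     (\<exists>f'. (\<forall>x\<in>U. (f has_real_derivative f' x) (at x)) \<and> rC_on k U f')"

definition rsmooth :: "real set \<Rightarrow> (real \<Rightarrow> real) \<Rightarrow> bool" where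
  "rsmooth U f \<longleftrightarrow> (\<forall>k. rC_on k U f)"

lemma rC_on_SucD: "rC_on (Suc k) U f \<Longrightarrow> rC_on k U f"
proof (induction k arbitrary: f)
  case 0
  then show ?case
    by (auto intro!: continuous_at_imp_continuous_on intro: DERIV_isCont)
next
  case (Suc k)
  then obtain f' where "\<forall>x\<in>U. (f has_real_derivative f' x) (at x)" "rC_on (Suc k) U f'"
    by auto
  then show ?case using Suc.IH by auto
qed

lemma rC_on_cong:
  assumes "open U" "\<And>x. x \<in> U \<Longrightarrow> f x = h x" "rC_on k U f"
  shows "rC_on k U h"
proof (cases k)
  case 0
  then show ?thesis
    using assms continuous_on_cong[of U U f h] by simp
next
  case (Suc m)
  then obtain f' where f': "\<forall>x\<in>U. (f has_real_derivative f' x) (at x)" "rC_on m U f'"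
    using assms(3) by auto
  then have "\<forall>x\<in>U. (h has_real_derivative f' x) (at x)"
    using has_field_derivative_transform_within_open assms(1,2) by blast
  then show ?thesis using f'(2) Suc by auto
qed

lemma rC_on_add: "rC_on k U f \<Longrightarrow> rC_on k U h \<Longrightarrow> rC_on k U (\<lambda>x. f x + h x)"
proof (induction k arbitrary: f h)
  case (Suc k)
  then obtain f' h' where "\<forall>x\<in>U. (f has_real_derivative f' x) (at x)" "rC_on k U f'"
     "\<forall>x\<in>U. (h has_real_derivative h' x) (at x)" "rC_on k U h'" by auto
  then show ?case
    by (auto intro!: exI[of _ "\<lambda>x. f' x + h' x"] DERIV_add Suc.IH)
qed (auto intro: continuous_intros)

lemma rC_on_mult: "rC_on k U f \<Longrightarrow> rC_on k U h \<Longrightarrow> rC_on k U (\<lambda>x. f x * h x)"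
proof (induction k arbitrary: f h)
  case (Suc k)
  then obtain f' h' where "\<forall>x\<in>U. (f has_real_derivative f' x) (at x)" "rC_on k U f'"
     "\<forall>x\<in>U. (h has_real_derivative h' x) (at x)" "rC_on k U h'" by auto
  moreover have "rC_on k U f" "rC_on k U h" using Suc.prems rC_on_SucD by blast+
  ultimately show ?case
    by (auto intro!: exI[of _ "\<lambda>x. f' x * h x + h' x * f x"] DERIV_mult Suc.IH rC_on_add)
qed (auto intro: continuous_intros)

lemma rC_on_compose:
  "rC_on k V f \<Longrightarrow> rC_on k U h \<Longrightarrow> h ` U \<subseteq> V \<Longrightarrow> rC_on k U (\<lambda>x. f (h x))"
proof (induction k arbitrary: f)
  case 0
  then show ?case by (auto intro: continuous_on_compose2)
next
  case (Suc k)
  then obtain f' h' where f': "\<forall>x\<in>V. (f has_real_derivative f' x) (at x)" "rC_on k V f'"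
    and h': "\<forall>x\<in>U. (h has_real_derivative h' x) (at x)" "rC_on k U h'" by auto
  have "rC_on k U (\<lambda>x. f' (h x) * h' x)"
    using Suc.IH[OF f'(2) rC_on_SucD[OF Suc.prems(2)] Suc.prems(3)] h'(2) by (rule rC_on_mult)
  moreover have "((\<lambda>x. f (h x)) has_real_derivative f' (h x) * h' x) (at x)" if "x \<in> U" for x
    by (rule DERIV_chain2) (use that f'(1) h'(1) Suc.prems(3) in auto)
  ultimately show ?case
    unfolding rC_on.simps by (intro exI[of _ "\<lambda>x. f' (h x) * h' x"]) blast
qed

lemma rsmooth_add: "rsmooth U f \<Longrightarrow> rsmooth U h \<Longrightarrow> rsmooth U (\<lambda>x. f x + h x)"
  by (simp add: rsmooth_def rC_on_add)

lemma rsmooth_mult: "rsmooth U f \<Longrightarrow> rsmooth U h \<Longrightarrow> rsmooth U (\<lambda>x. f x * h x)"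
  by (simp add: rsmooth_def rC_on_mult)

lemma rsmooth_compose:
  "rsmooth V f \<Longrightarrow> rsmooth U h \<Longrightarrow> h ` U \<subseteq> V \<Longrightarrow> rsmooth U (\<lambda>x. f (h x))"
  unfolding rsmooth_def using rC_on_compose by blast

lemma rsmooth_const [simp]: "rsmooth U (\<lambda>x. c)"
proof -
  have "rC_on k U (\<lambda>x. c)" for k c
    by (induction k arbitrary: c) (auto intro!: exI[of _ "\<lambda>x. 0"])
  then show ?thesis by (simp add: rsmooth_def)
qed

text \<open>One family closed under differentiation settles all orders at once; \<open>exp\<close>,
  the identity and \<open>inverse\<close> are treated this way.\<close>

lemma rsmoothI:
  assumes "\<And>k x. x \<in> U \<Longrightarrow> (F k has_real_derivative F (Suc k) x) (at x)"
  shows "rsmooth U (F m)"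
proof -
  have "rC_on k U (F m)" for k
  proof (induction k arbitrary: m)
    case 0
    show ?case
      unfolding rC_on.simps
      by (intro continuous_at_imp_continuous_on ballI DERIV_isCont[OF assms])
  next
    case (Suc k)
    then show ?case using assms by auto
  qed
  then show ?thesis by (simp add: rsmooth_def)
qed

lemma rsmooth_id [simp]: "rsmooth U (\<lambda>x. x)"
proof -
  have "rsmooth U ((\<lambda>k x. if k = 0 then x else if k = Suc 0 then 1 else 0) 0)"
    by (rule rsmoothI) (auto split: if_splits)
  then show ?thesis by simp
qed

lemma rsmooth_exp [simp]: "rsmooth U exp"
  using rsmoothI[of U "\<lambda>_. exp" 0] by (auto intro: DERIV_exp)

lemma rsmooth_diff: "rsmooth U f \<Longrightarrow> rsmooth U h \<Longrightarrow> rsmooth U (\<lambda>x. f x - h x)"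
  using rsmooth_add[of U f "\<lambda>x. (-1) * h x"] rsmooth_mult[of U "\<lambda>x. -1" h] by simp

lemma rsmooth_inverse [simp]: "0 \<notin> U \<Longrightarrow> rsmooth U inverse"
proof -
  assume U: "0 \<notin> U"
  have "rsmooth U ((\<lambda>k x::real. (-1)^k * fact k * inverse x ^ Suc k) 0)"
  proof (rule rsmoothI[where F = "\<lambda>k x::real. (-1)^k * fact k * inverse x ^ Suc k"])
    fix k and x :: real assume "x \<in> U"
    then have "x \<noteq> 0" using U by auto
    have "((\<lambda>x. (-1)^k * fact k * inverse x ^ Suc k) has_real_derivative
       (-1)^k * fact k * (of_nat (Suc k) * (inverse x ^ k * - (inverse x ^ 2)))) (at x)"
      using \<open>x \<noteq> 0\<close> 
      by (auto intro!: derivative_eq_intros simp: power2_eq_square algebra_simps simp del: power_Suc)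
    then show "((\<lambda>x. (-1)^k * fact k * inverse x ^ Suc k) has_real_derivative
       (-1)^(Suc k) * fact (Suc k) * inverse x ^ Suc (Suc k)) (at x)"
      by (simp add: power2_eq_square algebra_simps)
  qed
  then show ?thesis by simp
qed

lemma rsmooth_deriv:
  assumes "rsmooth U f" "open U" "\<And>x. x \<in> U \<Longrightarrow> (f has_real_derivative f' x) (at x)"
  shows "rsmooth U f'"
  unfolding rsmooth_def
proof
  fix k
  obtain h where h: "\<forall>x\<in>U. (f has_real_derivative h x) (at x)" "rC_on k U h"
    using assms(1)[unfolded rsmooth_def, rule_format, of "Suc k"] by auto
  then have "h x = f' x" if "x \<in> U" for x using that assms(3) DERIV_unique by blast
  then show "rC_on k U f'" using rC_on_cong[of U h f' k] h assms(2) by blast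
qed

lemma rsmooth_antideriv:
  assumes "rsmooth U f'" "\<And>x. x \<in> U \<Longrightarrow> (f has_real_derivative f' x) (at x)"
  shows "rsmooth U f"
  unfolding rsmooth_def
proof
  fix k
  have "rC_on (Suc k) U f" using assms unfolding rsmooth_def by auto
  then show "rC_on k U f" by (rule rC_on_SucD)
qed

lemma rsmooth_ln [simp]: "rsmooth {0<..} ln"
  by (rule rsmooth_antideriv[of _ inverse]) (auto intro!: derivative_eq_intros simp: inverse_eq_divide)

lemma rsmooth_sin [simp]: "rsmooth U sin" and rsmooth_cos [simp]: "rsmooth U cos"
proof -
  \<comment> \<open>Differentiation permutes these four functions cyclically, so they share one
    induction.\<close>
  have "rC_on k U sin \<and> rC_on k U cos \<and> rC_on k U (\<lambda>x. - sin x) \<and> rC_on k U (\<lambda>x. - cos x)" for k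
  proof (induction k)
    case (Suc k)
    have "rC_on (Suc k) U sin" using Suc by (auto intro!: exI[of _ cos] derivative_eq_intros)
    moreover have "rC_on (Suc k) U cos"
      using Suc by (auto intro!: exI[of _ "\<lambda>x. - sin x"] derivative_eq_intros)
    moreover have "rC_on (Suc k) U (\<lambda>x. - sin x)"
      using Suc by (auto intro!: exI[of _ "\<lambda>x. - cos x"] derivative_eq_intros)
    moreover have "rC_on (Suc k) U (\<lambda>x. - cos x)"
      using Suc by (auto intro!: exI[of _ sin] derivative_eq_intros)
    ultimately show ?case by blast
  qed (auto intro!: continuous_intros)
  then show "rsmooth U sin" "rsmooth U cos" by (auto simp: rsmooth_def)
qed

lemma Ck_on_compose:
  assumes "open U"
  shows "rC_on k V f \<Longrightarrow> Ck_on k U u \<Longrightarrow> u ` U \<subseteq> V \<Longrightarrow> Ck_on k U (\<lambda>x. f (u x))"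
proof (induction k arbitrary: f)
  case 0
  then show ?case by (auto intro: continuous_on_compose2)
next
  case (Suc k)
  then obtain f' where f': "\<forall>x\<in>V. (f has_real_derivative f' x) (at x)" "rC_on k V f'" by auto
  have d: "((\<lambda>x. f (u x)) has_derivative (\<lambda>h. f' (u x) * frechet_derivative u (at x) h)) (at x)"
    if "x \<in> U" for x
  proof -
    have "(u has_derivative frechet_derivative u (at x)) (at x)"
      using Suc.prems(2) that frechet_derivative_works by auto
    moreover have "(f has_derivative (\<lambda>h. f' (u x) * h)) (at (u x))"
      using f'(1) Suc.prems(3) that by (auto simp: has_field_derivative_def)
    ultimately show ?thesis using has_derivative_compose by blast
  qed
  have "Ck_on k U (partial_deriv i (\<lambda>x. f (u x))) \<longleftrightarrow>
        Ck_on k U (\<lambda>x. f' (u x) * partial_deriv i u x)" for i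
    by (rule Ck_on_cong[OF assms]) (use partial_deriv_eqI[OF d] in \<open>simp add: partial_deriv_def\<close>)
  moreover have "Ck_on k U (\<lambda>x. f' (u x))"
    using Suc.IH[OF f'(2) Ck_on_SucD[OF Suc.prems(2)] Suc.prems(3)] .
  ultimately show ?case
    using d Suc.prems(2) by (auto simp: differentiable_def intro!: Ck_on_mult[OF assms])
qed

lemma smooth_on_compose:
  "open U \<Longrightarrow> rsmooth V f \<Longrightarrow> smooth_on U u \<Longrightarrow> u ` U \<subseteq> V \<Longrightarrow> smooth_on U (\<lambda>x. f (u x))"
  unfolding smooth_on_def rsmooth_def using Ck_on_compose by blast

lemma smooth_on_inverse:
  "open U \<Longrightarrow> smooth_on U u \<Longrightarrow> (\<And>x. x \<in> U \<Longrightarrow> u x \<noteq> 0) \<Longrightarrow> smooth_on U (\<lambda>x. inverse (u x))"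
  by (rule smooth_on_compose[of U "- {0}" inverse u]) auto

lemma smooth_on_divide:
  "open U \<Longrightarrow> smooth_on U f \<Longrightarrow> smooth_on U u \<Longrightarrow> (\<And>x. x \<in> U \<Longrightarrow> u x \<noteq> 0) \<Longrightarrow>
   smooth_on U (\<lambda>x. f x / u x)"
  unfolding divide_inverse by (intro smooth_on_mult smooth_on_inverse)

subsection \<open>Directional derivatives\<close>

text \<open>The direction comes first and is constant, so that iterates such as
  \<open>dd u (dd v f)\<close> are mixed second derivatives along constant fields.\<close>

definition dd :: "real^'n::finite \<Rightarrow> (real^'n \<Rightarrow> real) \<Rightarrow> real^'n \<Rightarrow> real" where
  "dd v f x = frechet_derivative f (at x) v"

lemma dd_eqI: "(f has_derivative f') (at x) \<Longrightarrow> dd v f x = f' v"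
  unfolding dd_def using frechet_derivative_at by metis

lemma has_derivative_dd: "f differentiable (at x) \<Longrightarrow> (f has_derivative (\<lambda>v. dd v f x)) (at x)"
  unfolding dd_def using frechet_derivative_works by metis

lemma partial_deriv_dd: "partial_deriv i f x = dd (axis i 1) f x"
  by (simp add: partial_deriv_def dd_def)

lemma dd_sum_partial:
  assumes "f differentiable (at x)"
  shows "dd v f x = (\<Sum>i\<in>UNIV. v $ i * partial_deriv i f x)"
proof -
  have lin: "linear (\<lambda>v. dd v f x)"
    using has_derivative_dd[OF assms] has_derivative_linear by blast
  have "dd (\<Sum>i\<in>UNIV. v $ i *\<^sub>R axis i 1) f x = (\<Sum>i\<in>UNIV. v $ i *\<^sub>R dd (axis i 1) f x)"
    unfolding linear_sum[OF lin] linear_cmul[OF lin] ..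
  then show ?thesis
    using basis_expansion[of v] by (simp add: partial_deriv_dd scalar_mult_eq_scaleR)
qed

lemma dd_cong_open:
  assumes "open U" "x \<in> U" "\<And>y. y \<in> U \<Longrightarrow> f y = h y"
  shows "dd v f x = dd v h x"
proof -
  have "(f has_derivative D) (at x) \<longleftrightarrow> (h has_derivative D) (at x)" for D
    using assms has_derivative_transform_within_open[of f D x UNIV U h]
      has_derivative_transform_within_open[of h D x UNIV U f] by auto
  then show ?thesis
    by (simp add: dd_def frechet_derivative_def)
qed

lemma smooth_on_dd:
  assumes "open U" "smooth_on U f"
  shows "smooth_on U (dd v f)"
proof -
  have "smooth_on U (dd v f) \<longleftrightarrow> smooth_on U (\<lambda>x. \<Sum>i\<in>UNIV. v $ i * partial_deriv i f x)"
    by (rule smooth_on_cong[OF assms(1)])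
      (use assms smooth_on_differentiable dd_sum_partial in blast)
  then show ?thesis
    using assms by (auto intro!: smooth_on_sum smooth_on_mult smooth_on_partial)
qed

lemma dd_const [simp]: "dd v (\<lambda>x. c) x = 0"
  by (simp add: dd_def)

lemma dd_component [simp]: "dd v (\<lambda>x. x $ i) x = v $ i"
  by (rule dd_eqI) (auto intro!: bounded_linear_imp_has_derivative bounded_linear_vec_nth)

lemma dd_add:
  "f differentiable (at x) \<Longrightarrow> h differentiable (at x) \<Longrightarrow>
   dd v (\<lambda>x. f x + h x) x = dd v f x + dd v h x"
  using dd_eqI[OF has_derivative_add[OF has_derivative_dd has_derivative_dd]] by blast

lemma dd_diff:
  "f differentiable (at x) \<Longrightarrow> h differentiable (at x) \<Longrightarrow>
   dd v (\<lambda>x. f x - h x) x = dd v f x - dd v h x"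
  using dd_eqI[OF has_derivative_diff[OF has_derivative_dd has_derivative_dd]] by blast

lemma dd_mult:
  "f differentiable (at x) \<Longrightarrow> h differentiable (at x) \<Longrightarrow>
   dd v (\<lambda>x. f x * h x) x = f x * dd v h x + dd v f x * h x"
  using dd_eqI[OF has_derivative_mult[OF has_derivative_dd has_derivative_dd]] by blast

lemma dd_sum:
  "(\<And>a. a \<in> A \<Longrightarrow> f a differentiable (at x)) \<Longrightarrow>
   dd v (\<lambda>x. \<Sum>a\<in>A. f a x) x = (\<Sum>a\<in>A. dd v (f a) x)"
  using dd_eqI[OF has_derivative_sum[of A f "\<lambda>a v. dd v (f a) x" "at x"]] has_derivative_dd
  by blast

lemma dd_real_compose:
  assumes "(f has_real_derivative f') (at (u x))" "u differentiable (at x)"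
  shows "dd v (\<lambda>x. f (u x)) x = f' * dd v u x"
proof (rule dd_eqI)
  show "((\<lambda>x. f (u x)) has_derivative (\<lambda>v. f' * dd v u x)) (at x)"
    using has_derivative_compose[OF has_derivative_dd[OF assms(2)], of f "\<lambda>h. f' * h"] assms(1)
    by (simp add: has_field_derivative_def)
qed

lemma dd_linear: "f differentiable (at x) \<Longrightarrow> linear (\<lambda>v. dd v f x)"
  using has_derivative_dd has_derivative_linear by blast

lemma dd_scaleR: "f differentiable (at x) \<Longrightarrow> dd (c *\<^sub>R v) f x = c * dd v f x"
  using linear_cmul[OF dd_linear, of f x c v] by simp

lemma dd_plus: "f differentiable (at x) \<Longrightarrow> dd (v + w) f x = dd v f x + dd w f x"
  using linear_add[OF dd_linear, of f x v w] by simp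

text \<open>The mixed second difference of \<open>f\<close> along \<open>h u\<close> and
  \<open>h v\<close> is symmetric in the two directions, and two applications of the mean value
  theorem identify it with \<open>h * h\<close> times either mixed derivative at a nearby
  point.\<close>

lemma dd_commute:
  fixes f :: "real^'n::finite \<Rightarrow> real"
  assumes sm: "smooth_on UNIV f"
  shows "dd u (dd v f) x = dd v (dd u f) x"
proof -
  have sd: "smooth_on UNIV (dd w f)" "smooth_on UNIV (dd w (dd w' f))" for w w'
    using smooth_on_dd sm open_UNIV by blast+
  have along: "((\<lambda>t. h (a + t *\<^sub>R w)) has_real_derivative dd w h (a + t *\<^sub>R w)) (at t)"
    if "smooth_on UNIV h" for h :: "real^'n \<Rightarrow> real" and a w t
  proof -
    have "((\<lambda>t. a + t *\<^sub>R w) has_derivative (\<lambda>s. s *\<^sub>R w)) (at t)"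
      by (auto intro!: derivative_eq_intros)
    moreover have D: "(h has_derivative (\<lambda>v. dd v h (a + t *\<^sub>R w))) (at (a + t *\<^sub>R w))"
      using that smooth_on_differentiable has_derivative_dd by blast
    ultimately have "((\<lambda>t. h (a + t *\<^sub>R w)) has_derivative (\<lambda>s. dd (s *\<^sub>R w) h (a + t *\<^sub>R w))) (at t)"
      by (rule has_derivative_compose)
    moreover have "dd (s *\<^sub>R w) h (a + t *\<^sub>R w) = dd w h (a + t *\<^sub>R w) * s" for s
      using linear_cmul[OF has_derivative_linear[OF D], of s w] by simp
    ultimately show ?thesis
      by (simp add: has_field_derivative_def)
  qed
  have mv: "\<exists>s t. 0 < s \<and> s < h \<and> 0 < t \<and> t < h \<and>
      f (x + h *\<^sub>R a + h *\<^sub>R b) - f (x + h *\<^sub>R a) - f (x + h *\<^sub>R b) + f x =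
      h * h * dd b (dd a f) (x + s *\<^sub>R a + t *\<^sub>R b)" if hp: "h > 0" for h a b
  proof -
    define p where "p t = f ((x + h *\<^sub>R b) + t *\<^sub>R a) - f (x + t *\<^sub>R a)" for t
    define p' where "p' t = dd a f ((x + h *\<^sub>R b) + t *\<^sub>R a) - dd a f (x + t *\<^sub>R a)" for t
    have "(p has_real_derivative p' t) (at t)" for t
      unfolding p_def p'_def by (intro DERIV_diff along sm)
    then obtain s where s: "0 < s" "s < h" "p h - p 0 = (h - 0) * p' s"
      using MVT2[of 0 h p p', OF hp] by auto
    obtain t where t: "0 < t" "t < h" "dd a f ((x + s *\<^sub>R a) + h *\<^sub>R b) - dd a f ((x + s *\<^sub>R a) + 0 *\<^sub>R b)
        = (h - 0) * dd b (dd a f) ((x + s *\<^sub>R a) + t *\<^sub>R b)"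
      using MVT2[of 0 h "\<lambda>t. dd a f ((x + s *\<^sub>R a) + t *\<^sub>R b)" "\<lambda>t. dd b (dd a f) ((x + s *\<^sub>R a) + t *\<^sub>R b)"]
        along[OF sd(1)[of a], of "x + s *\<^sub>R a" b] hp by blast
    have "p' s = h * dd b (dd a f) (x + s *\<^sub>R a + t *\<^sub>R b)"
      using t(3) by (simp add: p'_def algebra_simps)
    then have "p h - p 0 = h * h * dd b (dd a f) (x + s *\<^sub>R a + t *\<^sub>R b)" using s(3) by simp
    then show ?thesis using s t by (intro exI[of _ s] exI[of _ t]) (simp add: p_def algebra_simps)
  qed
  have "\<exists>y z. dist y x \<le> h * (norm u + norm v) \<and> dist z x \<le> h * (norm u + norm v) \<and>
      dd u (dd v f) y = dd v (dd u f) z" if "h > 0" for h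
  proof -
    have bd: "dist (x + s *\<^sub>R a + t *\<^sub>R b) x \<le> h * (norm a + norm b)"
      if "0 < s" "s < h" "0 < t" "t < h" for s t a b
    proof -
      have "norm (s *\<^sub>R a + t *\<^sub>R b) \<le> s * norm a + t * norm b"
        using norm_triangle_ineq[of "s *\<^sub>R a" "t *\<^sub>R b"] that by simp
      also have "\<dots> \<le> h * norm a + h * norm b"
        using that by (intro add_mono mult_right_mono) auto
      finally show ?thesis by (simp add: dist_norm algebra_simps)
    qed
    obtain s t where 1: "0 < s" "s < h" "0 < t" "t < h"
      "f (x + h *\<^sub>R u + h *\<^sub>R v) - f (x + h *\<^sub>R u) - f (x + h *\<^sub>R v) + f x =
      h * h * dd v (dd u f) (x + s *\<^sub>R u + t *\<^sub>R v)" using mv[OF \<open>h > 0\<close>] by blast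
    obtain s' t' where 2: "0 < s'" "s' < h" "0 < t'" "t' < h"
      "f (x + h *\<^sub>R v + h *\<^sub>R u) - f (x + h *\<^sub>R v) - f (x + h *\<^sub>R u) + f x =
      h * h * dd u (dd v f) (x + s' *\<^sub>R v + t' *\<^sub>R u)" using mv[OF \<open>h > 0\<close>] by blast
    have "h * h * dd v (dd u f) (x + s *\<^sub>R u + t *\<^sub>R v) = h * h * dd u (dd v f) (x + s' *\<^sub>R v + t' *\<^sub>R u)"
      using 1(5) 2(5) by (simp add: algebra_simps)
    then have "dd u (dd v f) (x + s' *\<^sub>R v + t' *\<^sub>R u) = dd v (dd u f) (x + s *\<^sub>R u + t *\<^sub>R v)"
      using that by simp
    moreover have "dist (x + s' *\<^sub>R v + t' *\<^sub>R u) x \<le> h * (norm u + norm v)"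
      using bd[OF 2(1-4), of v u] by (simp add: add.commute)
    ultimately show ?thesis using bd[OF 1(1-4), of u v] by blast
  qed
  then obtain Y Z where YZ: "\<And>h. h > 0 \<Longrightarrow> dist (Y h) x \<le> h * (norm u + norm v)"
     "\<And>h. h > 0 \<Longrightarrow> dist (Z h) x \<le> h * (norm u + norm v)"
     "\<And>h. h > 0 \<Longrightarrow> dd u (dd v f) (Y h) = dd v (dd u f) (Z h)"
    by metis
  \<comment> \<open>Along the steps \<open>h = 1 / (k + 1)\<close> both intermediate points tend to
    \<open>x\<close>, and the mixed derivatives are continuous there.\<close>
  define e where "e k = inverse (real (Suc k))" for k
  have e: "e k > 0" for k by (simp add: e_def)
  have e0: "(\<lambda>k. e k * (norm u + norm v)) \<longlonglongrightarrow> 0"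
    using LIMSEQ_inverse_real_of_nat unfolding e_def by (rule tendsto_mult_left_zero)
  have lim: "(\<lambda>k. P (e k)) \<longlonglongrightarrow> x"
    if "\<And>h. h > 0 \<Longrightarrow> dist (P h) x \<le> h * (norm u + norm v)" for P
    by (rule metric_tendsto_imp_tendsto[OF e0]) (use that e in \<open>auto intro!: always_eventually order_trans[OF _ abs_ge_self]\<close>)
  have c: "isCont (dd w (dd w' f)) x" for w w'
    using smooth_on_continuous[OF sd(2)] by (simp add: continuous_on_eq_continuous_at)
  have "(\<lambda>k. dd u (dd v f) (Y (e k))) \<longlonglongrightarrow> dd u (dd v f) x"
    using lim[OF YZ(1)] c isCont_tendsto_compose by blast
  moreover have "(\<lambda>k. dd v (dd u f) (Z (e k))) \<longlonglongrightarrow> dd v (dd u f) x"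
    using lim[OF YZ(2)] c isCont_tendsto_compose by blast
  ultimately show ?thesis using YZ(3)[OF e] LIMSEQ_unique by simp
qed

subsection \<open>Curvature in terms of second derivatives of the metric\<close>

lemma riemannian_metricD:
  assumes "riemannian_metric g"
  shows "smooth_on UNIV (\<lambda>x. g x $ i $ j)" "g x $ i $ j = g x $ j $ i"
    "v \<noteq> 0 \<Longrightarrow> 0 < riem_inner g x v v"
  using assms unfolding riemannian_metric_def smooth_fun_iff riem_inner_def
  by (auto simp: transpose_def vec_eq_iff)

lemma riem_inner_sum: "riem_inner g x a b = (\<Sum>i\<in>UNIV. \<Sum>j\<in>UNIV. a $ i * b $ j * g x $ i $ j)"
  by (simp add: riem_inner_def inner_vec_def matrix_vector_mult_def sum_distrib_left mult_ac)

lemma riem_inner_commute: "riemannian_metric g \<Longrightarrow> riem_inner g x a b = riem_inner g x b a"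
  unfolding riem_inner_sum
  by (subst sum.swap) (intro sum.cong refl, simp add: riemannian_metricD(2)[of g x] mult.commute)

lemma riem_inner_linear:
  "riem_inner g x (a + b) c = riem_inner g x a c + riem_inner g x b c"
  "riem_inner g x (a - b) c = riem_inner g x a c - riem_inner g x b c"
  "riem_inner g x (r *\<^sub>R a) c = r * riem_inner g x a c"
  "riem_inner g x a (b + c) = riem_inner g x a b + riem_inner g x a c"
  "riem_inner g x a (b - c) = riem_inner g x a b - riem_inner g x a c"
  "riem_inner g x a (r *\<^sub>R c) = r * riem_inner g x a c"
  by (simp_all add: riem_inner_def inner_simps matrix_vector_right_distrib
      matrix_vector_mult_diff_distrib matrix_vector_mult_scaleR)

lemma riem_inner_nondegenerate:
  assumes "riemannian_metric g" "\<And>w. riem_inner g x a w = riem_inner g x b w"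
  shows "a = b"
proof -
  have "riem_inner g x (a - b) (a - b) = 0"
    using assms(2)[of "a - b"] by (simp add: riem_inner_linear)
  then show ?thesis using riemannian_metricD(3)[OF assms(1), of "a - b" x] by force
qed

lemma smooth_riem_inner:
  assumes "riemannian_metric g"
  shows "smooth_on UNIV (\<lambda>x. riem_inner g x a b)"
  unfolding riem_inner_sum
  by (intro smooth_on_sum smooth_on_mult riemannian_metricD assms) auto

lemma riemannian_metric_det:
  assumes "riemannian_metric g"
  shows "det (g x) \<noteq> 0"
proof -
  have "v = 0" if "g x *v v = 0" for v
    using riemannian_metricD(3)[OF assms, of v x] that by (force simp: riem_inner_def)
  then show ?thesis
    using matrix_left_invertible_ker invertible_left_inverse invertible_det_nz by metis
qed

lemma matrix_inv_right: "invertible A \<Longrightarrow> A ** matrix_inv A = mat 1"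
  unfolding invertible_def matrix_inv_def by (rule conjunct1, rule someI_ex)

text \<open>Cramer's rule turns an entry of the inverse into a quotient of polynomials in the
  entries of \<open>g x\<close>, with nonvanishing denominator.\<close>

lemma smooth_matrix_inv:
  assumes "riemannian_metric g"
  shows "smooth_on UNIV (\<lambda>x. matrix_inv (g x) $ k $ l)"
proof -
  have eq: "matrix_inv (g x) $ k $ l =
      det (\<chi> i j. if j = k then axis l 1 $ i else g x $ i $ j) / det (g x)" for x
  proof -
    have "g x ** matrix_inv (g x) = mat 1"
      using riemannian_metric_det[OF assms] invertible_det_nz matrix_inv_right by blast
    then have "g x *v (matrix_inv (g x) *v axis l 1) = axis l 1"
      by (simp add: matrix_vector_mul_assoc)
    then have "matrix_inv (g x) *v axis l 1 =
        (\<chi> k. det (\<chi> i j. if j = k then axis l 1 $ i else g x $ i $ j) / det (g x))"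
      using cramer[OF riemannian_metric_det[OF assms]] by blast
    then show ?thesis
      by (simp add: matrix_vector_mul_component inner_axis vec_eq_iff)
  qed
  have s: "smooth_on UNIV (\<lambda>x. if b then (c::real) else g x $ i $ j)" for b c i j
    using riemannian_metricD(1)[OF assms] by (cases b) auto
  show ?thesis
    unfolding eq det_def vec_lambda_beta
    by (intro smooth_on_divide smooth_on_sum smooth_on_mult smooth_on_prod s
        riemannian_metricD assms)
      (use riemannian_metric_det[OF assms] in \<open>auto simp: det_def\<close>)
qed

lemma smooth_christoffel:
  assumes "riemannian_metric g"
  shows "smooth_on UNIV (christoffel g k i j)"
proof -
  have "christoffel g k i j = (\<lambda>x. (\<Sum>l\<in>UNIV. matrix_inv (g x) $ k $ l *
        (partial_deriv i (\<lambda>y. g y $ j $ l) x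
         + partial_deriv j (\<lambda>y. g y $ i $ l) x
         - partial_deriv l (\<lambda>y. g y $ i $ j) x)) / 2)"
    by (simp add: christoffel_def fun_eq_iff)
  moreover have "smooth_on UNIV \<dots>"
    by (intro smooth_on_divide smooth_on_sum smooth_on_mult smooth_on_add smooth_on_diff
        smooth_matrix_inv smooth_on_partial riemannian_metricD(1) assms) auto
  ultimately show ?thesis by simp
qed

lemma smooth_UNIV_differentiable: "smooth_on UNIV f \<Longrightarrow> f differentiable (at x)"
  using smooth_on_differentiable by blast

text \<open>The covariant derivative of the constant field \<open>v\<close> along \<open>u\<close>:
  the Christoffel symbols as a vector-valued bilinear map.\<close>

definition christoffel_vec ::
    "(real^'n::finite \<Rightarrow> real^'n^'n) \<Rightarrow> real^'n \<Rightarrow> real^'n \<Rightarrow> real^'n \<Rightarrow> real^'n" where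
  "christoffel_vec g u v x = (\<chi> k. \<Sum>i\<in>UNIV. \<Sum>j\<in>UNIV. u $ i * v $ j * christoffel g k i j x)"

lemma smooth_christoffel_vec:
  "riemannian_metric g \<Longrightarrow> smooth_on UNIV (\<lambda>x. christoffel_vec g u v x $ k)"
  unfolding christoffel_vec_def vec_lambda_beta
  by (intro smooth_on_sum smooth_on_mult smooth_christoffel) auto

lemma dd_riem_inner:
  assumes "riemannian_metric g"
  shows "dd w (\<lambda>y. riem_inner g y a b) x =
    (\<Sum>i\<in>UNIV. \<Sum>j\<in>UNIV. a $ i * b $ j * dd w (\<lambda>y. g y $ i $ j) x)"
proof -
  note d = smooth_UNIV_differentiable[OF riemannian_metricD(1)[OF assms]]
  show ?thesis
    unfolding riem_inner_sum
    by (simp add: dd_sum dd_mult d differentiable_mult differentiable_sum)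
qed

text \<open>The product rule with the field frozen at its value at \<open>x\<close> in the first
  term; the field will itself be a Christoffel vector.\<close>

lemma dd_riem_inner_field:
  assumes g: "riemannian_metric g" and c: "\<And>k. smooth_on UNIV (\<lambda>y. c y $ k)"
  shows "dd w (\<lambda>y. riem_inner g y (c y) b) x =
    dd w (\<lambda>y. riem_inner g y (c x) b) x + riem_inner g x (\<chi> k. dd w (\<lambda>y. c y $ k) x) b"
proof -
  note d = smooth_UNIV_differentiable[OF riemannian_metricD(1)[OF assms(1)]]
  note d' = smooth_UNIV_differentiable[OF c]
  show ?thesis
    unfolding dd_riem_inner[OF g] unfolding riem_inner_sum
    by (simp add: dd_sum dd_mult d d' differentiable_mult differentiable_sum
        sum.distrib[symmetric] algebra_simps)
qed

lemma christoffel_lower: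
  assumes "riemannian_metric g"
  shows "(\<Sum>a\<in>UNIV. g x $ b $ a * christoffel g a i j x) =
    (partial_deriv i (\<lambda>y. g y $ j $ b) x + partial_deriv j (\<lambda>y. g y $ i $ b) x
      - partial_deriv b (\<lambda>y. g y $ i $ j) x) / 2"
proof -
  define T where "T l = (partial_deriv i (\<lambda>y. g y $ j $ l) x + partial_deriv j (\<lambda>y. g y $ i $ l) x
      - partial_deriv l (\<lambda>y. g y $ i $ j) x)" for l
  have inv: "g x ** matrix_inv (g x) = mat 1"
    using riemannian_metric_det[OF assms] invertible_det_nz matrix_inv_right by blast
  have "(\<Sum>a\<in>UNIV. g x $ b $ a * christoffel g a i j x) =
      (\<Sum>a\<in>UNIV. \<Sum>l\<in>UNIV. g x $ b $ a * matrix_inv (g x) $ a $ l * T l) / 2"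
    by (simp add: christoffel_def T_def sum_distrib_left sum_divide_distrib mult_ac)
  also have "\<dots> = (\<Sum>l\<in>UNIV. (g x ** matrix_inv (g x)) $ b $ l * T l) / 2"
    by (subst sum.swap) (simp add: matrix_matrix_mult_def sum_distrib_right)
  also have "\<dots> = T b / 2"
    unfolding inv mat_def by (simp add: if_distrib[of "\<lambda>z. z * _"] cong: if_cong)
  finally show ?thesis by (simp add: T_def)
qed

lemma sum3_rotate: "(\<Sum>j\<in>B. \<Sum>b\<in>C. \<Sum>i\<in>A. f i j b) = (\<Sum>i\<in>A. \<Sum>j\<in>B. \<Sum>b\<in>C. f i j b)"
proof -
  have "(\<Sum>j\<in>B. \<Sum>b\<in>C. \<Sum>i\<in>A. f i j b) = (\<Sum>j\<in>B. \<Sum>i\<in>A. \<Sum>b\<in>C. f i j b)"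
    by (intro sum.cong refl sum.swap)
  then show ?thesis using sum.swap[of "\<lambda>j i. \<Sum>b\<in>C. f i j b" A B] by simp
qed

lemma sum4_rotate: "(\<Sum>a\<in>A. \<Sum>b\<in>B. \<Sum>i\<in>C. \<Sum>j\<in>D. f a b i j) = (\<Sum>i\<in>C. \<Sum>j\<in>D. \<Sum>b\<in>B. \<Sum>a\<in>A. f a b i j)"
proof -
  have "(\<Sum>a\<in>A. \<Sum>b\<in>B. \<Sum>i\<in>C. \<Sum>j\<in>D. f a b i j) = (\<Sum>i\<in>C. \<Sum>a\<in>A. \<Sum>b\<in>B. \<Sum>j\<in>D. f a b i j)"
    by (rule sum3_rotate)
  also have "\<dots> = (\<Sum>i\<in>C. \<Sum>j\<in>D. \<Sum>a\<in>A. \<Sum>b\<in>B. f a b i j)"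
    by (rule sum.cong[OF refl], rule sum3_rotate)
  also have "\<dots> = (\<Sum>i\<in>C. \<Sum>j\<in>D. \<Sum>b\<in>B. \<Sum>a\<in>A. f a b i j)"
    by (intro sum.cong refl sum.swap)
  finally show ?thesis .
qed

text \<open>Constant fields commute, so the bracket terms of the Koszul formula vanish. Later
  computations reach the Christoffel symbols through this identity and so avoid the inverse
  matrix.\<close>

lemma koszul:
  assumes g: "riemannian_metric g"
  shows "riem_inner g x (christoffel_vec g u v x) w =
    (dd u (\<lambda>y. riem_inner g y v w) x + dd v (\<lambda>y. riem_inner g y u w) x
      - dd w (\<lambda>y. riem_inner g y u v) x) / 2"
proof -
  note d = smooth_UNIV_differentiable[OF riemannian_metricD(1)[OF g]]
  define G where "G k i j = partial_deriv k (\<lambda>y. g y $ i $ j) x" for k i j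
  have D: "dd a (\<lambda>y. riem_inner g y b c) x = (\<Sum>i\<in>UNIV. \<Sum>j\<in>UNIV. \<Sum>k\<in>UNIV. a $ k * b $ i * c $ j * G k i j)"
    for a b c
    unfolding dd_riem_inner[OF g] dd_sum_partial[OF d] G_def
    by (simp add: sum_distrib_left mult_ac)
  have D1: "dd u (\<lambda>y. riem_inner g y v w) x =
      (\<Sum>i\<in>UNIV. \<Sum>j\<in>UNIV. \<Sum>b\<in>UNIV. u $ i * v $ j * w $ b * G i j b)"
    unfolding D by (rule sum3_rotate)
  have D2: "dd v (\<lambda>y. riem_inner g y u w) x =
      (\<Sum>i\<in>UNIV. \<Sum>j\<in>UNIV. \<Sum>b\<in>UNIV. u $ i * v $ j * w $ b * G j i b)"
    unfolding D by (rule sum.cong[OF refl], subst sum.swap) (simp add: mult_ac)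
  have D3: "dd w (\<lambda>y. riem_inner g y u v) x =
      (\<Sum>i\<in>UNIV. \<Sum>j\<in>UNIV. \<Sum>b\<in>UNIV. u $ i * v $ j * w $ b * G b i j)"
    unfolding D by (simp add: mult_ac)
  have "riem_inner g x (christoffel_vec g u v x) w =
      (\<Sum>a\<in>UNIV. \<Sum>b\<in>UNIV. \<Sum>i\<in>UNIV. \<Sum>j\<in>UNIV.
         u $ i * v $ j * w $ b * (g x $ b $ a * christoffel g a i j x))"
    unfolding riem_inner_sum christoffel_vec_def vec_lambda_beta sum_distrib_right
    using riemannian_metricD(2)[OF g] by (intro sum.cong refl) (simp add: mult_ac)
  also have "\<dots> = (\<Sum>i\<in>UNIV. \<Sum>j\<in>UNIV. \<Sum>b\<in>UNIV. u $ i * v $ j * w $ b *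
      (\<Sum>a\<in>UNIV. g x $ b $ a * christoffel g a i j x))"
    unfolding sum_distrib_left by (rule sum4_rotate)
  also have "\<dots> = (dd u (\<lambda>y. riem_inner g y v w) x + dd v (\<lambda>y. riem_inner g y u w) x
      - dd w (\<lambda>y. riem_inner g y u v) x) / 2"
    unfolding christoffel_lower[OF g] D1 D2 D3 G_def[symmetric]
    by (simp add: sum_divide_distrib algebra_simps add_divide_distrib diff_divide_distrib
        sum.distrib[symmetric] sum_subtractf[symmetric])
  finally show ?thesis .
qed

lemma christoffel_vec_commute:
  "riemannian_metric g \<Longrightarrow> christoffel_vec g u v x = christoffel_vec g v u x"
  by (rule riem_inner_nondegenerate[where g = g and x = x])
    (auto simp: koszul riem_inner_commute[of g _ u v])

lemma metric_compatible:
  assumes "riemannian_metric g"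
  shows "dd u (\<lambda>y. riem_inner g y v w) x =
    riem_inner g x (christoffel_vec g u v x) w + riem_inner g x v (christoffel_vec g u w x)"
  unfolding riem_inner_commute[OF assms, of x v] koszul[OF assms]
  by (simp add: riem_inner_commute[OF assms, of _ w] riem_inner_commute[OF assms, of _ v u] field_simps)

lemma riem_curvature_christoffel:
  assumes g: "riemannian_metric g"
  shows "riem_curvature g x u v w =
    (\<chi> l. dd u (\<lambda>y. christoffel_vec g v w y $ l) x) - (\<chi> l. dd v (\<lambda>y. christoffel_vec g u w y $ l) x)
    + christoffel_vec g u (christoffel_vec g v w x) x - christoffel_vec g v (christoffel_vec g u w x) x"
proof -
  note d = smooth_UNIV_differentiable[OF smooth_christoffel[OF g]]
  have A: "dd a (\<lambda>y. christoffel_vec g b c y $ l) x = (\<Sum>j\<in>UNIV. \<Sum>k\<in>UNIV. \<Sum>i\<in>UNIV.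
      partial_deriv i (christoffel g l j k) x * a $ i * b $ j * c $ k)" for a b c l
  proof -
    have "dd a (\<lambda>y. christoffel_vec g b c y $ l) x =
        (\<Sum>j\<in>UNIV. \<Sum>k\<in>UNIV. b $ j * c $ k * dd a (christoffel g l j k) x)"
      unfolding christoffel_vec_def vec_lambda_beta
      by (simp add: dd_sum dd_mult d differentiable_mult differentiable_sum)
    then show ?thesis
      unfolding dd_sum_partial[OF d] by (simp add: sum_distrib_left mult_ac)
  qed
  have B: "christoffel_vec g a (christoffel_vec g b c x) x $ l = (\<Sum>i\<in>UNIV. \<Sum>m\<in>UNIV. \<Sum>j\<in>UNIV. \<Sum>k\<in>UNIV.
      christoffel g l i m x * christoffel g m j k x * a $ i * b $ j * c $ k)" for a b c l
    unfolding christoffel_vec_def vec_lambda_beta by (simp add: sum_distrib_left sum_distrib_right mult_ac)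
  have A1: "dd u (\<lambda>y. christoffel_vec g v w y $ l) x = (\<Sum>i\<in>UNIV. \<Sum>j\<in>UNIV. \<Sum>k\<in>UNIV.
      partial_deriv i (christoffel g l j k) x * u $ i * v $ j * w $ k)" for l
    unfolding A by (rule sum3_rotate)
  have A2: "dd v (\<lambda>y. christoffel_vec g u w y $ l) x = (\<Sum>i\<in>UNIV. \<Sum>j\<in>UNIV. \<Sum>k\<in>UNIV.
      partial_deriv j (christoffel g l i k) x * u $ i * v $ j * w $ k)" for l
    unfolding A by (subst sum3_rotate, subst sum.swap) (simp add: mult_ac)
  have B1: "christoffel_vec g u (christoffel_vec g v w x) x $ l = (\<Sum>i\<in>UNIV. \<Sum>j\<in>UNIV. \<Sum>k\<in>UNIV. \<Sum>m\<in>UNIV.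
      christoffel g l i m x * christoffel g m j k x * u $ i * v $ j * w $ k)" for l
    unfolding B by (rule sum.cong[OF refl], rule sum3_rotate[symmetric])
  have B2: "christoffel_vec g v (christoffel_vec g u w x) x $ l = (\<Sum>i\<in>UNIV. \<Sum>j\<in>UNIV. \<Sum>k\<in>UNIV. \<Sum>m\<in>UNIV.
      christoffel g l j m x * christoffel g m i k x * u $ i * v $ j * w $ k)" for l
  proof -
    have "christoffel_vec g v (christoffel_vec g u w x) x $ l = (\<Sum>j\<in>UNIV. \<Sum>i\<in>UNIV. \<Sum>k\<in>UNIV. \<Sum>m\<in>UNIV.
      christoffel g l j m x * christoffel g m i k x * v $ j * u $ i * w $ k)"
      unfolding B by (rule sum.cong[OF refl], rule sum3_rotate[symmetric])
    then show ?thesis by (subst sum.swap) (simp add: mult_ac)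
  qed
  show ?thesis
    unfolding vec_eq_iff vector_add_component vector_minus_component A1 A2 B1 B2 vec_lambda_beta
      riem_curvature_def riem_coeff_def
    by (simp add: sum_distrib_right sum.distrib sum_subtractf distrib_right left_diff_distrib)
qed

text \<open>Differentiating the Koszul formula and moving the outer Christoffel symbol to the other
  argument by metric compatibility leaves an expression linear in the second derivatives of the
  metric and quadratic in the Christoffel vectors, which can be estimated term by term.\<close>

lemma curvature_numerator:
  assumes g: "riemannian_metric g"
  shows "riem_inner g x (riem_curvature g x u v v) u =
    dd u (dd v (\<lambda>y. riem_inner g y u v)) x
    - dd u (dd u (\<lambda>y. riem_inner g y v v)) x / 2 - dd v (dd v (\<lambda>y. riem_inner g y u u)) x / 2
    + riem_inner g x (christoffel_vec g u v x) (christoffel_vec g u v x)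
    - riem_inner g x (christoffel_vec g u u x) (christoffel_vec g v v x)"
proof -
  let ?i = "riem_inner g"
  let ?c = "christoffel_vec g"
  have d: "(\<lambda>y. dd a (\<lambda>y. ?i y b c) y) differentiable (at x)" for a b c x
    by (intro smooth_UNIV_differentiable smooth_on_dd smooth_riem_inner g) auto
  \<comment> \<open>The inner product of \<open>?c b v\<close> with \<open>u\<close> is
    differentiated along \<open>a\<close> in two ways: by the product rule, and after rewriting it
    by the Koszul formula.\<close>
  have key: "?i x (\<chi> l. dd a (\<lambda>y. ?c b v y $ l) x) u =
      (dd a (dd b (\<lambda>y. ?i y v u)) x + dd a (dd v (\<lambda>y. ?i y b u)) x - dd a (dd u (\<lambda>y. ?i y b v)) x) / 2
      - ?i x (?c a (?c b v x) x) u - ?i x (?c b v x) (?c a u x)" for a b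
  proof -
    have "dd a (\<lambda>y. ?i y (?c b v y) u) x =
       dd a (\<lambda>y. ?i y (?c b v x) u) x + ?i x (\<chi> l. dd a (\<lambda>y. ?c b v y $ l) x) u"
      by (rule dd_riem_inner_field) (auto intro!: g smooth_christoffel_vec)
    moreover have "dd a (\<lambda>y. ?i y (?c b v y) u) x =
      (dd a (dd b (\<lambda>y. ?i y v u)) x + dd a (dd v (\<lambda>y. ?i y b u)) x - dd a (dd u (\<lambda>y. ?i y b v)) x) / 2"
      unfolding koszul[OF g]
      using dd_mult[of "\<lambda>y. dd b (\<lambda>y. ?i y v u) y + dd v (\<lambda>y. ?i y b u) y - dd u (\<lambda>y. ?i y b v) y" x "\<lambda>_. 1/2" a]
      by (simp add: dd_add dd_diff d differentiable_add differentiable_diff)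
    ultimately show ?thesis using metric_compatible[OF g, of a "?c b v x" u x] by linarith
  qed
  have "?i x (riem_curvature g x u v v) u = 
     (?i x (\<chi> l. dd u (\<lambda>y. ?c v v y $ l) x) u + ?i x (?c u (?c v v x) x) u)
     - (?i x (\<chi> l. dd v (\<lambda>y. ?c u v y $ l) x) u + ?i x (?c v (?c u v x) x) u)"
    unfolding riem_curvature_christoffel[OF g] riem_inner_linear by simp
  also have "\<dots> = dd u (dd v (\<lambda>y. riem_inner g y u v)) x
    - dd u (dd u (\<lambda>y. riem_inner g y v v)) x / 2 - dd v (dd v (\<lambda>y. riem_inner g y u u)) x / 2
    + riem_inner g x (christoffel_vec g u v x) (christoffel_vec g u v x)
    - riem_inner g x (christoffel_vec g u u x) (christoffel_vec g v v x)"
    unfolding key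
    by (simp add: riem_inner_commute[OF g, of _ v u] christoffel_vec_commute[OF g, of v u]
        riem_inner_commute[OF g, of _ "?c v v x"] field_simps)
  finally show ?thesis .
qed

subsection \<open>Curvature in other coordinates\<close>

definition smooth_field :: "(real^'n::finite \<Rightarrow> real^'n) \<Rightarrow> bool" where
  "smooth_field A \<longleftrightarrow> (\<forall>i. smooth_on UNIV (\<lambda>z. A z $ i))"

definition pushforward :: "(real^'n::finite \<Rightarrow> real^'n) \<Rightarrow> real^'n \<Rightarrow> real^'n \<Rightarrow> real^'n" where
  "pushforward \<Phi> a z = (\<chi> i. dd a (\<lambda>z. \<Phi> z $ i) z)"

text \<open>The derivative of the components, without connection term; for
  \<open>A = pushforward \<Phi> a\<close> it is the Hessian of \<open>\<Phi>\<close>.\<close>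

definition field_deriv :: "real^'n::finite \<Rightarrow> (real^'n \<Rightarrow> real^'n) \<Rightarrow> real^'n \<Rightarrow> real^'n" where
  "field_deriv c A z = (\<chi> k. dd c (\<lambda>z. A z $ k) z)"

lemma smooth_fieldD: "smooth_field A \<Longrightarrow> smooth_on UNIV (\<lambda>z. A z $ i)"
  by (simp add: smooth_field_def)

lemma smooth_field_differentiable: "smooth_field A \<Longrightarrow> (\<lambda>z. A z $ i) differentiable (at z)"
  by (rule smooth_UNIV_differentiable[OF smooth_fieldD])

lemma smooth_field_pushforward: "smooth_field \<Phi> \<Longrightarrow> smooth_field (pushforward \<Phi> a)"
  by (simp add: smooth_field_def pushforward_def smooth_on_dd)

lemma smooth_field_deriv: "smooth_field A \<Longrightarrow> smooth_field (field_deriv a A)"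
  by (simp add: smooth_field_def field_deriv_def smooth_on_dd)

lemma has_derivative_pushforward:
  assumes "smooth_field \<Phi>"
  shows "(\<Phi> has_derivative (\<lambda>a. pushforward \<Phi> a z)) (at z)"
proof -
  have "((\<lambda>z. \<Phi> z $ i) has_derivative (\<lambda>a. dd a (\<lambda>z. \<Phi> z $ i) z)) (at z)" for i
    by (intro has_derivative_dd smooth_field_differentiable assms)
  then have "(\<Phi> has_derivative (\<lambda>a. pushforward \<Phi> a z)) (at z within UNIV)"
    unfolding has_derivative_componentwise_within[of \<Phi>]
    by (auto simp: Basis_vec_def inner_axis pushforward_def)
  then show ?thesis by simp
qed

lemma has_derivative_compose_map:
  assumes "smooth_field \<Phi>" "smooth_on UNIV F"
  shows "((\<lambda>z. F (\<Phi> z)) has_derivative (\<lambda>c. dd (pushforward \<Phi> c z) F (\<Phi> z))) (at z)"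
  by (rule has_derivative_compose[OF has_derivative_pushforward[OF assms(1)]
      has_derivative_dd[OF smooth_UNIV_differentiable[OF assms(2)]]])

lemma dd_compose:
  assumes "smooth_field \<Phi>" "smooth_on UNIV F"
  shows "dd c (\<lambda>z. F (\<Phi> z)) z = dd (pushforward \<Phi> c z) F (\<Phi> z)"
  by (rule dd_eqI[OF has_derivative_compose_map[OF assms]])

lemma differentiable_compose_map:
  assumes "smooth_field \<Phi>" "smooth_on UNIV F"
  shows "(\<lambda>z. F (\<Phi> z)) differentiable (at z)"
  using has_derivative_compose_map[OF assms] unfolding differentiable_def by blast

lemma Ck_on_sum:
  assumes "open U"
  shows "(\<And>a. a \<in> A \<Longrightarrow> Ck_on k U (f a)) \<Longrightarrow> Ck_on k U (\<lambda>x. \<Sum>a\<in>A. f a x)"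
  by (induction A rule: infinite_finite_induct) (auto intro: Ck_on_add[OF assms])

text \<open>By the chain rule a partial derivative of the composition is a combination of partial
  derivatives of \<open>F\<close> along \<open>\<Phi>\<close> with smooth coefficients, so the order
  is raised step by step for all \<open>F\<close> simultaneously.\<close>

lemma smooth_on_compose_map:
  assumes \<Phi>: "smooth_field \<Phi>" and "smooth_on UNIV F"
  shows "smooth_on UNIV (\<lambda>z. F (\<Phi> z))"
proof -
  have "Ck_on k UNIV (\<lambda>z. F (\<Phi> z))" for k
    using assms(2)
  proof (induction k arbitrary: F)
    case 0
    have "isCont (\<lambda>z. F (\<Phi> z)) x" for x
      using differentiable_compose_map[OF \<Phi> 0] by (rule differentiable_imp_continuous_within)
    then show ?case by (simp add: continuous_on_eq_continuous_at)
  next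
    case (Suc k)
    have "partial_deriv i (\<lambda>z. F (\<Phi> z)) =
        (\<lambda>z. \<Sum>j\<in>UNIV. pushforward \<Phi> (axis i 1) z $ j * partial_deriv j F (\<Phi> z))" for i
      by (simp add: fun_eq_iff partial_deriv_dd[of i] dd_compose[OF \<Phi> Suc.prems]
          dd_sum_partial[OF smooth_UNIV_differentiable[OF Suc.prems]])
    moreover have "Ck_on k UNIV (\<lambda>z. \<Sum>j\<in>UNIV. pushforward \<Phi> (axis i 1) z $ j * partial_deriv j F (\<Phi> z))" for i
      using smooth_fieldD[OF smooth_field_pushforward[OF \<Phi>]]
      by (intro Ck_on_sum Ck_on_mult Suc.IH smooth_on_partial Suc.prems) (auto simp: smooth_on_def)
    ultimately show ?case
      using differentiable_compose_map[OF \<Phi> Suc.prems] by simp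
  qed
  then show ?thesis by (simp add: smooth_on_def)
qed

lemma smooth_metric_along:
  assumes g: "riemannian_metric g" and f: "smooth_field \<Phi>" "smooth_field A" "smooth_field B"
  shows "smooth_on UNIV (\<lambda>z. riem_inner g (\<Phi> z) (A z) (B z))"
  unfolding riem_inner_sum
  by (intro smooth_on_sum smooth_on_mult smooth_fieldD[OF f(2)] smooth_fieldD[OF f(3)] open_UNIV
      smooth_on_compose_map[OF f(1) riemannian_metricD(1)[OF g]])

lemma dd_metric_along:
  assumes g: "riemannian_metric g" and f: "smooth_field \<Phi>" "smooth_field A" "smooth_field B"
  shows "dd c (\<lambda>z. riem_inner g (\<Phi> z) (A z) (B z)) z =
    dd (pushforward \<Phi> c z) (\<lambda>y. riem_inner g y (A z) (B z)) (\<Phi> z)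
    + riem_inner g (\<Phi> z) (field_deriv c A z) (B z) + riem_inner g (\<Phi> z) (A z) (field_deriv c B z)"
proof -
  note G = riemannian_metricD(1)[OF g]
  note dA = smooth_field_differentiable[OF f(2)] and dB = smooth_field_differentiable[OF f(3)]
  note dg = differentiable_compose_map[where F = "\<lambda>y. g y $ i $ j" for i j, OF f(1) G]
  have "dd c (\<lambda>z. riem_inner g (\<Phi> z) (A z) (B z)) z =
     (\<Sum>i\<in>UNIV. \<Sum>j\<in>UNIV. A z $ i * B z $ j * dd (pushforward \<Phi> c z) (\<lambda>y. g y $ i $ j) (\<Phi> z)
       + (dd c (\<lambda>z. A z $ i) z * B z $ j * g (\<Phi> z) $ i $ j
         + A z $ i * dd c (\<lambda>z. B z $ j) z * g (\<Phi> z) $ i $ j))"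
    unfolding riem_inner_sum
    by (simp add: dd_sum dd_mult dA dB dg differentiable_mult differentiable_sum
       dd_compose[where F = "\<lambda>y. g y $ i $ j" for i j, OF f(1) G] algebra_simps)
  then show ?thesis
    unfolding dd_riem_inner[OF g] unfolding riem_inner_sum field_deriv_def
    by (simp add: sum.distrib)
qed

lemma
  assumes g: "riemannian_metric g"
    and f: "smooth_field \<Phi>" "smooth_field A" "smooth_field B" "smooth_field w"
  shows smooth_metric_deriv_along:
    "smooth_on UNIV (\<lambda>z. dd (w z) (\<lambda>y. riem_inner g y (A z) (B z)) (\<Phi> z))" (is ?smooth)
    and dd_metric_deriv_along: "dd c (\<lambda>z. dd (w z) (\<lambda>y. riem_inner g y (A z) (B z)) (\<Phi> z)) z =
    dd (pushforward \<Phi> c z) (dd (w z) (\<lambda>y. riem_inner g y (A z) (B z))) (\<Phi> z)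
    + dd (field_deriv c w z) (\<lambda>y. riem_inner g y (A z) (B z)) (\<Phi> z)
    + dd (w z) (\<lambda>y. riem_inner g y (field_deriv c A z) (B z)) (\<Phi> z)
    + dd (w z) (\<lambda>y. riem_inner g y (A z) (field_deriv c B z)) (\<Phi> z)" (is ?deriv)
proof -
  note dA = smooth_field_differentiable[OF f(2)] and dB = smooth_field_differentiable[OF f(3)]
    and dw = smooth_field_differentiable[OF f(4)]
  note G = riemannian_metricD(1)[OF g]
  have G': "smooth_on UNIV (partial_deriv k (\<lambda>y. g y $ i $ j))" for i j k
    by (intro smooth_on_partial G)
  note dG = smooth_UNIV_differentiable[OF G] and dG' = smooth_UNIV_differentiable[OF G']
  note dg = differentiable_compose_map[OF f(1) G']
  have I: "dd v (\<lambda>y. riem_inner g y a b) x =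
      (\<Sum>i\<in>UNIV. \<Sum>j\<in>UNIV. \<Sum>k\<in>UNIV. a $ i * b $ j * v $ k * partial_deriv k (\<lambda>y. g y $ i $ j) x)"
    for v a b x
    unfolding dd_riem_inner[OF g] dd_sum_partial[OF dG] by (simp add: sum_distrib_left mult_ac)
  have I2: "dd v (dd v' (\<lambda>y. riem_inner g y a b)) x =
      (\<Sum>i\<in>UNIV. \<Sum>j\<in>UNIV. \<Sum>k\<in>UNIV. a $ i * b $ j * v' $ k * dd v (partial_deriv k (\<lambda>y. g y $ i $ j)) x)"
    for v v' a b x
  proof -
    have "dd v' (\<lambda>y. riem_inner g y a b) = (\<lambda>x. \<Sum>i\<in>UNIV. \<Sum>j\<in>UNIV. \<Sum>k\<in>UNIV. a $ i * b $ j * v' $ k * partial_deriv k (\<lambda>y. g y $ i $ j) x)"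
      using I by blast
    then show ?thesis by (simp add: dd_sum dd_mult dG' differentiable_mult differentiable_sum)
  qed
  show ?smooth
    unfolding I
    by (intro smooth_on_sum smooth_on_mult open_UNIV smooth_on_compose_map[OF f(1) G']
        smooth_fieldD[OF f(2)] smooth_fieldD[OF f(3)] smooth_fieldD[OF f(4)])
  have "dd c (\<lambda>z. dd (w z) (\<lambda>y. riem_inner g y (A z) (B z)) (\<Phi> z)) z =
     (\<Sum>i\<in>UNIV. \<Sum>j\<in>UNIV. \<Sum>k\<in>UNIV.
        A z $ i * B z $ j * w z $ k * dd (pushforward \<Phi> c z) (partial_deriv k (\<lambda>y. g y $ i $ j)) (\<Phi> z)
       + (A z $ i * B z $ j * dd c (\<lambda>z. w z $ k) z * partial_deriv k (\<lambda>y. g y $ i $ j) (\<Phi> z)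
       + (dd c (\<lambda>z. A z $ i) z * B z $ j * w z $ k * partial_deriv k (\<lambda>y. g y $ i $ j) (\<Phi> z)
         + A z $ i * dd c (\<lambda>z. B z $ j) z * w z $ k * partial_deriv k (\<lambda>y. g y $ i $ j) (\<Phi> z))))"
    unfolding I
    by (simp add: dd_sum dd_mult dA dB dw dg differentiable_mult differentiable_sum
       dd_compose[OF f(1) G'] distrib_left distrib_right mult_ac add_ac)
  then show ?deriv
    unfolding I I2 field_deriv_def by (simp add: sum.distrib)
qed

text \<open>The map is an arbitrary smooth one, since polar coordinates are periodic and degenerate
  on the axis. The pulled back metric is never formed as a matrix; only its values
  \<open>pull a b\<close> on constant fields are differentiated.\<close>

locale coordinate_change =
  fixes g :: "real^'n::finite \<Rightarrow> real^'n^'n" and \<Phi> :: "real^'n \<Rightarrow> real^'n"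
  assumes metric: "riemannian_metric g" and map: "smooth_field \<Phi>"
begin

abbreviation "J \<equiv> pushforward \<Phi>"
abbreviation "pull a b z \<equiv> riem_inner g (\<Phi> z) (J a z) (J b z)"
abbreviation "hess c a z \<equiv> field_deriv c (J a) z"

lemma smooth_J: "smooth_field (J a)"
  by (rule smooth_field_pushforward[OF map])

lemma smooth_hess: "smooth_field (hess c a)"
  by (rule smooth_field_deriv[OF smooth_J])

lemma hess_commute: "hess c a = hess a c"
  unfolding field_deriv_def pushforward_def vec_lambda_beta fun_eq_iff vec_eq_iff
  using dd_commute[OF smooth_fieldD[OF map]] by blast

lemma dd_pull:
  "dd c (pull a b) z = dd (J c z) (\<lambda>y. riem_inner g y (J a z) (J b z)) (\<Phi> z)
    + riem_inner g (\<Phi> z) (hess c a z) (J b z) + riem_inner g (\<Phi> z) (J a z) (hess c b z)"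
  by (rule dd_metric_along[OF metric map smooth_J smooth_J])

lemma dd_dd_pull:
  "dd d (dd c (pull a b)) z =
    dd (J d z) (dd (J c z) (\<lambda>y. riem_inner g y (J a z) (J b z))) (\<Phi> z)
    + dd (hess d c z) (\<lambda>y. riem_inner g y (J a z) (J b z)) (\<Phi> z)
    + dd (J c z) (\<lambda>y. riem_inner g y (hess d a z) (J b z)) (\<Phi> z)
    + dd (J c z) (\<lambda>y. riem_inner g y (J a z) (hess d b z)) (\<Phi> z)
    + dd (J d z) (\<lambda>y. riem_inner g y (hess c a z) (J b z)) (\<Phi> z)
    + dd (J d z) (\<lambda>y. riem_inner g y (J a z) (hess c b z)) (\<Phi> z)
    + riem_inner g (\<Phi> z) (field_deriv d (hess c a) z) (J b z)
    + riem_inner g (\<Phi> z) (hess c a z) (hess d b z)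
    + riem_inner g (\<Phi> z) (hess d a z) (hess c b z)
    + riem_inner g (\<Phi> z) (J a z) (field_deriv d (hess c b) z)"
proof -
  let ?G = "\<lambda>z. dd (J c z) (\<lambda>y. riem_inner g y (J a z) (J b z)) (\<Phi> z)"
  let ?A = "\<lambda>z. riem_inner g (\<Phi> z) (hess c a z) (J b z)"
  let ?B = "\<lambda>z. riem_inner g (\<Phi> z) (J a z) (hess c b z)"
  have s: "smooth_on UNIV ?G" "smooth_on UNIV ?A" "smooth_on UNIV ?B"
    by (intro smooth_metric_deriv_along smooth_metric_along metric map smooth_J smooth_hess)+
  have "dd c (pull a b) = (\<lambda>z. ?G z + ?A z + ?B z)"
    using dd_pull by blast
  then have "dd d (dd c (pull a b)) z = dd d ?G z + dd d ?A z + dd d ?B z"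
    using s by (simp add: dd_add smooth_UNIV_differentiable smooth_on_add)
  also have "\<dots> = dd (J d z) (dd (J c z) (\<lambda>y. riem_inner g y (J a z) (J b z))) (\<Phi> z)
    + dd (hess d c z) (\<lambda>y. riem_inner g y (J a z) (J b z)) (\<Phi> z)
    + dd (J c z) (\<lambda>y. riem_inner g y (hess d a z) (J b z)) (\<Phi> z)
    + dd (J c z) (\<lambda>y. riem_inner g y (J a z) (hess d b z)) (\<Phi> z)
    + (dd (J d z) (\<lambda>y. riem_inner g y (hess c a z) (J b z)) (\<Phi> z)
    + riem_inner g (\<Phi> z) (field_deriv d (hess c a) z) (J b z)
    + riem_inner g (\<Phi> z) (hess c a z) (hess d b z))
    + (dd (J d z) (\<lambda>y. riem_inner g y (J a z) (hess c b z)) (\<Phi> z)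
    + riem_inner g (\<Phi> z) (hess d a z) (hess c b z)
    + riem_inner g (\<Phi> z) (J a z) (field_deriv d (hess c b) z))"
    by (simp only: dd_metric_deriv_along[OF metric map smooth_J smooth_J smooth_J]
        dd_metric_along[OF metric map smooth_hess smooth_J]
        dd_metric_along[OF metric map smooth_J smooth_hess])
  finally show ?thesis by (simp add: algebra_simps)
qed

text \<open>The Christoffel symbols transform inhomogeneously, by the Hessian of the coordinate map.\<close>

definition pulled_christoffel :: "real^'n \<Rightarrow> real^'n \<Rightarrow> real^'n \<Rightarrow> real^'n" where
  "pulled_christoffel a b z = hess a b z + christoffel_vec g (J a z) (J b z) (\<Phi> z)"

text \<open>Of the six Hessian terms produced by the three derivatives, four cancel and two combine
  to \<open>hess a b\<close>; this explains that summand of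
  \<open>pulled_christoffel\<close>.\<close>

lemma koszul_pull:
  "riem_inner g (\<Phi> z) (pulled_christoffel a b z) (J w z) =
    (dd a (pull b w) z + dd b (pull a w) z - dd w (pull a b) z) / 2"
  unfolding pulled_christoffel_def riem_inner_linear koszul[OF metric] dd_pull
  by (simp add: hess_commute[of w] hess_commute[of b a]
     riem_inner_commute[OF metric, of _ "J b z" "hess a w z"]
     riem_inner_commute[OF metric, of _ "J a z" "hess b w z"] field_simps)

text \<open>Invariance of the curvature under coordinate changes: the right-hand side is the formula
  of \<open>curvature_numerator\<close> written for \<open>pull\<close>. The third derivatives of
  \<open>\<Phi>\<close> in the three second derivatives cancel by their symmetry.\<close>

lemma curvature_numerator_pull:
  "riem_inner g (\<Phi> z) (riem_curvature g (\<Phi> z) (J a z) (J b z) (J b z)) (J a z) =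
    dd a (dd b (pull a b)) z - dd a (dd a (pull b b)) z / 2 - dd b (dd b (pull a a)) z / 2
    + riem_inner g (\<Phi> z) (pulled_christoffel a b z) (pulled_christoffel a b z)
    - riem_inner g (\<Phi> z) (pulled_christoffel a a z) (pulled_christoffel b b z)"
proof -
  let ?c = "\<lambda>a b. christoffel_vec g (J a z) (J b z) (\<Phi> z)"
  let ?i = "riem_inner g (\<Phi> z)"
  have third: "field_deriv d (hess c e) z = field_deriv c (hess d e) z" for c d e
    unfolding field_deriv_def vec_lambda_beta vec_eq_iff
    using dd_commute[OF smooth_fieldD[OF smooth_J]] by blast
  have H: "hess b a = hess a b" "field_deriv b (hess a a) z = field_deriv a (hess a b) z"
    "field_deriv a (hess b b) z = field_deriv b (hess a b) z"
    using third[of b a a] third[of a b b] by (simp_all add: hess_commute[of b a])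
  have sym: "riem_inner g y u v = riem_inner g y v u" for y u v
    by (rule riem_inner_commute[OF metric])
  have k: "?i (?c a b) w = (dd (J a z) (\<lambda>y. riem_inner g y (J b z) w) (\<Phi> z)
      + dd (J b z) (\<lambda>y. riem_inner g y (J a z) w) (\<Phi> z)
      - dd w (\<lambda>y. riem_inner g y (J a z) (J b z)) (\<Phi> z)) / 2" for a b w
    by (rule koszul[OF metric])
  have X: "?i (pulled_christoffel a b z) (pulled_christoffel a b z) =
      ?i (hess a b z) (hess a b z) + 2 * ?i (?c a b) (hess a b z) + ?i (?c a b) (?c a b)"
    unfolding pulled_christoffel_def riem_inner_linear by (simp add: sym[of _ "hess a b z" "?c a b"])
  have Y: "?i (pulled_christoffel a a z) (pulled_christoffel b b z) =
      ?i (hess a a z) (hess b b z) + ?i (?c a a) (hess b b z) + ?i (?c b b) (hess a a z) + ?i (?c a a) (?c b b)"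
    unfolding pulled_christoffel_def riem_inner_linear by (simp add: sym[of _ "hess a a z" "?c b b"])
  show ?thesis
    unfolding curvature_numerator[OF metric] X Y dd_dd_pull k
    by (simp add: H sym field_simps)
qed

end

section \<open>A bound for the sectional curvature at a single point\<close>

definition curvature_form :: "(real^'n::finite \<Rightarrow> real^'n^'n) \<Rightarrow> real^'n \<Rightarrow> real^'n \<Rightarrow> real^'n \<Rightarrow> real" where
  "curvature_form g x u v = riem_inner g x (riem_curvature g x u v v) u"

definition gram :: "(real^'n::finite \<Rightarrow> real^'n^'n) \<Rightarrow> real^'n \<Rightarrow> real^'n \<Rightarrow> real^'n \<Rightarrow> real" where
  "gram g x u v = riem_inner g x u u * riem_inner g x v v - (riem_inner g x u v)\<^sup>2"

lemma sectional_curvature_alt: "sectional_curvature g x u v = curvature_form g x u v / gram g x u v"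
  by (simp add: sectional_curvature_def curvature_form_def gram_def)

lemma christoffel_vec_linear:
  "christoffel_vec g (u + w) v x = christoffel_vec g u v x + christoffel_vec g w v x"
  "christoffel_vec g (r *\<^sub>R u) v x = r *\<^sub>R christoffel_vec g u v x"
  "christoffel_vec g u (v + w) x = christoffel_vec g u v x + christoffel_vec g u w x"
  "christoffel_vec g u (r *\<^sub>R v) x = r *\<^sub>R christoffel_vec g u v x"
  by (simp_all add: christoffel_vec_def vec_eq_iff algebra_simps sum.distrib sum_distrib_left)

lemma dd_metric_linear:
  assumes g: "riemannian_metric g"
  shows "dd w (\<lambda>y. riem_inner g y (a + b) c) = (\<lambda>x. dd w (\<lambda>y. riem_inner g y a c) x + dd w (\<lambda>y. riem_inner g y b c) x)"
    "dd w (\<lambda>y. riem_inner g y (r *\<^sub>R a) c) = (\<lambda>x. r * dd w (\<lambda>y. riem_inner g y a c) x)"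
  by (simp_all add: fun_eq_iff riem_inner_linear dd_add dd_mult
      smooth_UNIV_differentiable[OF smooth_riem_inner[OF g]])

text \<open>The antisymmetry of the curvature tensor in disguise: the additional terms of the
  expansion in \<open>t\<close> cancel by the symmetries of the second derivatives of the metric. It
  allows \<open>u\<close> to be replaced by its component orthogonal to \<open>v\<close>.\<close>

lemma curvature_form_shear:
  assumes g: "riemannian_metric g"
  shows "curvature_form g x (u + t *\<^sub>R v) v = curvature_form g x u v"
proof -
  have sm: "smooth_on UNIV (dd d (\<lambda>y. riem_inner g y a b))" for d a b
    by (intro smooth_on_dd smooth_riem_inner g) simp
  define Q where "Q d c a b = dd d (dd c (\<lambda>y. riem_inner g y a b)) x" for d c a b
  have Q1: "Q (d + t *\<^sub>R d') c a b = Q d c a b + t * Q d' c a b" for d d' c a b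
    by (simp add: Q_def dd_plus dd_scaleR smooth_UNIV_differentiable[OF sm])
  have Q2: "Q d c a b = Q c d a b" for d c a b
    unfolding Q_def by (rule dd_commute[OF smooth_riem_inner[OF g]])
  have Q3: "Q d c (a + t *\<^sub>R a') b = Q d c a b + t * Q d c a' b" for d c a a' b
    unfolding Q_def dd_metric_linear[OF g]
    by (simp add: dd_add dd_mult smooth_UNIV_differentiable[OF sm] differentiable_mult)
  have Q4: "Q d c a b = Q d c b a" for d c a b
    by (simp add: Q_def riem_inner_commute[OF g, of _ a])
  have F: "curvature_form g x u v = Q u v u v - Q u u v v / 2 - Q v v u u / 2
    + riem_inner g x (christoffel_vec g u v x) (christoffel_vec g u v x)
    - riem_inner g x (christoffel_vec g u u x) (christoffel_vec g v v x)" for u v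
    unfolding curvature_form_def Q_def by (rule curvature_numerator[OF g])
  have Q1': "Q c (d + t *\<^sub>R d') a b = Q c d a b + t * Q c d' a b" for d d' c a b
    using Q1[of d d' c a b] Q2[of c "d + t *\<^sub>R d'" a b] Q2[of c d a b] Q2[of c d' a b] by simp
  have Q3': "Q d c b (a + t *\<^sub>R a') = Q d c b a + t * Q d c b a'" for d c a a' b
    using Q3[of d c a a' b] Q4[of d c b "a + t *\<^sub>R a'"] Q4[of d c b a] Q4[of d c b a'] by simp
  show ?thesis
    unfolding F Q1 Q1' Q3 Q3' christoffel_vec_linear riem_inner_linear
    by (simp add: christoffel_vec_commute[OF g, of v u] Q2[of v u] Q4[of _ _ v u]
        riem_inner_commute[OF g, of x "christoffel_vec g v v x" "christoffel_vec g u v x"]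
        algebra_simps add_divide_distrib)
qed

lemma gram_shear:
  assumes g: "riemannian_metric g"
  shows "gram g x (u + t *\<^sub>R v) v = gram g x u v"
  by (simp add: gram_def riem_inner_linear riem_inner_commute[OF g, of x v u] algebra_simps power2_eq_square)

text \<open>All derivatives are measured relative to \<open>\<mu>\<close>, the common value of both
  coefficients at \<open>z\<close>, so that the Christoffel vectors are of size
  \<open>\<alpha>\<close> in the coordinates. The constant collects 3 + 3/2 + 3/2 from the second
  derivatives and twice 81/4 from the Christoffel terms, together 46.5.\<close>

lemma (in coordinate_change) sectional_curvature_bound:
  fixes E K :: "real^'n \<Rightarrow> real" and j :: 'n
  assumes V: "open V" "z \<in> V"
    and pull: "\<And>y a b. y \<in> V \<Longrightarrow> pull a b y = E y * (a \<bullet> b - a $ j * b $ j) + K y * (a $ j * b $ j)"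
    and sm: "smooth_on V E" "smooth_on V K"
    and at: "E z = \<mu>" "K z = \<mu>" "\<mu> > 0" and "\<alpha> \<ge> 0"
    and d1: "\<And>c. \<bar>dd c E z\<bar> \<le> \<mu> * \<alpha> * norm c" "\<And>c. \<bar>dd c K z\<bar> \<le> \<mu> * \<alpha> * norm c"
    and d2: "\<And>c d. \<bar>dd d (dd c E) z\<bar> \<le> \<mu> * \<alpha>\<^sup>2 * norm c * norm d"
      "\<And>c d. \<bar>dd d (dd c K) z\<bar> \<le> \<mu> * \<alpha>\<^sup>2 * norm c * norm d"
  shows "\<bar>sectional_curvature g (\<Phi> z) u v\<bar> \<le> 47 * \<alpha>\<^sup>2 / \<mu>"
proof -
  let ?i = "riem_inner g (\<Phi> z)"
  have at_z: "pull a b z = \<mu> * (a \<bullet> b)" for a b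
    by (simp add: pull[OF V(2)] at algebra_simps)
  have linJ: "linear (\<lambda>a. J a z)"
    using has_derivative_pushforward[OF map] has_derivative_linear by blast
  have "inj (\<lambda>a. J a z)"
    unfolding linear_injective_0[OF linJ]
  proof safe
    fix a assume "J a z = 0"
    then have "\<mu> * (a \<bullet> a) = 0" using at_z[of a a] riem_inner_linear(3)[of g "\<Phi> z" 0 0] by simp
    then show "a = 0" using at by simp
  qed
  then have surjJ: "\<exists>a. J a z = w" for w
    using linear_injective_imp_surjective[OF linJ] by (metis surjD)
  have P1: "dd c (pull a b) y = (a \<bullet> b - a $ j * b $ j) * dd c E y + a $ j * b $ j * dd c K y"
    if "y \<in> V" for a b c y
  proof -
    have "dd c (pull a b) y = dd c (\<lambda>y. (a \<bullet> b - a $ j * b $ j) * E y + a $ j * b $ j * K y) y"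
      by (rule dd_cong_open[OF V(1) that]) (simp add: pull mult.commute)
    then show ?thesis
      using smooth_on_differentiable[OF sm(1) that] smooth_on_differentiable[OF sm(2) that]
      by (simp add: dd_add dd_mult differentiable_mult)
  qed
  have P2: "dd d (dd c (pull a b)) z = (a \<bullet> b - a $ j * b $ j) * dd d (dd c E) z + a $ j * b $ j * dd d (dd c K) z"
    for a b c d
  proof -
    have "dd d (dd c (pull a b)) z = dd d (\<lambda>y. (a \<bullet> b - a $ j * b $ j) * dd c E y + a $ j * b $ j * dd c K y) z"
      by (rule dd_cong_open[OF V]) (rule P1)
    then show ?thesis
      using smooth_on_differentiable[OF smooth_on_dd[OF V(1) sm(1)] V(2)]
        smooth_on_differentiable[OF smooth_on_dd[OF V(1) sm(2)] V(2)]
      by (simp add: dd_add dd_mult differentiable_mult)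
  qed
  have jj: "\<bar>a $ j * b $ j\<bar> \<le> norm a * norm b" for a b :: "real^'n"
    unfolding abs_mult by (intro mult_mono component_le_norm_cart) auto
  have ab: "\<bar>a \<bullet> b - a $ j * b $ j\<bar> \<le> 2 * (norm a * norm b)" for a b :: "real^'n"
    using Cauchy_Schwarz_ineq2[of a b] jj[of a b] by linarith
  \<comment> \<open>The factor 3 is 2 for the part without the component \<open>j\<close> plus 1 for
    that component.\<close>
  have mix: "\<bar>(a \<bullet> b - a $ j * b $ j) * e + a $ j * b $ j * k\<bar> \<le> 3 * B * (norm a * norm b)"
    if "\<bar>e\<bar> \<le> B" "\<bar>k\<bar> \<le> B" for a b :: "real^'n" and e k B :: real
  proof -
    have "\<bar>(a \<bullet> b - a $ j * b $ j) * e\<bar> \<le> 2 * (norm a * norm b) * B"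
      unfolding abs_mult[of _ e] by (intro mult_mono ab that) auto
    moreover have "\<bar>a $ j * b $ j * k\<bar> \<le> (norm a * norm b) * B"
      unfolding abs_mult[of _ k] by (intro mult_mono jj that) auto
    ultimately show ?thesis by (simp add: algebra_simps)
  qed
  have B1: "\<bar>dd c (pull a b) z\<bar> \<le> 3 * (\<mu> * \<alpha> * norm c) * (norm a * norm b)" for a b c
    unfolding P1[OF V(2)] by (intro mix d1)
  have B2: "\<bar>dd d (dd c (pull a b)) z\<bar> \<le> 3 * (\<mu> * \<alpha>\<^sup>2 * norm c * norm d) * (norm a * norm b)" for a b c d
    unfolding P2 by (intro mix d2)
  \<comment> \<open>The Koszul formula is tested with \<open>\<xi>\<close> itself: three first
    derivatives with factor 3 each, halved, give 9/2.\<close>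
  have chr: "\<exists>\<xi>. pulled_christoffel a b z = J \<xi> z \<and> norm \<xi> \<le> 9 / 2 * \<alpha> * (norm a * norm b)" for a b
  proof -
    obtain \<xi> where \<xi>: "pulled_christoffel a b z = J \<xi> z" using surjJ by metis
    have "\<mu> * (\<xi> \<bullet> \<xi>) = (dd a (pull b \<xi>) z + dd b (pull a \<xi>) z - dd \<xi> (pull a b) z) / 2"
      using koszul_pull[of z a b \<xi>] unfolding at_z[of \<xi> \<xi>, symmetric] \<xi> .
    also have "\<dots> \<le> (9 * (\<mu> * \<alpha> * (norm a * norm b * norm \<xi>))) / 2"
      using B1[of a b \<xi>] B1[of b a \<xi>] B1[of \<xi> a b] by (simp add: mult_ac abs_le_iff)
    finally have "\<mu> * (norm \<xi> * norm \<xi>) \<le> \<mu> * (9 / 2 * \<alpha> * (norm a * norm b) * norm \<xi>)"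
      by (simp add: dot_square_norm power2_eq_square mult_ac)
    then have "norm \<xi> * norm \<xi> \<le> 9 / 2 * \<alpha> * (norm a * norm b) * norm \<xi>"
      using at(3) by (simp only: mult_le_cancel_left_pos)
    then have "norm \<xi> \<le> 9 / 2 * \<alpha> * (norm a * norm b)"
      using \<open>\<alpha> \<ge> 0\<close> by (cases "\<xi> = 0") (auto simp: mult_le_cancel_right_pos)
    then show ?thesis using \<xi> by blast
  qed
  have cc: "\<bar>?i (pulled_christoffel a b z) (pulled_christoffel c d z)\<bar> \<le>
      \<mu> * (81 / 4 * \<alpha>\<^sup>2 * (norm a * norm b * norm c * norm d))" for a b c d
  proof -
    obtain \<xi> \<eta> where \<xi>: "pulled_christoffel a b z = J \<xi> z" "norm \<xi> \<le> 9 / 2 * \<alpha> * (norm a * norm b)"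
      and \<eta>: "pulled_christoffel c d z = J \<eta> z" "norm \<eta> \<le> 9 / 2 * \<alpha> * (norm c * norm d)"
      using chr by blast
    have "\<bar>\<xi> \<bullet> \<eta>\<bar> \<le> norm \<xi> * norm \<eta>" by (rule Cauchy_Schwarz_ineq2)
    also have "\<dots> \<le> (9 / 2 * \<alpha> * (norm a * norm b)) * (9 / 2 * \<alpha> * (norm c * norm d))"
      using \<open>\<alpha> \<ge> 0\<close> by (intro mult_mono \<xi> \<eta>) auto
    finally have "\<mu> * \<bar>\<xi> \<bullet> \<eta>\<bar> \<le> \<mu> * (81 / 4 * \<alpha>\<^sup>2 * (norm a * norm b * norm c * norm d))"
      using at(3) by (simp add: power2_eq_square mult_ac)
    then show ?thesis unfolding \<xi> \<eta> at_z using at(3) by (simp add: abs_mult)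
  qed
  have gramJ: "gram g (\<Phi> z) (J a z) (J b z) = \<mu>\<^sup>2 * ((norm a)\<^sup>2 * (norm b)\<^sup>2 - (a \<bullet> b)\<^sup>2)" for a b
    by (simp add: gram_def at_z dot_square_norm power2_eq_square algebra_simps)
  have main: "\<bar>curvature_form g (\<Phi> z) (J a z) (J b z)\<bar> \<le> 47 * (\<mu> * \<alpha>\<^sup>2) * ((norm a)\<^sup>2 * (norm b)\<^sup>2)" for a b
  proof -
    define S where "S = \<mu> * \<alpha>\<^sup>2 * ((norm a)\<^sup>2 * (norm b)\<^sup>2)"
    have "S \<ge> 0" using at(3) by (simp add: S_def)
    moreover have "\<bar>dd a (dd b (pull a b)) z\<bar> \<le> 3 * S" "\<bar>dd a (dd a (pull b b)) z\<bar> \<le> 3 * S"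
      "\<bar>dd b (dd b (pull a a)) z\<bar> \<le> 3 * S"
      using B2[of a b a b] B2[of a a b b] B2[of b b a a] by (simp_all add: S_def power2_eq_square mult_ac)
    moreover have "\<bar>?i (pulled_christoffel a b z) (pulled_christoffel a b z)\<bar> \<le> 81 / 4 * S"
      "\<bar>?i (pulled_christoffel a a z) (pulled_christoffel b b z)\<bar> \<le> 81 / 4 * S"
      using cc[of a b a b] cc[of a a b b] by (simp_all add: S_def power2_eq_square mult_ac)
    ultimately have "\<bar>curvature_form g (\<Phi> z) (J a z) (J b z)\<bar> \<le> 47 * S"
      unfolding curvature_form_def curvature_numerator_pull by linarith
    then show ?thesis by (simp add: S_def)
  qed
  obtain a b where ab: "u = J a z" "v = J b z" using surjJ by metis
  \<comment> \<open>Orthogonalisation makes the Gram determinant equal to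
    \<open>\<mu>\<^sup>2\<close> times the product of the squared norms; for nearly parallel vectors
    the two would not be comparable.\<close>
  define a' where "a' = a - (a \<bullet> b / (b \<bullet> b)) *\<^sub>R b"
  have orth: "a' \<bullet> b = 0" by (simp add: a'_def inner_diff_left)
  have "u = J a' z + (a \<bullet> b / (b \<bullet> b)) *\<^sub>R v"
    unfolding ab a'_def linear_diff[OF linJ] linear_scale[OF linJ] by simp
  then have eq: "curvature_form g (\<Phi> z) u v = curvature_form g (\<Phi> z) (J a' z) (J b z)"
    "gram g (\<Phi> z) u v = \<mu>\<^sup>2 * ((norm a')\<^sup>2 * (norm b)\<^sup>2)"
    using curvature_form_shear[OF metric] gram_shear[OF metric] gramJ[of a' b] orth ab by simp_all
  define D where "D = (norm a')\<^sup>2 * (norm b)\<^sup>2"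
  have D: "D \<ge> 0" by (simp add: D_def)
  have "\<bar>curvature_form g (\<Phi> z) u v\<bar> / (\<mu>\<^sup>2 * D) \<le> 47 * (\<mu> * \<alpha>\<^sup>2) * D / (\<mu>\<^sup>2 * D)"
    unfolding eq D_def using main[of a' b] by (rule divide_right_mono) simp
  moreover have "\<bar>sectional_curvature g (\<Phi> z) u v\<bar> = \<bar>curvature_form g (\<Phi> z) u v\<bar> / (\<mu>\<^sup>2 * D)"
    using D by (simp add: sectional_curvature_alt abs_divide abs_mult eq(2) D_def)
  ultimately have "\<bar>sectional_curvature g (\<Phi> z) u v\<bar> \<le> 47 * (\<mu> * \<alpha>\<^sup>2) * D / (\<mu>\<^sup>2 * D)"
    by simp
  \<comment> \<open>For dependent vectors \<open>D = 0\<close> and the quotient is 0.\<close>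
  also have "\<dots> \<le> 47 * \<alpha>\<^sup>2 / \<mu>"
    using at(3) by (cases "D = 0") (auto simp: power2_eq_square)
  finally show ?thesis .
qed

lemma sectional_curvature_locally_constant:
  assumes g: "riemannian_metric g" and V: "open V" "x \<in> V" "\<And>y. y \<in> V \<Longrightarrow> g y = A"
  shows "sectional_curvature g x u v = 0"
proof -
  have "dd w (\<lambda>y. riem_inner g y a b) y = dd w (\<lambda>y. a \<bullet> (A *v b)) y" if "y \<in> V" for w a b y
    by (rule dd_cong_open[OF V(1) that]) (simp add: riem_inner_def V(3))
  then have d1: "dd w (\<lambda>y. riem_inner g y a b) y = 0" if "y \<in> V" for w a b y
    using that by simp
  have d2: "dd w' (dd w (\<lambda>y. riem_inner g y a b)) x = 0" for w w' a b
    using dd_cong_open[OF V(1,2), of "dd w (\<lambda>y. riem_inner g y a b)" "\<lambda>_. 0" w'] d1 by simp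
  have "christoffel_vec g a b x = 0" for a b
  proof (rule riem_inner_nondegenerate[OF g])
    show "riem_inner g x (christoffel_vec g a b x) w = riem_inner g x 0 w" for w
      unfolding koszul[OF g] using d1[OF V(2)] riem_inner_linear(3)[of g x 0 0 w] by simp
  qed
  then have "curvature_form g x u v = 0"
    unfolding curvature_form_def curvature_numerator[OF g]
    using d2 riem_inner_linear(3)[of g x 0 0 0] by simp
  then show ?thesis by (simp add: sectional_curvature_alt)
qed

subsection \<open>The Riemannian distance\<close>

definition speed :: "(real^'n::finite \<Rightarrow> real^'n^'n) \<Rightarrow> (real \<Rightarrow> real^'n) \<Rightarrow> real \<Rightarrow> real" where
  "speed g \<gamma> t = sqrt (riem_inner g (\<gamma> t) (vector_derivative \<gamma> (at t)) (vector_derivative \<gamma> (at t)))"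

lemma riem_length_speed: "riem_length g \<gamma> = (\<integral>\<^sup>+t\<in>{0..1}. ennreal (speed g \<gamma> t) \<partial>lborel)"
  by (simp add: riem_length_def speed_def)

lemma riem_inner_nonneg: "riemannian_metric g \<Longrightarrow> 0 \<le> riem_inner g x v v"
  using riemannian_metricD(3)[of g v x] by (cases "v = 0") (auto simp: riem_inner_def)

lemma speed_eqI:
  assumes "\<gamma> t = \<delta> s" "(\<delta> has_vector_derivative w) (at s)" "(\<gamma> has_vector_derivative r *\<^sub>R w) (at t)"
  shows "speed g \<gamma> t = \<bar>r\<bar> * speed g \<delta> s"
  using assms
  by (simp add: speed_def vector_derivative_at riem_inner_linear real_sqrt_mult
      mult.assoc[symmetric] flip: power2_eq_square)

lemma nn_integral_finite_cong:
  assumes "finite S" "\<And>t. t \<notin> S \<Longrightarrow> f t = h t"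
  shows "(\<integral>\<^sup>+t. f t \<partial>lborel) = (\<integral>\<^sup>+t. h (t::real) \<partial>lborel)"
proof (rule nn_integral_cong_AE)
  have "S \<in> null_sets lborel" using assms(1) by (rule finite_imp_null_set_lborel)
  then have "AE t in lborel. t \<notin> S" by (rule AE_not_in)
  then show "AE t in lborel. f t = h t" by eventually_elim (rule assms(2))
qed

text \<open>\<open>speed\<close> is uncontrolled at the breaks of the path; \<open>f\<close> is a
  Borel version of it that vanishes on a finite set and outside the unit interval. The endpoints
  belong to \<open>S\<close> so that the point where two paths are joined can be left out of
  consideration.\<close>

lemma valid_path_speed:
  assumes g: "riemannian_metric g" and \<gamma>: "valid_path \<gamma>"
  obtains S f where "finite S" "{0, 1} \<subseteq> S" "f \<in> borel_measurable borel" "\<And>t. 0 \<le> f t"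
    "\<And>t. t \<in> {0..1} - S \<Longrightarrow> f t = speed g \<gamma> t \<and> \<gamma> differentiable (at t)"
    "\<And>t. t \<notin> {0..1} - S \<Longrightarrow> f t = 0"
    "riem_length g \<gamma> = (\<integral>\<^sup>+t. ennreal (f t) \<partial>lborel)"
proof -
  obtain S0 where S0: "finite S0" "\<gamma> C1_differentiable_on ({0..1} - S0)" and "continuous_on {0..1} \<gamma>"
    using \<gamma> unfolding valid_path_def piecewise_C1_differentiable_on_def by auto
  define S where "S = S0 \<union> {0, 1}"
  have S: "finite S" "{0, 1} \<subseteq> S" "\<gamma> C1_differentiable_on ({0..1} - S)"
    using S0 C1_differentiable_on_subset[OF S0(2), of "{0..1} - S"] by (auto simp: S_def)
  note C1 = S(3)[unfolded C1_differentiable_on_eq]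
  have c1: "continuous_on ({0..1} - S) (\<lambda>t. vector_derivative \<gamma> (at t) $ i)" for i
    by (intro continuous_intros) (use C1 in simp)
  have c2: "continuous_on ({0..1} - S) (\<lambda>t. g (\<gamma> t) $ i $ j)" for i j
    by (rule continuous_on_compose2[OF smooth_on_continuous[OF riemannian_metricD(1)[OF g]]])
      (use \<open>continuous_on {0..1} \<gamma>\<close> in \<open>auto intro: continuous_on_subset\<close>)
  have cont: "continuous_on ({0..1} - S) (speed g \<gamma>)"
    unfolding speed_def riem_inner_sum by (intro continuous_intros c1 c2)
  define f where "f t = indicator ({0..1} - S) t *\<^sub>R speed g \<gamma> t" for t
  have m: "f \<in> borel_measurable borel"
    unfolding f_def
    by (rule borel_measurable_continuous_on_indicator[OF _ cont])
      (use \<open>finite S\<close> in \<open>simp add: sets.Diff borel_closed finite_imp_closed\<close>)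
  have nn: "0 \<le> f t" for t
    by (simp add: f_def indicator_def speed_def riem_inner_nonneg[OF g])
  have "riem_length g \<gamma> = (\<integral>\<^sup>+t. ennreal (f t) \<partial>lborel)"
    unfolding riem_length_speed
    by (rule nn_integral_finite_cong[OF S(1)]) (auto simp: f_def indicator_def)
  with S m nn C1 show thesis
    by (intro that[of S f]) (auto simp: f_def indicator_def)
qed

lemma riem_length_reversepath:
  assumes g: "riemannian_metric g" and \<gamma>: "valid_path \<gamma>"
  shows "riem_length g (reversepath \<gamma>) = riem_length g \<gamma>"
proof -
  obtain S f where f: "finite S" "{0, 1} \<subseteq> S" "f \<in> borel_measurable borel" "\<And>t. 0 \<le> f t"
    "\<And>t. t \<in> {0..1} - S \<Longrightarrow> f t = speed g \<gamma> t \<and> \<gamma> differentiable (at t)"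
    "\<And>t. t \<notin> {0..1} - S \<Longrightarrow> f t = 0"
    "riem_length g \<gamma> = (\<integral>\<^sup>+t. ennreal (f t) \<partial>lborel)"
    using valid_path_speed[OF assms] by blast
  have sp: "speed g (reversepath \<gamma>) t = speed g \<gamma> (1 - t)" if "\<gamma> differentiable (at (1 - t))" for t
  proof -
    have d: "(\<gamma> has_vector_derivative vector_derivative \<gamma> (at (1 - t))) (at (1 - t))"
      using that vector_derivative_works by blast
    have "((\<lambda>t. 1 - t) has_vector_derivative -1) (at t)"
      by (auto intro!: derivative_eq_intros)
    from vector_diff_chain_at[OF this d]
    have "(reversepath \<gamma> has_vector_derivative (-1) *\<^sub>R vector_derivative \<gamma> (at (1 - t))) (at t)"
      by (simp add: reversepath_def o_def)
    from speed_eqI[OF _ d this] show ?thesis by (simp add: reversepath_def)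
  qed
  have "riem_length g (reversepath \<gamma>) = (\<integral>\<^sup>+t. ennreal (f (1 - t)) \<partial>lborel)"
    unfolding riem_length_speed
  proof (rule nn_integral_finite_cong[of "(\<lambda>s. 1 - s) ` S"])
    fix t :: real assume "t \<notin> (\<lambda>s. 1 - s) ` S"
    then have t: "1 - t \<notin> S" by (metis (no_types, lifting) add_diff_cancel_left' diff_diff_eq2 image_eqI)
    show "ennreal (speed g (reversepath \<gamma>) t) * indicator {0..1} t = ennreal (f (1 - t))"
      using f(5)[of "1 - t"] f(6)[of "1 - t"] t sp[of t] by (auto simp: indicator_def)
  qed (use f in auto)
  also have "\<dots> = (\<integral>\<^sup>+t. ennreal (f t) \<partial>lborel)"
    using nn_integral_real_affine[of "\<lambda>t. ennreal (f t)" "-1" 1] f(3) by simp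
  finally show ?thesis using f(7) by simp
qed

lemma riem_length_join:
  assumes g: "riemannian_metric g" and \<gamma>: "valid_path \<gamma>" "valid_path \<delta>"
  shows "riem_length g (\<gamma> +++ \<delta>) = riem_length g \<gamma> + riem_length g \<delta>"
proof -
  obtain S f where f: "finite S" "{0, 1} \<subseteq> S" "f \<in> borel_measurable borel" "\<And>t. 0 \<le> f t"
    "\<And>t. t \<in> {0..1} - S \<Longrightarrow> f t = speed g \<gamma> t \<and> \<gamma> differentiable (at t)"
    "\<And>t. t \<notin> {0..1} - S \<Longrightarrow> f t = 0"
    "riem_length g \<gamma> = (\<integral>\<^sup>+t. ennreal (f t) \<partial>lborel)"
    using valid_path_speed[OF g \<gamma>(1)] by blast
  obtain T h where h: "finite T" "{0, 1} \<subseteq> T" "h \<in> borel_measurable borel" "\<And>t. 0 \<le> h t"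
    "\<And>t. t \<in> {0..1} - T \<Longrightarrow> h t = speed g \<delta> t \<and> \<delta> differentiable (at t)"
    "\<And>t. t \<notin> {0..1} - T \<Longrightarrow> h t = 0"
    "riem_length g \<delta> = (\<integral>\<^sup>+t. ennreal (h t) \<partial>lborel)"
    using valid_path_speed[OF g \<gamma>(2)] by blast
  have sp1: "speed g (\<gamma> +++ \<delta>) t = 2 * speed g \<gamma> (2 * t)"
    if "\<gamma> differentiable (at (2 * t))" "t < 1/2" for t
  proof -
    have d: "(\<gamma> has_vector_derivative vector_derivative \<gamma> (at (2 * t))) (at (2 * t))"
      using that vector_derivative_works by blast
    have "((\<lambda>t. 2 * t) has_vector_derivative 2) (at t)"
      by (auto intro!: derivative_eq_intros)
    from vector_diff_chain_at[OF this d]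
    have "((\<lambda>t. \<gamma> (2 * t)) has_vector_derivative 2 *\<^sub>R vector_derivative \<gamma> (at (2 * t))) (at t)"
      by (simp add: o_def)
    then have "(\<gamma> +++ \<delta> has_vector_derivative 2 *\<^sub>R vector_derivative \<gamma> (at (2 * t))) (at t)"
      by (rule has_vector_derivative_transform_within_open[where S = "{..<1/2}"])
        (use that in \<open>auto simp: joinpaths_def\<close>)
    from speed_eqI[OF _ d this] show ?thesis using that by (simp add: joinpaths_def)
  qed
  have sp2: "speed g (\<gamma> +++ \<delta>) t = 2 * speed g \<delta> (2 * t - 1)"
    if "\<delta> differentiable (at (2 * t - 1))" "t > 1/2" for t
  proof -
    have d: "(\<delta> has_vector_derivative vector_derivative \<delta> (at (2 * t - 1))) (at (2 * t - 1))"
      using that vector_derivative_works by blast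
    have "((\<lambda>t. 2 * t - 1) has_vector_derivative 2) (at t)"
      by (auto intro!: derivative_eq_intros)
    from vector_diff_chain_at[OF this d]
    have "((\<lambda>t. \<delta> (2 * t - 1)) has_vector_derivative 2 *\<^sub>R vector_derivative \<delta> (at (2 * t - 1))) (at t)"
      by (simp add: o_def)
    then have "(\<gamma> +++ \<delta> has_vector_derivative 2 *\<^sub>R vector_derivative \<delta> (at (2 * t - 1))) (at t)"
      by (rule has_vector_derivative_transform_within_open[where S = "{1/2<..}"])
        (use that in \<open>auto simp: joinpaths_def\<close>)
    from speed_eqI[OF _ d this] show ?thesis using that by (simp add: joinpaths_def)
  qed
  have m: "f \<in> borel_measurable lborel" "h \<in> borel_measurable lborel" using f(3) h(3) by simp_all
  \<comment> \<open>The arguments \<open>0 + 2 * t\<close> and \<open>-1 + 2 * t\<close> have the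
    form of an affine substitution in the integral. Both integrands vanish off the unit interval, so
    the halves can be added without indicators.\<close>
  have "riem_length g (\<gamma> +++ \<delta>) =
      (\<integral>\<^sup>+t. 2 * ennreal (f (0 + 2 * t)) + 2 * ennreal (h (-1 + 2 * t)) \<partial>lborel)"
    unfolding riem_length_speed
  proof (rule nn_integral_finite_cong[of "(\<lambda>s. s / 2) ` S \<union> (\<lambda>s. (s + 1) / 2) ` T"])
    fix t :: real assume t: "t \<notin> (\<lambda>s. s / 2) ` S \<union> (\<lambda>s. (s + 1) / 2) ` T"
    have 1: "2 * t \<notin> S" using t image_eqI[of t "\<lambda>s. s / 2" "2 * t" S] by auto
    have 2: "2 * t - 1 \<notin> T" using t image_eqI[of t "\<lambda>s. (s + 1) / 2" "2 * t - 1" T] by auto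
    have "t \<noteq> 1/2"
    proof
      assume "t = 1/2"
      then have "2 * t = 1" by simp
      then show False using 1 f(2) by simp
    qed
    then consider "t \<notin> {0..1}" | "0 \<le> t" "t < 1/2" | "1/2 < t" "t \<le> 1" 
      unfolding atLeastAtMost_iff by linarith
    then show "ennreal (speed g (\<gamma> +++ \<delta>) t) * indicator {0..1} t =
        2 * ennreal (f (0 + 2 * t)) + 2 * ennreal (h (-1 + 2 * t))"
    proof cases
      case 1
      then have "f (2 * t) = 0" "h (2 * t - 1) = 0" using f(6) h(6) by auto
      then show ?thesis using 1 by simp
    next
      case c: 2
      have "h (2 * t - 1) = 0" using c by (intro h(6)) auto
      moreover have "f (2 * t) = speed g \<gamma> (2 * t)" "\<gamma> differentiable (at (2 * t))"
        using f(5)[of "2 * t"] 1 c by auto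
      ultimately show ?thesis using c sp1[of t] f(4)[of "2 * t"] by (simp add: ennreal_mult)
    next
      case c: 3
      have "f (2 * t) = 0" using c by (intro f(6)) auto
      moreover have "h (2 * t - 1) = speed g \<delta> (2 * t - 1)" "\<delta> differentiable (at (2 * t - 1))"
        using h(5)[of "2 * t - 1"] 2 c by auto
      ultimately show ?thesis using c sp2[of t] h(4)[of "2 * t - 1"] by (simp add: ennreal_mult)
    qed
  qed (use f h in auto)
  also have "\<dots> = 2 * (\<integral>\<^sup>+t. ennreal (f (0 + 2 * t)) \<partial>lborel) + 2 * (\<integral>\<^sup>+t. ennreal (h (-1 + 2 * t)) \<partial>lborel)"
    using f(3) h(3) by (simp add: nn_integral_add nn_integral_cmult)
  also have "\<dots> = riem_length g \<gamma> + riem_length g \<delta>"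
    using nn_integral_real_affine[of "\<lambda>t. ennreal (f t)" 2 0]
      nn_integral_real_affine[of "\<lambda>t. ennreal (h t)" 2 "-1"] f(3,7) h(3,7) by simp
  finally show ?thesis .
qed

text \<open>Along a path the derivative of \<open>\<rho>\<close> is at most the speed, and the
  fundamental theorem tolerates the finitely many breaks. Every lower bound for a distance is
  obtained from this with a suitable \<open>\<rho>\<close>.\<close>

lemma riem_length_ge:
  assumes g: "riemannian_metric g" and \<gamma>: "valid_path \<gamma>" and \<rho>: "smooth_on UNIV \<rho>"
    and grad: "\<And>x v. (dd v \<rho> x)\<^sup>2 \<le> riem_inner g x v v"
  shows "ennreal \<bar>\<rho> (pathfinish \<gamma>) - \<rho> (pathstart \<gamma>)\<bar> \<le> riem_length g \<gamma>"
proof (cases "riem_length g \<gamma> = \<infinity>")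
  case False
  obtain S f where f: "finite S" "{0, 1} \<subseteq> S" "f \<in> borel_measurable borel" "\<And>t. 0 \<le> f t"
    "\<And>t. t \<in> {0..1} - S \<Longrightarrow> f t = speed g \<gamma> t \<and> \<gamma> differentiable (at t)"
    "\<And>t. t \<notin> {0..1} - S \<Longrightarrow> f t = 0"
    "riem_length g \<gamma> = (\<integral>\<^sup>+t. ennreal (f t) \<partial>lborel)"
    using valid_path_speed[OF g \<gamma>] by blast
  obtain r where r: "riem_length g \<gamma> = ennreal r" "0 \<le> r"
    using False by (cases "riem_length g \<gamma>") auto
  have If: "(f has_integral r) UNIV"
    using nn_integral_has_integral[OF f(3,4) _ r(2)] f(7) r(1) by simp
  define F where "F t = (if t \<in> {0..1} - S then dd (vector_derivative \<gamma> (at t)) \<rho> (\<gamma> t) else 0)" for t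
  have "(F has_integral (\<rho> (\<gamma> 1) - \<rho> (\<gamma> 0))) {0..1}"
  proof (rule fundamental_theorem_of_calculus_interior_strong[OF f(1)])
    fix t :: real assume t: "t \<in> {0<..<1} - S"
    then have "(\<gamma> has_vector_derivative vector_derivative \<gamma> (at t)) (at t)"
      using f(5)[of t] vector_derivative_works by auto
    then have "((\<lambda>t. \<rho> (\<gamma> t)) has_derivative (\<lambda>s. dd (s *\<^sub>R vector_derivative \<gamma> (at t)) \<rho> (\<gamma> t))) (at t)"
      unfolding has_vector_derivative_def
      by (rule has_derivative_compose[OF _ has_derivative_dd[OF smooth_UNIV_differentiable[OF \<rho>]]])
    then show "((\<lambda>t. \<rho> (\<gamma> t)) has_vector_derivative F t) (at t)"
      using t by (simp add: has_vector_derivative_def F_def dd_scaleR[OF smooth_UNIV_differentiable[OF \<rho>]])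
  next
    have "continuous_on {0..1} \<gamma>"
      using \<gamma> by (simp add: valid_path_def piecewise_C1_differentiable_on_def)
    then show "continuous_on {0..1} (\<lambda>t. \<rho> (\<gamma> t))"
      using continuous_on_compose2[OF smooth_on_continuous[OF \<rho>]] by blast
  qed simp
  then have IF: "(F has_integral (\<rho> (\<gamma> 1) - \<rho> (\<gamma> 0))) UNIV"
    by (rule has_integral_on_superset) (auto simp: F_def)
  have le: "\<bar>F t\<bar> \<le> f t" for t
  proof (cases "t \<in> {0..1} - S")
    case True
    then show ?thesis
      using f(5)[OF True] grad real_le_rsqrt[of "\<bar>F t\<bar>"] by (simp add: F_def speed_def)
  next
    case False
    then have "F t = 0" unfolding F_def by (rule if_not_P)
    then show ?thesis using f(4)[of t] by simp
  qed
  have "\<rho> (\<gamma> 1) - \<rho> (\<gamma> 0) \<le> r"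
    by (rule has_integral_le[OF IF If]) (use le abs_le_iff in blast)
  moreover have "- (\<rho> (\<gamma> 1) - \<rho> (\<gamma> 0)) \<le> r"
    by (rule has_integral_le[OF has_integral_neg[OF IF] If]) (use le abs_le_iff in blast)
  ultimately show ?thesis
    unfolding r(1) by (intro ennreal_leI) (simp add: pathfinish_def pathstart_def)
qed simp

section \<open>The distance: finiteness, comparison with the norm, completeness\<close>

lemma metric_bounded_on_compact:
  assumes g: "riemannian_metric g" and "compact K"
  obtains C where "C > 0" "\<And>x v. x \<in> K \<Longrightarrow> riem_inner g x v v \<le> C\<^sup>2 * (norm v)\<^sup>2"
proof -
  have "\<exists>B. \<forall>x\<in>K. \<bar>g x $ i $ j\<bar> \<le> B" for i j
  proof -
    have "bounded ((\<lambda>x. g x $ i $ j) ` K)"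
      using assms(2) smooth_on_continuous[OF riemannian_metricD(1)[OF g]]
      by (intro compact_imp_bounded compact_continuous_image) (auto intro: continuous_on_subset)
    then show ?thesis unfolding bounded_iff by auto
  qed
  then obtain B where B: "\<And>i j x. x \<in> K \<Longrightarrow> \<bar>g x $ i $ j\<bar> \<le> B i j" by metis
  \<comment> \<open>The summand 1 gives \<open>C \<ge> 1\<close>, hence
    \<open>C \<le> C\<^sup>2\<close>; a square is convenient for the root in the speed.\<close>
  define C where "C = 1 + (\<Sum>i\<in>UNIV. \<Sum>j\<in>UNIV. \<bar>B i j\<bar>)"
  have C1: "C \<ge> 1" by (simp add: C_def sum_nonneg)
  show thesis
  proof
    show "C > 0" using C1 by simp
    fix x v assume "x \<in> K"
    have "riem_inner g x v v \<le> (\<Sum>i\<in>UNIV. \<Sum>j\<in>UNIV. (norm v)\<^sup>2 * \<bar>B i j\<bar>)"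
      unfolding riem_inner_sum
    proof (intro sum_mono)
      fix i j
      have "v $ i * v $ j * g x $ i $ j \<le> \<bar>v $ i\<bar> * \<bar>v $ j\<bar> * \<bar>g x $ i $ j\<bar>"
        by (metis abs_ge_self abs_mult)
      also have "\<dots> \<le> norm v * norm v * \<bar>B i j\<bar>"
        using B[OF \<open>x \<in> K\<close>, of i j] by (intro mult_mono component_le_norm_cart) auto
      finally show "v $ i * v $ j * g x $ i $ j \<le> (norm v)\<^sup>2 * \<bar>B i j\<bar>" by (simp add: power2_eq_square)
    qed
    also have "\<dots> \<le> C * (norm v)\<^sup>2"
    proof -
      have "(\<Sum>i\<in>UNIV. \<Sum>j\<in>UNIV. (norm v)\<^sup>2 * \<bar>B i j\<bar>) = (norm v)\<^sup>2 * (\<Sum>i\<in>UNIV. \<Sum>j\<in>UNIV. \<bar>B i j\<bar>)"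
        by (simp add: sum_distrib_left)
      then show ?thesis by (simp add: C_def distrib_right distrib_left mult.commute)
    qed
    also have "\<dots> \<le> C\<^sup>2 * (norm v)\<^sup>2"
      using C1 by (intro mult_right_mono) (auto simp: power2_eq_square)
    finally show "riem_inner g x v v \<le> C\<^sup>2 * (norm v)\<^sup>2" .
  qed
qed

lemma riem_length_linepath:
  assumes "C > 0" "\<And>y v. y \<in> closed_segment a b \<Longrightarrow> riem_inner g y v v \<le> C\<^sup>2 * (norm v)\<^sup>2"
  shows "riem_length g (linepath a b) \<le> ennreal (C * norm (b - a))"
proof -
  have "riem_length g (linepath a b) \<le> (\<integral>\<^sup>+t. ennreal (C * norm (b - a)) * indicator {0..1::real} t \<partial>lborel)"
    unfolding riem_length_speed
  proof (intro nn_integral_mono)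
    fix t :: real
    have "speed g (linepath a b) t \<le> C * norm (b - a)" if "t \<in> {0..1}"
    proof -
      have "riem_inner g (linepath a b t) (b - a) (b - a) \<le> (C * norm (b - a))\<^sup>2"
        using assms(2)[of "linepath a b t" "b - a"] linepath_in_path[OF that, of a b]
        by (simp add: power_mult_distrib)
      then show ?thesis
        using assms(1) by (simp add: speed_def vector_derivative_linepath_at real_le_lsqrt)
    qed
    then show "ennreal (speed g (linepath a b) t) * indicator {0..1} t \<le> ennreal (C * norm (b - a)) * indicator {0..1} t"
      by (auto simp: indicator_def intro: ennreal_leI)
  qed
  also have "\<dots> = ennreal (C * norm (b - a))"
    by (simp add: nn_integral_cmult_indicator)
  finally show ?thesis .
qed

text \<open>The infimum before \<open>enn2real\<close>, which would send an infinite value to 0.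
  Segments show that it is finite, so inequalities between distances can be proved for extended
  reals.\<close>

definition riem_edist :: "(real^'n::finite \<Rightarrow> real^'n^'n) \<Rightarrow> real^'n \<Rightarrow> real^'n \<Rightarrow> ennreal" where
  "riem_edist g x y = (INF \<gamma>\<in>{\<gamma>. valid_path \<gamma> \<and> pathstart \<gamma> = x \<and> pathfinish \<gamma> = y}. riem_length g \<gamma>)"

lemma riem_dist_edist: "riem_dist g x y = enn2real (riem_edist g x y)"
  by (simp add: riem_dist_def riem_edist_def)

lemma riem_dist_nonneg: "0 \<le> riem_dist g x y"
  by (simp add: riem_dist_edist)

lemma riem_edist_le: "valid_path \<gamma> \<Longrightarrow> riem_edist g (pathstart \<gamma>) (pathfinish \<gamma>) \<le> riem_length g \<gamma>"
  unfolding riem_edist_def by (rule INF_lower) simp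

lemma riem_edist_linepath:
  assumes "C > 0" "\<And>y v. y \<in> closed_segment a b \<Longrightarrow> riem_inner g y v v \<le> C\<^sup>2 * (norm v)\<^sup>2"
  shows "riem_edist g a b \<le> ennreal (C * norm (b - a))"
  by (rule order_trans[OF riem_edist_le[of "linepath a b" g, simplified] riem_length_linepath[OF assms]])

lemma riem_edist_finite:
  assumes g: "riemannian_metric g"
  shows "riem_edist g x y = ennreal (riem_dist g x y)"
proof -
  obtain C where "C > 0" "\<And>z v. z \<in> closed_segment x y \<Longrightarrow> riem_inner g z v v \<le> C\<^sup>2 * (norm v)\<^sup>2"
    using metric_bounded_on_compact[OF g compact_segment, of x y] by blast
  then have "riem_edist g x y < \<infinity>"
    using riem_edist_linepath[of C x y g] ennreal_less_top le_less_trans by fastforce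
  then show ?thesis by (simp add: riem_dist_edist)
qed

lemma riem_dist_le_length:
  assumes "valid_path \<gamma>" "riem_length g \<gamma> \<le> ennreal r" "0 \<le> r"
  shows "riem_dist g (pathstart \<gamma>) (pathfinish \<gamma>) \<le> r"
  unfolding riem_dist_edist
  using enn2real_mono[of _ "ennreal r"] riem_edist_le[OF assms(1), of g] assms(2,3)
  by (metis enn2real_ennreal ennreal_less_top order_trans)

lemma riem_dist_ge:
  assumes g: "riemannian_metric g" and \<rho>: "smooth_on UNIV \<rho>"
    and grad: "\<And>x v. (dd v \<rho> x)\<^sup>2 \<le> riem_inner g x v v"
  shows "\<bar>\<rho> y - \<rho> x\<bar> \<le> riem_dist g x y"
proof -
  have "ennreal \<bar>\<rho> y - \<rho> x\<bar> \<le> riem_edist g x y"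
    unfolding riem_edist_def using riem_length_ge[OF g _ \<rho> grad] by (intro INF_greatest) auto
  then show ?thesis
    unfolding riem_edist_finite[OF g] by (simp add: riem_dist_edist)
qed

text \<open>The linear coordinate in the direction of \<open>y - x\<close> has slope at most 1 for a
  metric above the Euclidean one.\<close>

lemma riem_dist_ge_norm:
  assumes g: "riemannian_metric g" and lower: "\<And>x v. (norm v)\<^sup>2 \<le> riem_inner g x v v"
  shows "norm (y - x) \<le> riem_dist g x y"
proof -
  define u where "u = sgn (y - x)"
  define \<rho> where "\<rho> = (\<lambda>z. u \<bullet> z)"
  have "\<rho> = (\<lambda>z. \<Sum>i\<in>UNIV. u $ i * z $ i)" by (simp add: \<rho>_def inner_vec_def)
  then have "smooth_on UNIV \<rho>" by (auto intro!: smooth_on_sum smooth_on_mult)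
  moreover have "dd v \<rho> z = u \<bullet> v" for v z
    unfolding \<rho>_def by (rule dd_eqI) (auto intro!: derivative_eq_intros)
  moreover have "(u \<bullet> v)\<^sup>2 \<le> riem_inner g z v v" for v z
  proof -
    have "\<bar>u \<bullet> v\<bar> \<le> norm u * norm v" by (rule Cauchy_Schwarz_ineq2)
    also have "\<dots> \<le> norm v" by (simp add: u_def norm_sgn)
    finally have "(u \<bullet> v)\<^sup>2 \<le> (norm v)\<^sup>2" using power_mono[of "\<bar>u \<bullet> v\<bar>" "norm v" 2] by simp
    then show ?thesis using lower[of v z] by simp
  qed
  ultimately have "\<bar>\<rho> y - \<rho> x\<bar> \<le> riem_dist g x y" using riem_dist_ge[OF g] by metis
  moreover have "\<rho> y - \<rho> x = u \<bullet> (y - x)" by (simp add: \<rho>_def inner_diff_right)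
  moreover have "u \<bullet> (y - x) = norm (y - x)"
    unfolding u_def sgn_div_norm by (simp only: inner_scaleR_left dot_square_norm) (simp add: power2_eq_square field_simps)
  ultimately show ?thesis by simp
qed

lemma riem_dist_triangle:
  assumes g: "riemannian_metric g"
  shows "riem_dist g x z \<le> riem_dist g x y + riem_dist g y z"
proof -
  have 1: "riem_edist g x z \<le> riem_length g \<gamma> + riem_length g \<delta>"
    if "valid_path \<gamma>" "pathstart \<gamma> = x" "pathfinish \<gamma> = y" "valid_path \<delta>" "pathstart \<delta> = y" "pathfinish \<delta> = z" for \<gamma> \<delta>
    using riem_edist_le[of "\<gamma> +++ \<delta>" g] riem_length_join[OF g, of \<gamma> \<delta>] that by (simp add: valid_path_join)
  have "riem_edist g x z \<le> riem_edist g x y + riem_edist g y z"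
  proof (rule ennreal_le_epsilon)
    fix e :: real assume "0 < e"
    have *: "\<exists>\<gamma>. valid_path \<gamma> \<and> pathstart \<gamma> = a \<and> pathfinish \<gamma> = b \<and> riem_length g \<gamma> < riem_edist g a b + ennreal (e/2)" for a b
    proof -
      have "riem_edist g a b < riem_edist g a b + ennreal (e/2)"
        using \<open>0 < e\<close> unfolding riem_edist_finite[OF g]
        by (subst ennreal_plus[symmetric]) (auto simp: riem_dist_edist intro!: ennreal_lessI)
      then show ?thesis
        unfolding riem_edist_def by (subst (asm) INF_less_iff) auto
    qed
    obtain \<gamma> \<delta> where p: "valid_path \<gamma>" "pathstart \<gamma> = x" "pathfinish \<gamma> = y" "riem_length g \<gamma> < riem_edist g x y + ennreal (e/2)"
       "valid_path \<delta>" "pathstart \<delta> = y" "pathfinish \<delta> = z" "riem_length g \<delta> < riem_edist g y z + ennreal (e/2)"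
      using *[of x y] *[of y z] by blast
    have "riem_edist g x z \<le> riem_length g \<gamma> + riem_length g \<delta>" using 1 p by blast
    also have "\<dots> \<le> (riem_edist g x y + ennreal (e/2)) + (riem_edist g y z + ennreal (e/2))"
      using p by (intro add_mono) auto
    also have "\<dots> = riem_edist g x y + riem_edist g y z + (ennreal (e/2) + ennreal (e/2))"
      by (simp add: add_ac)
    also have "ennreal (e/2) + ennreal (e/2) = ennreal e"
      using \<open>0 < e\<close> by (subst ennreal_plus[symmetric]) auto
    finally show "riem_edist g x z \<le> riem_edist g x y + riem_edist g y z + ennreal e" .
  qed
  then show ?thesis
    unfolding riem_edist_finite[OF g] by (simp add: ennreal_plus[symmetric] riem_dist_nonneg del: ennreal_plus)
qed

lemma riem_dist_commute:
  assumes g: "riemannian_metric g"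
  shows "riem_dist g x y = riem_dist g y x"
proof -
  have "riem_edist g y x \<le> riem_edist g x y" for x y
    unfolding riem_edist_def[of g x y]
  proof (rule INF_greatest, clarify)
    fix \<gamma> :: "real \<Rightarrow> real^'a" assume "valid_path \<gamma>"
    then show "riem_edist g (pathfinish \<gamma>) (pathstart \<gamma>) \<le> riem_length g \<gamma>"
      using riem_edist_le[of "reversepath \<gamma>" g] riem_length_reversepath[OF g] by simp
  qed
  then show ?thesis unfolding riem_dist_edist by (metis order_antisym)
qed

lemma Metric_space_riem_dist:
  assumes g: "riemannian_metric g" and lower: "\<And>x v. (norm v)\<^sup>2 \<le> riem_inner g x v v"
  shows "Metric_space UNIV (riem_dist g)"
proof
  show "riem_dist g x y = 0 \<longleftrightarrow> x = y" for x y
  proof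
    show "riem_dist g x y = 0 \<Longrightarrow> x = y" using riem_dist_ge_norm[OF assms, of y x] by simp
    assume "x = y"
    have "riem_edist g x x \<le> ennreal (1 * norm (x - x))"
      using riem_edist_le[of "linepath x x" g]
      by (simp add: riem_length_speed speed_def vector_derivative_linepath_at riem_inner_def)
    then show "riem_dist g x y = 0" using \<open>x = y\<close> by (simp add: riem_dist_edist)
  qed
qed (rule riem_dist_nonneg riem_dist_commute[OF g] riem_dist_triangle[OF g])+

text \<open>Cauchy sequences for the larger distance are Euclidean Cauchy sequences; on a unit ball
  around the Euclidean limit the metric is at most a multiple of the Euclidean one, so the
  convergence carries over to the larger distance.\<close>

lemma complete_metricI:
  assumes g: "riemannian_metric g" and lower: "\<And>x v. (norm v)\<^sup>2 \<le> riem_inner g x v v"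
  shows "complete_metric g"
proof -
  interpret Metric_space UNIV "riem_dist g" by (rule Metric_space_riem_dist[OF assms])
  show ?thesis
    unfolding complete_metric_def mcomplete_def
  proof (intro allI impI)
    fix \<sigma> assume \<sigma>: "MCauchy \<sigma>"
    have "Cauchy \<sigma>"
      unfolding Cauchy_def
    proof (intro allI impI)
      fix e :: real assume "e > 0"
      then obtain N where N: "\<And>n n'. N \<le> n \<Longrightarrow> N \<le> n' \<Longrightarrow> riem_dist g (\<sigma> n) (\<sigma> n') < e"
        using \<sigma> unfolding MCauchy_def by blast
      then show "\<exists>M. \<forall>m\<ge>M. \<forall>n\<ge>M. dist (\<sigma> m) (\<sigma> n) < e"
        using riem_dist_ge_norm[OF assms] unfolding dist_norm by (meson le_less_trans)
    qed
    then obtain x where x: "\<sigma> \<longlonglongrightarrow> x" using Cauchy_convergent convergent_def by blast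
    obtain C where C: "C > 0" "\<And>y v. y \<in> cball x 1 \<Longrightarrow> riem_inner g y v v \<le> C\<^sup>2 * (norm v)\<^sup>2"
      using metric_bounded_on_compact[OF g compact_cball] by blast
    have near: "riem_dist g y x \<le> C * norm (y - x)" if "y \<in> cball x 1" for y
    proof -
      have "closed_segment x y \<subseteq> cball x 1"
        using that by (intro closed_segment_subset) auto
      then have "riem_edist g x y \<le> ennreal (C * norm (y - x))"
        using C by (intro riem_edist_linepath) auto
      then have "riem_dist g x y \<le> C * norm (y - x)"
        unfolding riem_edist_finite[OF g] using C(1) by (subst (asm) ennreal_le_iff) auto
      then show ?thesis by (simp add: commute)
    qed
    have "limitin mtopology \<sigma> x sequentially"
      unfolding limitin_metric
    proof (intro conjI allI impI)
      fix e :: real assume "e > 0"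
      then have "min 1 (e / C) > 0" using C(1) by simp
      from tendstoD[OF x this]
      show "\<forall>\<^sub>F n in sequentially. \<sigma> n \<in> UNIV \<and> riem_dist g (\<sigma> n) x < e"
      proof eventually_elim
        case (elim n)
        then have "\<sigma> n \<in> cball x 1" "C * norm (\<sigma> n - x) < e"
          using C(1) by (auto simp: dist_norm norm_minus_commute field_simps)
        then show ?case using near[of "\<sigma> n"] by auto
      qed
    qed simp
    then show "\<exists>x. limitin mtopology \<sigma> x sequentially" by blast
  qed
qed

subsection \<open>The radial profile of the collars\<close>

text \<open>The standard flat function \<open>exp (- 1 / x)\<close>, multiplied by negative powers
  of \<open>x\<close>: derivatives of members are combinations of members, which yields smoothness
  at 0.\<close>

definition flat_exp :: "nat \<Rightarrow> real \<Rightarrow> real" where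
  "flat_exp m x = (if x \<le> 0 then 0 else inverse x ^ m * exp (- inverse x))"

lemma flat_exp_tendsto_0: "(flat_exp m \<longlongrightarrow> 0) (at 0)"
proof (rule filterlim_split_at)
  have "\<forall>\<^sub>F x in at_left 0. flat_exp m x = 0"
    by (simp add: eventually_at_filter flat_exp_def)
  then show "(flat_exp m \<longlongrightarrow> 0) (at_left 0)" by (rule tendsto_eventually)
  have "((\<lambda>x. inverse x ^ m / exp (inverse x)) \<longlongrightarrow> 0) (at_right (0::real))"
    by (rule filterlim_compose[OF tendsto_power_div_exp_0 filterlim_inverse_at_top_right])
  moreover have "\<forall>\<^sub>F x in at_right 0. inverse x ^ m / exp (inverse x) = flat_exp m x"
    by (simp add: eventually_at_filter flat_exp_def exp_minus divide_inverse)
  ultimately show "(flat_exp m \<longlongrightarrow> 0) (at_right 0)"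
    by (rule Lim_transform_eventually)
qed

lemma flat_exp_deriv:
  "(flat_exp m has_real_derivative flat_exp (m + 2) x - real m * flat_exp (Suc m) x) (at x)"
proof -
  consider "x < 0" | "x = 0" | "x > 0" by linarith
  then show ?thesis
  proof cases
    case 1
    have "((\<lambda>x. 0) has_real_derivative 0) (at x)" by simp
    then have "(flat_exp m has_real_derivative 0) (at x)"
      by (rule has_field_derivative_transform_within_open[of _ _ _ "{..<0}"])
        (use 1 in \<open>auto simp: flat_exp_def\<close>)
    then show ?thesis using 1 by (simp add: flat_exp_def)
  next
    case 2
    \<comment> \<open>The difference quotient at 0 is itself a member of the family; for
      \<open>h = 0\<close> both sides are 0 because division by 0 gives 0.\<close>
    have "(\<lambda>h. (flat_exp m (0 + h) - flat_exp m 0) / h) = flat_exp (Suc m)"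
      by (simp add: flat_exp_def fun_eq_iff divide_inverse)
    then have "(flat_exp m has_real_derivative 0) (at 0)"
      using flat_exp_tendsto_0[of "Suc m"] by (simp add: DERIV_def)
    then show ?thesis using 2 by (simp add: flat_exp_def)
  next
    case 3
    have i: "(inverse has_real_derivative - (inverse x ^ 2)) (at x)"
      using 3 by (auto intro!: derivative_eq_intros simp: power2_eq_square)
    have "((\<lambda>x. inverse x ^ m * exp (- inverse x)) has_real_derivative
        real m * inverse x ^ (m - 1) * - (inverse x ^ 2) * exp (- inverse x)
        + inverse x ^ m * (exp (- inverse x) * - (- (inverse x ^ 2)))) (at x)"
      by (rule derivative_eq_intros DERIV_power i refl | simp)+
    moreover have "real m * inverse x ^ (m - 1) * - (inverse x ^ 2) * exp (- inverse x)
        + inverse x ^ m * (exp (- inverse x) * - (- (inverse x ^ 2))) =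
        flat_exp (m + 2) x - real m * flat_exp (Suc m) x"
      using 3 by (cases m) (simp_all add: flat_exp_def power_add power2_eq_square algebra_simps)
    ultimately have "((\<lambda>x. inverse x ^ m * exp (- inverse x)) has_real_derivative
        flat_exp (m + 2) x - real m * flat_exp (Suc m) x) (at x)" by simp
    then show ?thesis
      by (rule has_field_derivative_transform_within_open[of _ _ _ "{0<..}"])
        (use 3 in \<open>auto simp: flat_exp_def\<close>)
  qed
qed

lemma rsmooth_flat_exp: "rsmooth UNIV (flat_exp m)"
proof -
  have "rC_on k UNIV (flat_exp m)" for k
  proof (induction k arbitrary: m)
    case 0
    show ?case
      unfolding rC_on.simps by (intro continuous_at_imp_continuous_on ballI DERIV_isCont[OF flat_exp_deriv])
  next
    case (Suc k)
    have "rC_on k UNIV (\<lambda>x. - real m)"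
      using rsmooth_const unfolding rsmooth_def by blast
    from rC_on_add[OF Suc.IH[of "m + 2"] rC_on_mult[OF this Suc.IH[of "Suc m"]]]
    have "rC_on k UNIV (\<lambda>x. flat_exp (m + 2) x - real m * flat_exp (Suc m) x)" by simp
    then show ?case
      unfolding rC_on.simps
      by (intro exI[of _ "\<lambda>x. flat_exp (m + 2) x - real m * flat_exp (Suc m) x"] conjI ballI flat_exp_deriv)
  qed
  then show ?thesis by (simp add: rsmooth_def)
qed

text \<open>A smooth substitute for \<open>max 0 y\<close>, different from it only between 0 and 1;
  the quotient is the usual smooth step.\<close>

definition ramp :: "real \<Rightarrow> real" where
  "ramp y = y * (flat_exp 0 y / (flat_exp 0 y + flat_exp 0 (1 - y)))"

lemma flat_exp_nonneg: "0 \<le> flat_exp 0 x" and flat_exp_pos: "0 < x \<Longrightarrow> 0 < flat_exp 0 x"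
  by (simp_all add: flat_exp_def)

lemma flat_exp_sum_pos: "0 < flat_exp 0 y + flat_exp 0 (1 - y)"
  using flat_exp_nonneg[of y] flat_exp_nonneg[of "1 - y"] flat_exp_pos[of y] flat_exp_pos[of "1 - y"]
  by linarith

lemma ramp_le_0 [simp]: "y \<le> 0 \<Longrightarrow> ramp y = 0"
  by (simp add: ramp_def flat_exp_def)

lemma ramp_ge_1 [simp]: "1 \<le> y \<Longrightarrow> ramp y = y"
  using flat_exp_pos[of y] by (simp add: ramp_def flat_exp_def[of 0 "1 - y"])

lemma ramp_nonneg: "0 \<le> ramp y" and ramp_le: "0 \<le> y \<Longrightarrow> ramp y \<le> y"
proof -
  let ?s = "flat_exp 0 y / (flat_exp 0 y + flat_exp 0 (1 - y))"
  have "0 \<le> ?s" "?s \<le> 1"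
    using flat_exp_sum_pos[of y] flat_exp_nonneg[of y] flat_exp_nonneg[of "1 - y"] by auto
  then have s: "0 \<le> ?s" "?s \<le> 1" by blast+
  show "0 \<le> ramp y"
  proof (cases "y \<le> 0")
    case False
    then show ?thesis unfolding ramp_def by (intro mult_nonneg_nonneg s(1)) simp
  qed simp
  show "ramp y \<le> y" if "0 \<le> y"
    unfolding ramp_def using mult_left_mono[OF s(2) that] by simp
qed

lemma rsmooth_ramp: "rsmooth UNIV ramp"
proof -
  have 1: "rsmooth UNIV (\<lambda>y. flat_exp 0 (1 - y))"
    by (rule rsmooth_compose[OF rsmooth_flat_exp]) (auto intro: rsmooth_diff)
  have 2: "rsmooth UNIV (\<lambda>y. inverse (flat_exp 0 y + flat_exp 0 (1 - y)))"
  proof (rule rsmooth_compose[of "- {0}" inverse UNIV "\<lambda>y. flat_exp 0 y + flat_exp 0 (1 - y)"])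
    show "(\<lambda>y. flat_exp 0 y + flat_exp 0 (1 - y)) ` UNIV \<subseteq> - {0}"
      using flat_exp_sum_pos by (auto simp: less_imp_neq[symmetric])
  qed (auto intro: rsmooth_add rsmooth_flat_exp 1)
  have "rsmooth UNIV (\<lambda>y. y * (flat_exp 0 y * inverse (flat_exp 0 y + flat_exp 0 (1 - y))))"
    by (intro rsmooth_mult rsmooth_flat_exp 2 rsmooth_id)
  then show ?thesis by (simp add: ramp_def[abs_def] divide_inverse)
qed

lemma rsmooth_has_deriv:
  assumes "rsmooth UNIV f"
  shows "(f has_real_derivative deriv f x) (at x)" "rsmooth UNIV (deriv f)"
proof -
  have "\<exists>f'. \<forall>x. (f has_real_derivative f' x) (at x)"
    using assms[unfolded rsmooth_def, rule_format, of "Suc 0"] by auto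
  then show *: "(f has_real_derivative deriv f x) (at x)" for x
    using DERIV_imp_deriv by metis
  show "rsmooth UNIV (deriv f)"
    by (rule rsmooth_deriv[OF assms]) (auto intro: *)
qed

text \<open>Outside the interval from 0 to 1 the second derivative vanishes, and inside it the
  weight \<open>1 + ramp y\<close> is at most 2. The weight supplies a denominator that the second
  derivative of \<open>log_growth\<close> needs.\<close>

lemma ramp_deriv_bound:
  obtains B where "B \<ge> 1" "\<And>y. \<bar>deriv ramp y\<bar> \<le> B" "\<And>y. \<bar>deriv (deriv ramp) y\<bar> * (1 + ramp y) \<le> B"
proof -
  note d1 = rsmooth_has_deriv[OF rsmooth_ramp] and d2 = rsmooth_has_deriv[OF rsmooth_has_deriv(2)[OF rsmooth_ramp]]
  have c: "continuous_on {0..1} (deriv ramp)" "continuous_on {0..1} (deriv (deriv ramp))"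
    using d1(2) d2(2) unfolding rsmooth_def by (metis continuous_on_subset rC_on.simps(1) subset_UNIV)+
  have bd: "\<exists>B. \<forall>y\<in>{0..1}. \<bar>f y\<bar> \<le> B" if "continuous_on {0..1} f" for f :: "real \<Rightarrow> real"
    using compact_imp_bounded[OF compact_continuous_image[OF that]] by (auto simp: bounded_iff)
  obtain B1 B2 where B: "\<And>y. y \<in> {0..1} \<Longrightarrow> \<bar>deriv ramp y\<bar> \<le> B1" "\<And>y. y \<in> {0..1} \<Longrightarrow> \<bar>deriv (deriv ramp) y\<bar> \<le> B2"
    using bd[OF c(1)] bd[OF c(2)] by blast
  have n: "deriv ramp y = 0" if "y < 0" for y
  proof -
    have "((\<lambda>_. 0) has_real_derivative 0) (at y)" by simp
    then have "(ramp has_real_derivative 0) (at y)"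
      by (rule has_field_derivative_transform_within_open[of _ _ _ "{..<0}"]) (use that in auto)
    then show ?thesis by (rule DERIV_imp_deriv)
  qed
  have n2: "deriv (deriv ramp) y = 0" if "y < 0" for y
  proof -
    have "((\<lambda>_. 0) has_real_derivative 0) (at y)" by simp
    then have "(deriv ramp has_real_derivative 0) (at y)"
      by (rule has_field_derivative_transform_within_open[of _ _ _ "{..<0}"]) (use that n in auto)
    then show ?thesis by (rule DERIV_imp_deriv)
  qed
  have p: "deriv ramp y = 1" if "y > 1" for y
  proof -
    have "((\<lambda>y. y) has_real_derivative 1) (at y)" by simp
    then have "(ramp has_real_derivative 1) (at y)"
      by (rule has_field_derivative_transform_within_open[of _ _ _ "{1<..}"]) (use that in auto)
    then show ?thesis by (rule DERIV_imp_deriv)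
  qed
  have p2: "deriv (deriv ramp) y = 0" if "y > 1" for y
  proof -
    have "((\<lambda>_. 1) has_real_derivative 0) (at y)" by simp
    then have "(deriv ramp has_real_derivative 0) (at y)"
      by (rule has_field_derivative_transform_within_open[of _ _ _ "{1<..}"]) (use that p in auto)
    then show ?thesis by (rule DERIV_imp_deriv)
  qed
  show thesis
  proof (rule that[of "1 + \<bar>B1\<bar> + 2 * \<bar>B2\<bar>"])
    show "\<bar>deriv ramp y\<bar> \<le> 1 + \<bar>B1\<bar> + 2 * \<bar>B2\<bar>" for y
      using n[of y] p[of y] B(1)[of y] by (cases "y < 0"; cases "y > 1") auto
    show "\<bar>deriv (deriv ramp) y\<bar> * (1 + ramp y) \<le> 1 + \<bar>B1\<bar> + 2 * \<bar>B2\<bar>" for y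
    proof (cases "y < 0 \<or> y > 1")
      case True
      then show ?thesis using n2[of y] p2[of y] by auto
    next
      case False
      then have y: "y \<in> {0..1}" by auto
      have "\<bar>deriv (deriv ramp) y\<bar> * (1 + ramp y) \<le> \<bar>B2\<bar> * 2"
        using B(2)[OF y] ramp_le[of y] ramp_nonneg[of y] y by (intro mult_mono) auto
      then show ?thesis by linarith
    qed
  qed simp
qed

text \<open>Written as \<open>exp (- l) = (1 + ramp (N * (2 - ramp (16 * \<xi> - 1)))) / (1 + 2 *
  N)\<close>: the inner ramp starts the descent smoothly at \<open>\<xi> = 1 / 16\<close>, from
  \<open>\<xi> = 1 / 8\<close> on the argument of the outer ramp is affine, and the outer ramp stops
  the descent at \<open>\<xi> = 3 / 16\<close>, where the numerator has fallen from
  \<open>1 + 2 * N\<close> to 1.\<close>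

definition log_growth :: "real \<Rightarrow> real \<Rightarrow> real" where
  "log_growth N \<xi> = ln (1 + 2 * N) - ln (1 + ramp (N * (2 - ramp (16 * \<xi> - 1))))"

context
  fixes N :: real
  assumes N: "N \<ge> 1"
begin

lemma exp_log_growth: "exp (log_growth N \<xi>) = (1 + 2 * N) / (1 + ramp (N * (2 - ramp (16 * \<xi> - 1))))"
  using N ramp_nonneg[of "N * (2 - ramp (16 * \<xi> - 1))"] by (simp add: log_growth_def exp_diff)

lemma log_growth_inner: "\<xi> \<le> 1 / 16 \<Longrightarrow> log_growth N \<xi> = 0"
  using N by (simp add: log_growth_def mult.commute)

lemma log_growth_outer:
  assumes "3 / 16 \<le> \<xi>"
  shows "log_growth N \<xi> = ln (1 + 2 * N)"
proof -
  have "N * (2 - (16 * \<xi> - 1)) \<le> 0" using N assms by (intro mult_nonneg_nonpos) auto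
  then show ?thesis using assms by (simp add: log_growth_def)
qed

lemma log_growth_arg: "0 \<le> ramp (N * (2 - ramp (16 * \<xi> - 1)))" "ramp (N * (2 - ramp (16 * \<xi> - 1))) \<le> 2 * N"
proof -
  let ?m = "2 - ramp (16 * \<xi> - 1)"
  show "0 \<le> ramp (N * ?m)" by (rule ramp_nonneg)
  have "N * ?m \<le> 2 * N" using N ramp_nonneg[of "16 * \<xi> - 1"] by (simp add: algebra_simps)
  moreover have "ramp (N * ?m) \<le> max 0 (N * ?m)"
    using ramp_le[of "N * ?m"] by (cases "0 \<le> N * ?m") auto
  ultimately show "ramp (N * ?m) \<le> 2 * N" using N by linarith
qed

lemma log_growth_range: "0 \<le> log_growth N \<xi>" "log_growth N \<xi> \<le> ln (1 + 2 * N)"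
  using log_growth_arg[of \<xi>] by (simp_all add: log_growth_def)

lemma rsmooth_log_growth: "rsmooth UNIV (log_growth N)"
proof -
  have 1: "rsmooth UNIV (\<lambda>\<xi>. ramp (16 * \<xi> - 1))"
    by (rule rsmooth_compose[OF rsmooth_ramp]) (auto intro!: rsmooth_diff rsmooth_mult)
  have 2: "rsmooth UNIV (\<lambda>\<xi>. ramp (N * (2 - ramp (16 * \<xi> - 1))))"
    by (rule rsmooth_compose[OF rsmooth_ramp]) (auto intro!: rsmooth_diff rsmooth_mult 1)
  have "rsmooth UNIV (\<lambda>\<xi>. ln (1 + ramp (N * (2 - ramp (16 * \<xi> - 1)))))"
    by (rule rsmooth_compose[OF rsmooth_ln])
      (use log_growth_arg(1) in \<open>auto intro!: rsmooth_add 2 simp: add_pos_nonneg\<close>)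
  then show ?thesis
    unfolding log_growth_def[abs_def] by (intro rsmooth_diff) auto
qed

text \<open>This bounds the integral of \<open>exp ((p + 1) * log_growth N)\<close> along a radial path by a multiple
  of \<open>exp (p * log_growth N)\<close>.\<close>

lemma log_growth_decay:
  assumes "0 \<le> \<xi>" "\<xi> \<le> 3 / 16" "0 \<le> t" "t \<le> 1"
  shows "exp (log_growth N (t\<^sup>2 * \<xi>)) \<le> 4 / (exp (- log_growth N \<xi>) + (1 - t))"
proof -
  define M where "M \<xi> = N * (2 - ramp (16 * \<xi> - 1))" for \<xi>
  define h where "h \<xi> = (1 + ramp (M \<xi>)) / (1 + 2 * N)" for \<xi>
  have h: "exp (log_growth N \<xi>) = 1 / h \<xi>" "exp (- log_growth N \<xi>) = h \<xi>" "0 < h \<xi>" "h \<xi> \<le> 1" for \<xi>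
    using N log_growth_arg[of \<xi>] exp_log_growth[of \<xi>] by (simp_all add: h_def M_def exp_minus)
  \<comment> \<open>Replacing an affine function by its ramp costs at most a factor 2.\<close>
  have r: "1 + y \<le> 2 * (1 + ramp y)" for y
    using ramp_nonneg[of y] by (cases "y \<le> 1") auto
  have "h \<xi> + (1 - t) \<le> 4 * h (t\<^sup>2 * \<xi>)"
  \<comment> \<open>Either the intermediate point lies where \<open>h\<close> is still at least 1/2,
    which suffices since both summands on the left are at most 1, or both points lie where
    \<open>M\<close> is affine.\<close>
  proof (cases "t\<^sup>2 * \<xi> \<le> 1 / 8")
    case True
    have "ramp (16 * (t\<^sup>2 * \<xi>) - 1) \<le> 1"
      using True ramp_le[of "16 * (t\<^sup>2 * \<xi>) - 1"] by (cases "16 * (t\<^sup>2 * \<xi>) - 1 \<le> 0") auto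
    then have "N * 1 \<le> M (t\<^sup>2 * \<xi>)" unfolding M_def using N by (intro mult_left_mono) auto
    then have "1 + 2 * N \<le> 2 * (1 + ramp (M (t\<^sup>2 * \<xi>)))" using N by simp
    then have "1 / 2 \<le> h (t\<^sup>2 * \<xi>)" using N by (simp add: h_def field_simps)
    then show ?thesis using h(4)[of \<xi>] assms by linarith
  next
    case False
    have "t\<^sup>2 * \<xi> \<le> 1 * \<xi>" using assms by (intro mult_right_mono) (auto simp: power_le_one)
    then have \<xi>: "1 / 8 \<le> \<xi>" using False by simp
    have M: "M \<xi> = N * (3 - 16 * \<xi>)" "M (t\<^sup>2 * \<xi>) = N * (3 - 16 * (t\<^sup>2 * \<xi>))"
      using \<xi> False by (simp_all add: M_def algebra_simps)
    have "0 \<le> M \<xi>" unfolding M using N assms by simp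
    \<comment> \<open>Although the tube function grows quadratically along the path,
      \<open>t\<^sup>2 \<le> t\<close> makes the gain in \<open>M\<close> at least linear in
      \<open>1 - t\<close>.\<close>
    have "t\<^sup>2 \<le> t * 1" unfolding power2_eq_square using assms by (intro mult_left_mono) auto
    then have "(1 - t) * (1 / 8) \<le> (1 - t\<^sup>2) * \<xi>" using \<xi> assms by (intro mult_mono) auto
    then have "1 - t \<le> 8 * ((1 - t\<^sup>2) * \<xi>)" by simp
    then have "2 * (1 - t) \<le> 16 * (\<xi> - t\<^sup>2 * \<xi>)" by (simp add: left_diff_distrib)
    then have "N * (2 * (1 - t)) \<le> N * (16 * (\<xi> - t\<^sup>2 * \<xi>))" using N by (intro mult_left_mono) auto
    then have d: "M \<xi> + N * (2 * (1 - t)) \<le> M (t\<^sup>2 * \<xi>)" unfolding M by (simp add: algebra_simps)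
    have "(1 + ramp (M \<xi>)) + (1 - t) * (1 + 2 * N) \<le> (1 + M \<xi>) + (1 - t) + N * (2 * (1 - t))"
      using ramp_le[OF \<open>0 \<le> M \<xi>\<close>] by (simp add: algebra_simps)
    also have "\<dots> \<le> 2 * (1 + M (t\<^sup>2 * \<xi>))" 
    proof -
      have "0 \<le> N * (2 * (1 - t))" using N assms by (intro mult_nonneg_nonneg) auto
      then have "M \<xi> + N * (2 * (1 - t)) \<le> 2 * M (t\<^sup>2 * \<xi>)" using d \<open>0 \<le> M \<xi>\<close> by linarith
      then show ?thesis using assms(3) by (simp add: distrib_left)
    qed
    also have "\<dots> \<le> 4 * (1 + ramp (M (t\<^sup>2 * \<xi>)))" using r[of "M (t\<^sup>2 * \<xi>)"] by simp
    finally have "(1 + ramp (M \<xi>) + (1 - t) * (1 + 2 * N)) / (1 + 2 * N) \<le> 4 * (1 + ramp (M (t\<^sup>2 * \<xi>))) / (1 + 2 * N)"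
      using N by (intro divide_right_mono) auto
    moreover have "(1 + ramp (M \<xi>) + (1 - t) * (1 + 2 * N)) / (1 + 2 * N) = h \<xi> + (1 - t)"
      using N by (simp add: h_def add_divide_distrib)
    ultimately show ?thesis by (simp add: h_def)
  qed
  moreover have "0 < h \<xi> + (1 - t)" using h(3)[of \<xi>] assms by linarith
  ultimately show ?thesis
    unfolding h using frac_le[of 4 4 "h \<xi> + (1 - t)" "4 * h (t\<^sup>2 * \<xi>)"] h(3)[of "t\<^sup>2 * \<xi>"] by simp
qed

end

text \<open>With \<open>D = 1 + ramp M\<close> one has \<open>exp l = (1 + 2 * N) / D\<close>, and
  every derivative of \<open>M\<close> is of order \<open>N\<close>. In \<open>l'\<close> this
  factor is paired with \<open>1 / D\<close>. In \<open>l''\<close> the term with two factors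
  \<open>M1\<close> has one \<open>1 / D\<close> too few; the weighted bound on the second
  derivative of the ramp provides the other. The three terms of \<open>l''\<close> have 256 each,
  hence 768.\<close>

lemma log_growth_deriv_bound:
  obtains C where "C \<ge> 1"
    "\<And>N \<xi>. N \<ge> 1 \<Longrightarrow> \<bar>deriv (log_growth N) \<xi>\<bar> \<le> C * exp (log_growth N \<xi>)"
    "\<And>N \<xi>. N \<ge> 1 \<Longrightarrow> \<bar>deriv (deriv (log_growth N)) \<xi>\<bar> \<le> C * (exp (log_growth N \<xi>))\<^sup>2"
proof -
  obtain B where B: "B \<ge> 1" "\<And>y. \<bar>deriv ramp y\<bar> \<le> B" "\<And>y. \<bar>deriv (deriv ramp) y\<bar> * (1 + ramp y) \<le> B"
    using ramp_deriv_bound by blast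
  let ?r1 = "deriv ramp" and ?r2 = "deriv (deriv ramp)"
  note r1 = rsmooth_has_deriv[OF rsmooth_ramp] and r2 = rsmooth_has_deriv[OF rsmooth_has_deriv(2)[OF rsmooth_ramp]]
  have B2: "\<bar>?r2 y\<bar> \<le> B" for y
    using B(3)[of y] ramp_nonneg[of y] mult_left_mono[of 1 "1 + ramp y" "\<bar>?r2 y\<bar>"] by simp
  have main: "\<bar>deriv (log_growth N) \<xi>\<bar> \<le> 16 * B\<^sup>2 * exp (log_growth N \<xi>) \<and>
     \<bar>deriv (deriv (log_growth N)) \<xi>\<bar> \<le> 768 * B ^ 4 * (exp (log_growth N \<xi>))\<^sup>2" if N: "N \<ge> 1" for N \<xi>
  proof -
    define M M1 M2 where "M \<xi> = N * (2 - ramp (16 * \<xi> - 1))" and "M1 \<xi> = - (16 * N * ?r1 (16 * \<xi> - 1))"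
      and "M2 \<xi> = - (256 * N * ?r2 (16 * \<xi> - 1))" for \<xi>
    define D where "D \<xi> = 1 + ramp (M \<xi>)" for \<xi>
    have Dpos: "D \<xi> \<ge> 1" for \<xi> by (simp add: D_def ramp_nonneg)
    have "((\<lambda>\<xi>. ramp (16 * \<xi> - 1)) has_real_derivative ?r1 (16 * \<xi> - 1) * 16) (at \<xi>)" for \<xi>
      by (rule DERIV_chain2[OF r1(1)]) (auto intro!: derivative_eq_intros)
    then have dM: "(M has_real_derivative M1 \<xi>) (at \<xi>)" for \<xi>
      unfolding M_def[abs_def] M1_def by (auto intro!: derivative_eq_intros)
    have "((\<lambda>\<xi>. ?r1 (16 * \<xi> - 1)) has_real_derivative ?r2 (16 * \<xi> - 1) * 16) (at \<xi>)" for \<xi>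
      by (rule DERIV_chain2[OF r2(1)]) (auto intro!: derivative_eq_intros)
    then have dM1: "(M1 has_real_derivative M2 \<xi>) (at \<xi>)" for \<xi>
      unfolding M1_def[abs_def] M2_def by (auto intro!: derivative_eq_intros)
    have dD: "(D has_real_derivative ?r1 (M \<xi>) * M1 \<xi>) (at \<xi>)" for \<xi>
      unfolding D_def[abs_def] using DERIV_chain2[OF r1(1) dM] by (auto intro!: derivative_eq_intros)
    have dr: "((\<lambda>\<xi>. ?r1 (M \<xi>)) has_real_derivative ?r2 (M \<xi>) * M1 \<xi>) (at \<xi>)" for \<xi>
      by (rule DERIV_chain2[OF r2(1) dM])
    have eq: "log_growth N = (\<lambda>\<xi>. ln (1 + 2 * N) - ln (D \<xi>))"
      by (simp add: log_growth_def D_def M_def fun_eq_iff)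
    have Dp: "D \<xi> > 0" for \<xi> using Dpos[of \<xi>] by linarith
    have l1: "(log_growth N has_real_derivative - (?r1 (M \<xi>) * M1 \<xi> / D \<xi>)) (at \<xi>)" for \<xi>
      unfolding eq using Dp[of \<xi>] by (auto intro!: derivative_eq_intros dD)
    have l1': "deriv (log_growth N) = (\<lambda>\<xi>. - (?r1 (M \<xi>) * M1 \<xi> / D \<xi>))"
      using DERIV_imp_deriv[OF l1] by blast
    have "(deriv (log_growth N) has_real_derivative
        - (((?r1 (M \<xi>) * M2 \<xi> + ?r2 (M \<xi>) * M1 \<xi> * M1 \<xi>) * D \<xi> - ?r1 (M \<xi>) * M1 \<xi> * (?r1 (M \<xi>) * M1 \<xi>)) / (D \<xi> * D \<xi>))) (at \<xi>)"
      unfolding l1' by (intro DERIV_minus DERIV_divide DERIV_mult' dr dM1 dD) (use Dp[of \<xi>] in simp)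
    then have l2: "deriv (deriv (log_growth N)) \<xi> =
        - ((?r1 (M \<xi>) * M2 \<xi> + ?r2 (M \<xi>) * M1 \<xi> * M1 \<xi>) / D \<xi>) + (?r1 (M \<xi>) * M1 \<xi> / D \<xi>)\<^sup>2"
      using Dp[of \<xi>] by (subst DERIV_imp_deriv) (auto simp: power2_eq_square field_simps)
    define W where "W = exp (log_growth N \<xi>)"
    have W: "W = (1 + 2 * N) / D \<xi>" by (simp add: W_def exp_log_growth[OF N] D_def M_def)
    have W1: "W \<ge> 1" using log_growth_range(1)[OF N, of \<xi>] by (simp add: W_def)
    have ND: "N / D \<xi> \<le> W" using N Dp[of \<xi>] by (simp add: W divide_right_mono)
    have ND0: "N / D \<xi> \<ge> 0" using N Dp[of \<xi>] by simp
    have M1: "\<bar>M1 \<xi>\<bar> \<le> 16 * B * N"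
      using B(2)[of "16 * \<xi> - 1"] N by (simp add: M1_def abs_mult)
    have M2: "\<bar>M2 \<xi>\<bar> \<le> 256 * B * N"
      using B2[of "16 * \<xi> - 1"] N by (simp add: M2_def abs_mult)
    have "\<bar>?r1 (M \<xi>) * M1 \<xi>\<bar> \<le> B * (16 * B * N)"
      unfolding abs_mult using B M1 by (intro mult_mono) auto
    then have "\<bar>?r1 (M \<xi>) * M1 \<xi> / D \<xi>\<bar> \<le> B * (16 * B * N) / D \<xi>"
      using Dp[of \<xi>] by (simp add: divide_right_mono)
    also have "\<dots> = 16 * B\<^sup>2 * (N / D \<xi>)" by (simp add: power2_eq_square)
    also have "\<dots> \<le> 16 * B\<^sup>2 * W" using ND by (intro mult_left_mono) auto
    finally have t1: "\<bar>?r1 (M \<xi>) * M1 \<xi> / D \<xi>\<bar> \<le> 16 * B\<^sup>2 * W" .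
    have "\<bar>?r1 (M \<xi>) * M2 \<xi>\<bar> \<le> B * (256 * B * N)"
      unfolding abs_mult using B M2 by (intro mult_mono) auto
    then have "\<bar>?r1 (M \<xi>) * M2 \<xi> / D \<xi>\<bar> \<le> B * (256 * B * N) / D \<xi>"
      using Dp[of \<xi>] by (simp add: divide_right_mono)
    also have "\<dots> = 256 * B\<^sup>2 * (N / D \<xi>)" by (simp add: power2_eq_square)
    also have "\<dots> \<le> 256 * B ^ 4 * W\<^sup>2"
      using ND ND0 W1 B(1) by (intro mult_mono) (auto simp: power_increasing self_le_power intro: order_trans)
    finally have t2: "\<bar>?r1 (M \<xi>) * M2 \<xi> / D \<xi>\<bar> \<le> 256 * B ^ 4 * W\<^sup>2" .
    have "\<bar>?r2 (M \<xi>)\<bar> \<le> B / D \<xi>"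
      using B(3)[of "M \<xi>"] Dp[of \<xi>] by (simp add: D_def field_simps)
    then have "\<bar>?r2 (M \<xi>) * M1 \<xi> * M1 \<xi>\<bar> \<le> B / D \<xi> * (16 * B * N) * (16 * B * N)"
      unfolding abs_mult using M1 B N Dp[of \<xi>] by (intro mult_mono) auto
    then have "\<bar>?r2 (M \<xi>) * M1 \<xi> * M1 \<xi> / D \<xi>\<bar> \<le> B / D \<xi> * (16 * B * N) * (16 * B * N) / D \<xi>"
      unfolding abs_divide[of _ "D \<xi>"] abs_of_pos[OF Dp] using Dp[of \<xi>] by (intro divide_right_mono) auto
    also have "\<dots> = 256 * B ^ 3 * (N / D \<xi>)\<^sup>2" by (simp add: power2_eq_square power3_eq_cube)
    also have "\<dots> \<le> 256 * B ^ 4 * W\<^sup>2"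
      using ND ND0 B(1) by (intro mult_mono power_mono) (auto simp: power_increasing)
    finally have t3: "\<bar>?r2 (M \<xi>) * M1 \<xi> * M1 \<xi> / D \<xi>\<bar> \<le> 256 * B ^ 4 * W\<^sup>2" .
    have "(?r1 (M \<xi>) * M1 \<xi> / D \<xi>)\<^sup>2 \<le> (16 * B\<^sup>2 * W)\<^sup>2"
      using power_mono[OF t1 abs_ge_zero, of 2] unfolding power2_abs .
    then have t4: "(?r1 (M \<xi>) * M1 \<xi> / D \<xi>)\<^sup>2 \<le> 256 * B ^ 4 * W\<^sup>2"
      by (simp add: power_mult_distrib)
    have "\<bar>deriv (deriv (log_growth N)) \<xi>\<bar> \<le> 768 * B ^ 4 * W\<^sup>2"
      unfolding l2 add_divide_distrib using t2 t3 t4 zero_le_power2[of "?r1 (M \<xi>) * M1 \<xi> / D \<xi>"] by linarith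
    then show ?thesis using t1 by (simp add: l1' W_def)
  qed
  show thesis
  proof (rule that[of "768 * B ^ 4"])
    have "1 \<le> B ^ 4" using B(1) by (rule one_le_power)
    then show "1 \<le> 768 * B ^ 4" by linarith
    have "16 * B\<^sup>2 \<le> 768 * B ^ 4" using B(1) by (intro mult_mono power_increasing) auto
    then show "\<bar>deriv (log_growth N) \<xi>\<bar> \<le> 768 * B ^ 4 * exp (log_growth N \<xi>)" if "N \<ge> 1" for N \<xi>
      using main[OF that, of \<xi>]
        mult_right_mono[of "16 * B\<^sup>2" "768 * B ^ 4" "exp (log_growth N \<xi>)", OF _ exp_ge_zero] by linarith
  qed (use main in blast)
qed

subsection \<open>A single collar\<close>

text \<open>Fixed before any \<open>N\<close>, since one constant must serve all collars although
  \<open>N\<close> grows with the index of the collar.\<close>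

definition growth_const :: real where
  "growth_const = (SOME C. C \<ge> 1 \<and>
    (\<forall>N \<xi>. N \<ge> 1 \<longrightarrow> \<bar>deriv (log_growth N) \<xi>\<bar> \<le> C * exp (log_growth N \<xi>) \<and>
      \<bar>deriv (deriv (log_growth N)) \<xi>\<bar> \<le> C * (exp (log_growth N \<xi>))\<^sup>2))"

lemma growth_const:
  "growth_const \<ge> 1"
  "N \<ge> 1 \<Longrightarrow> \<bar>deriv (log_growth N) \<xi>\<bar> \<le> growth_const * exp (log_growth N \<xi>)"
  "N \<ge> 1 \<Longrightarrow> \<bar>deriv (deriv (log_growth N)) \<xi>\<bar> \<le> growth_const * (exp (log_growth N \<xi>))\<^sup>2"
proof -
  obtain C where "C \<ge> 1 \<and>
    (\<forall>N \<xi>. N \<ge> 1 \<longrightarrow> \<bar>deriv (log_growth N) \<xi>\<bar> \<le> C * exp (log_growth N \<xi>) \<and>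
      \<bar>deriv (deriv (log_growth N)) \<xi>\<bar> \<le> C * (exp (log_growth N \<xi>))\<^sup>2)"
    using log_growth_deriv_bound by metis
  from someI[of "\<lambda>C. C \<ge> 1 \<and>
    (\<forall>N \<xi>. N \<ge> 1 \<longrightarrow> \<bar>deriv (log_growth N) \<xi>\<bar> \<le> C * exp (log_growth N \<xi>) \<and>
      \<bar>deriv (deriv (log_growth N)) \<xi>\<bar> \<le> C * (exp (log_growth N \<xi>))\<^sup>2)", OF this]
  show "growth_const \<ge> 1"
  "N \<ge> 1 \<Longrightarrow> \<bar>deriv (log_growth N) \<xi>\<bar> \<le> growth_const * exp (log_growth N \<xi>)"
  "N \<ge> 1 \<Longrightarrow> \<bar>deriv (deriv (log_growth N)) \<xi>\<bar> \<le> growth_const * (exp (log_growth N \<xi>))\<^sup>2"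
    unfolding growth_const_def[symmetric] by blast+
qed

text \<open>An orthogonal matrix that takes a coordinate axis to \<open>w\<close> conjugates this
  rank one update of a scalar matrix to a diagonal matrix.\<close>

lemma det_rank_one_update:
  fixes w :: "real^'n::finite"
  assumes "norm w = 1"
  shows "det (\<chi> a b. \<alpha> * (if a = b then 1 else 0) + \<beta> * w $ a * w $ b) = \<alpha> ^ (CARD('n) - 1) * (\<alpha> + \<beta>)"
proof -
  fix i :: 'n
  let ?A = "\<chi> a b. \<alpha> * (if a = b then 1 else 0) + \<beta> * w $ a * w $ b"
  obtain Q where Q: "orthogonal_matrix Q" "Q *v axis i 1 = w"
    using orthogonal_matrix_exists_basis[OF assms] by blast
  have Qi: "Q $ a $ i = w $ a" for a
    using Q(2) by (auto simp: vec_eq_iff matrix_vector_mul_component inner_axis)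
  have QQ: "(\<Sum>a\<in>UNIV. Q $ a $ b * Q $ a $ d) = (if b = d then 1 else 0)" for b d
  proof -
    have "transpose Q ** Q = mat 1" using Q(1) by (simp add: orthogonal_matrix_def)
    then have "(transpose Q ** Q) $ b $ d = mat 1 $ b $ d" by simp
    then show ?thesis by (simp add: matrix_matrix_mult_def transpose_def mat_def)
  qed
  have Qw: "(\<Sum>a\<in>UNIV. Q $ a $ b * w $ a) = (if b = i then 1 else 0)" for b
    using QQ[of b i] by (simp add: Qi)
  define D where "D = transpose Q ** ?A ** Q"
  have QA: "(\<Sum>a\<in>UNIV. Q $ a $ b * ?A $ a $ e) = \<alpha> * Q $ e $ b + \<beta> * w $ e * (if b = i then 1 else 0)" for b e
  proof -
    have "(\<Sum>a\<in>UNIV. Q $ a $ b * ?A $ a $ e) =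
        (\<Sum>a\<in>UNIV. (if a = e then \<alpha> * Q $ a $ b else 0)) + \<beta> * w $ e * (\<Sum>a\<in>UNIV. Q $ a $ b * w $ a)"
      unfolding sum_distrib_left sum.distrib[symmetric] by (intro sum.cong) (auto simp: algebra_simps)
    then show ?thesis by (simp add: Qw)
  qed
  have D: "D $ b $ d = \<alpha> * (if b = d then 1 else 0) + \<beta> * (if b = i then 1 else 0) * (if d = i then 1 else 0)" for b d
  proof -
    have "D $ b $ d = (\<Sum>e\<in>UNIV. (\<Sum>a\<in>UNIV. Q $ a $ b * ?A $ a $ e) * Q $ e $ d)"
      by (simp add: D_def matrix_matrix_mult_def transpose_def)
    also have "\<dots> = (\<Sum>e\<in>UNIV. (\<alpha> * Q $ e $ b + \<beta> * w $ e * (if b = i then 1 else 0)) * Q $ e $ d)"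
      unfolding QA ..
    also have "\<dots> = \<alpha> * (\<Sum>e\<in>UNIV. Q $ e $ b * Q $ e $ d)
        + \<beta> * (if b = i then 1 else 0) * (\<Sum>e\<in>UNIV. Q $ e $ d * w $ e)"
      unfolding sum_distrib_left sum.distrib[symmetric] by (intro sum.cong) (auto simp: algebra_simps)
    finally show ?thesis by (simp add: QQ Qw)
  qed
  have "det D = (\<Prod>b\<in>UNIV. D $ b $ b)"
    by (rule det_diagonal) (auto simp: D)
  also have "\<dots> = (\<Prod>b\<in>UNIV. \<alpha> + (if b = i then \<beta> else 0))"
    by (intro prod.cong refl) (simp add: D)
  also have "\<dots> = (\<alpha> + \<beta>) * (\<Prod>b\<in>UNIV - {i}. \<alpha>)"
    by (subst prod.remove[of UNIV i]) auto
  also have "\<dots> = \<alpha> ^ (CARD('n) - 1) * (\<alpha> + \<beta>)"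
    by (simp add: card_Diff_singleton)
  finally have "det D = \<alpha> ^ (CARD('n) - 1) * (\<alpha> + \<beta>)" .
  moreover have "det D = det ?A"
    using det_orthogonal_matrix[OF Q(1)] by (auto simp: D_def det_mul)
  ultimately show ?thesis by simp
qed

text \<open>\<open>c\<close> is the factor of the flat metric inside the tube, \<open>L\<close> the
  radius of the core circle, and \<open>ln (1 + 2 * N)\<close> the final value of \<open>l\<close>.
  The exponent \<open>p\<close> is tied to the dimension only when the collars are glued.\<close>

locale collar =
  fixes i j :: "'n::finite" and m :: "real^'n" and c L N :: real and p :: nat
  assumes ij: "i \<noteq> j" and c_pos: "c > 0" and L_pos: "L > 0" and N_ge: "N \<ge> 1" and p_pos: "p > 0"
begin

definition nc :: "real^'n \<Rightarrow> real^'n" where "nc x = (1 / L) *\<^sub>R (x - m)"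

text \<open>The tube is modelled on the circle of radius 1 (after rescaling) that passes through the
  centre \<open>m\<close> and bounds a disc in the plane of the axes \<open>i\<close>, \<open>j\<close>: \<open>radius2\<close> is the squared
  distance from the axis of rotation of this circle, and \<open>tube\<close> vanishes exactly on it.\<close>

definition radius2 :: "real^'n \<Rightarrow> real" where
  "radius2 x = (nc x $ i + 1)\<^sup>2 + (nc x $ j)\<^sup>2"

definition tube :: "real^'n \<Rightarrow> real" where
  "tube x = (radius2 x - 1)\<^sup>2 + (\<Sum>k\<in>- {i, j}. (nc x $ k)\<^sup>2)"

text \<open>The generator of the rotation. Its squared length is \<open>radius2\<close>, so
  \<open>angular x $ a * angular x $ b / radius2 x\<close> is the matrix of the orthogonal
  projection to the orbit direction.\<close>

definition angular :: "real^'n \<Rightarrow> real^'n" where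
  "angular x = (\<chi> k. if k = i then - nc x $ j else if k = j then nc x $ i + 1 else 0)"

definition base_exp :: "real \<Rightarrow> real" where
  "base_exp \<xi> = 2 * (p + 1) * log_growth N \<xi>"

text \<open>The orbits of the rotation are shrunk by \<open>exp (- p * l * (1 - l / M))\<close> relative to the other
  directions, where \<open>l = log_growth N \<xi>\<close> runs from 0 to \<open>M = ln (1 + 2 * N)\<close>.  Thus \<open>circle_exp\<close>
  agrees with \<open>base_exp\<close> at both ends of the collar, but is nonnegative throughout.\<close>

definition circle_exp :: "real \<Rightarrow> real" where
  "circle_exp \<xi> = 2 * log_growth N \<xi> + 2 * p * (log_growth N \<xi>)\<^sup>2 / ln (1 + 2 * N)"

text \<open>On the axis of rotation the quotient by \<open>radius2 x = 0\<close> is 0 by convention.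
  This is harmless: \<open>tube x \<ge> 1\<close> there, where the two exponentials agree.\<close>

definition collar_metric :: "real^'n \<Rightarrow> real^'n^'n" where
  "collar_metric x = (\<chi> a b. c * (exp (base_exp (tube x)) * (if a = b then 1 else 0)
     + (exp (circle_exp (tube x)) - exp (base_exp (tube x))) / radius2 x * angular x $ a * angular x $ b))"

lemma sum_split: "(\<Sum>k\<in>UNIV. f k) = f i + f j + (\<Sum>k\<in>- {i, j}. f k)" for f :: "'n \<Rightarrow> real"
proof -
  have "(\<Sum>k\<in>UNIV. f k) = (\<Sum>k\<in>{i, j}. f k) + (\<Sum>k\<in>- {i, j}. f k)"
    by (subst sum.union_disjoint[symmetric]) auto
  then show ?thesis using ij by simp
qed

lemma inner_split: "u \<bullet> v = u $ i * v $ i + u $ j * v $ j + (\<Sum>k\<in>- {i, j}. u $ k * v $ k)"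
  unfolding inner_vec_def by (simp add: sum_split)

lemma norm_split: "(norm v)\<^sup>2 = (v $ i)\<^sup>2 + (v $ j)\<^sup>2 + (\<Sum>k\<in>- {i, j}. (v $ k)\<^sup>2)"
  unfolding power2_norm_eq_inner inner_split by (simp add: power2_eq_square)

lemma angular_inner: "angular x \<bullet> v = (nc x $ i + 1) * v $ j - nc x $ j * v $ i"
  using ij by (simp add: inner_split angular_def)

lemma norm_angular: "(norm (angular x))\<^sup>2 = radius2 x"
  using ij by (simp add: norm_split angular_def radius2_def)

lemma radius2_nonneg: "0 \<le> radius2 x"
  by (simp add: radius2_def)

lemma collar_metric_form:
  "riem_inner collar_metric x u v = c * (exp (base_exp (tube x)) * (u \<bullet> v)
     + (exp (circle_exp (tube x)) - exp (base_exp (tube x))) / radius2 x * (angular x \<bullet> u) * (angular x \<bullet> v))"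
proof -
  define A B where "A = exp (base_exp (tube x))"
    and "B = (exp (circle_exp (tube x)) - exp (base_exp (tube x))) / radius2 x"
  have "riem_inner collar_metric x u v =
      c * (\<Sum>a\<in>UNIV. \<Sum>b\<in>UNIV. (if a = b then A * (u $ a * v $ b) else 0))
      + c * B * (\<Sum>a\<in>UNIV. \<Sum>b\<in>UNIV. (angular x $ a * u $ a) * (angular x $ b * v $ b))"
    unfolding riem_inner_sum collar_metric_def vec_lambda_beta
    unfolding B_def[symmetric] unfolding A_def[symmetric]
    unfolding sum_distrib_left sum.distrib[symmetric]
    by (intro sum.cong refl) (simp add: algebra_simps)
  also have "(\<Sum>a\<in>UNIV. \<Sum>b\<in>UNIV. (angular x $ a * u $ a) * (angular x $ b * v $ b)) = (angular x \<bullet> u) * (angular x \<bullet> v)"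
    by (simp add: inner_vec_def sum_product)
  also have "(\<Sum>a\<in>UNIV. \<Sum>b\<in>UNIV. (if a = b then A * (u $ a * v $ b) else 0)) = A * (u \<bullet> v)"
    by (simp add: inner_vec_def sum_distrib_left)
  finally have "riem_inner collar_metric x u v =
      c * (A * (u \<bullet> v) + B * (angular x \<bullet> u) * (angular x \<bullet> v))" by (simp add: algebra_simps)
  then show ?thesis unfolding A_def B_def .
qed

lemma ln_ge_1: "1 \<le> ln (1 + 2 * N)"
proof -
  have "exp 1 \<le> (3::real)" using exp_le by simp
  then have "exp 1 \<le> 1 + 2 * N" using N_ge by linarith
  then show ?thesis using N_ge by (subst ln_ge_iff) auto
qed

lemmas growth_nonneg = log_growth_range(1)[OF N_ge] and growth_le = log_growth_range(2)[OF N_ge]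

lemma exp_order: "0 \<le> circle_exp \<xi>" "circle_exp \<xi> \<le> base_exp \<xi>"
proof -
  have M: "0 < ln (1 + 2 * N)" using ln_ge_1 by linarith
  show "0 \<le> circle_exp \<xi>" unfolding circle_exp_def using growth_nonneg[of \<xi>] M by simp
  have "(log_growth N \<xi>)\<^sup>2 / ln (1 + 2 * N) \<le> log_growth N \<xi>"
    using mult_left_mono[OF growth_le[of \<xi>] growth_nonneg[of \<xi>]] M
    by (simp add: divide_le_eq power2_eq_square)
  then have "2 * p * ((log_growth N \<xi>)\<^sup>2 / ln (1 + 2 * N)) \<le> 2 * p * log_growth N \<xi>"
    by (intro mult_left_mono) auto
  then show "circle_exp \<xi> \<le> base_exp \<xi>"
    by (simp add: circle_exp_def base_exp_def algebra_simps)
qed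

lemma angular_cauchy: "(angular x \<bullet> v)\<^sup>2 / radius2 x \<le> (norm v)\<^sup>2"
proof (cases "radius2 x = 0")
  case False
  have "(angular x \<bullet> v)\<^sup>2 \<le> (norm (angular x) * norm v)\<^sup>2"
    using Cauchy_Schwarz_ineq2[of "angular x" v] power_mono[of "\<bar>angular x \<bullet> v\<bar>" _ 2] by simp
  then show ?thesis
    using False radius2_nonneg[of x] by (simp add: power_mult_distrib norm_angular divide_le_eq mult.commute)
qed simp

text \<open>If \<open>W\<close> is the squared orbit component of \<open>v\<close>, the form is
  \<open>c * (P * ((norm v)\<^sup>2 - W) + R * W)\<close> with \<open>1 \<le> R \<le> P\<close>. The
  third bound drops the orbit direction, in which functions of \<open>tube\<close> do not
  change.\<close>

lemma collar_metric_bounds: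
  shows "c * (norm v)\<^sup>2 \<le> riem_inner collar_metric x v v"
    and "riem_inner collar_metric x v v \<le> c * exp (base_exp (tube x)) * (norm v)\<^sup>2"
    and "c * exp (base_exp (tube x)) * ((norm v)\<^sup>2 - (angular x \<bullet> v)\<^sup>2 / radius2 x) \<le> riem_inner collar_metric x v v"
proof -
  define P R W where "P = exp (base_exp (tube x))" and "R = exp (circle_exp (tube x))"
    and "W = (angular x \<bullet> v)\<^sup>2 / radius2 x"
  have PR: "1 \<le> R" "R \<le> P" using exp_order by (auto simp: P_def R_def)
  have W: "0 \<le> W" "W \<le> (norm v)\<^sup>2" using angular_cauchy radius2_nonneg by (auto simp: W_def)
  have eq: "riem_inner collar_metric x v v = c * (P * ((norm v)\<^sup>2 - W) + R * W)"
    by (simp add: collar_metric_form P_def R_def W_def power2_eq_square dot_square_norm algebra_simps diff_divide_distrib)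
  have "1 * ((norm v)\<^sup>2 - W) \<le> P * ((norm v)\<^sup>2 - W)" "1 * W \<le> R * W" "R * W \<le> P * W"
    using PR W by (intro mult_right_mono; simp)+
  then show "c * (norm v)\<^sup>2 \<le> riem_inner collar_metric x v v"
    "riem_inner collar_metric x v v \<le> c * exp (base_exp (tube x)) * (norm v)\<^sup>2"
    unfolding eq mult.assoc P_def[symmetric] using c_pos
    by (intro mult_left_mono; simp add: algebra_simps)+
  show "c * exp (base_exp (tube x)) * ((norm v)\<^sup>2 - (angular x \<bullet> v)\<^sup>2 / radius2 x) \<le> riem_inner collar_metric x v v"
    unfolding eq mult.assoc P_def[symmetric] W_def[symmetric] using c_pos PR W
    by (intro mult_left_mono) auto
qed

lemma tube_nonneg: "0 \<le> tube x"
  by (simp add: tube_def sum_nonneg)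

lemma tube_small:
  assumes "tube x \<le> 3 / 16"
  shows "\<bar>radius2 x - 1\<bar> \<le> 1 / 2" "(\<Sum>k\<in>- {i, j}. (nc x $ k)\<^sup>2) \<le> 1 / 4"
proof -
  have s: "0 \<le> (\<Sum>k\<in>- {i, j}. (nc x $ k)\<^sup>2)" by (simp add: sum_nonneg)
  then have "(radius2 x - 1)\<^sup>2 \<le> (1 / 2)\<^sup>2"
    using assms by (simp add: tube_def power2_eq_square)
  then show "\<bar>radius2 x - 1\<bar> \<le> 1 / 2" by (subst (asm) abs_le_square_iff[symmetric]) simp
  have "0 \<le> (radius2 x - 1)\<^sup>2" by simp
  then show "(\<Sum>k\<in>- {i, j}. (nc x $ k)\<^sup>2) \<le> 1 / 4" using assms unfolding tube_def by linarith
qed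

lemma norm_nc: "norm (nc x) = norm (x - m) / L"
  using L_pos by (simp add: nc_def)

text \<open>The core circle passes through \<open>m\<close>, so a small ball around \<open>m\<close>
  is inside the tube. Together with \<open>tube_outer\<close> this locates the collar between the
  radii \<open>L / 16\<close> and \<open>3 * L\<close>, on which the gluing rests.\<close>

lemma tube_inner:
  assumes "norm (x - m) \<le> L / 16"
  shows "tube x < 1 / 16"
proof -
  define r where "r = norm (nc x)"
  have r: "0 \<le> r" "r \<le> 1 / 16" using assms L_pos by (auto simp: r_def norm_nc field_simps)
  have "radius2 x - 1 = 2 * nc x $ i + ((nc x $ i)\<^sup>2 + (nc x $ j)\<^sup>2)"
    by (simp add: radius2_def power2_eq_square algebra_simps)
  moreover have "(nc x $ i)\<^sup>2 + (nc x $ j)\<^sup>2 \<le> r\<^sup>2" "(\<Sum>k\<in>- {i, j}. (nc x $ k)\<^sup>2) \<le> r\<^sup>2"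
    unfolding r_def norm_split by (simp_all add: sum_nonneg)
  moreover have "\<bar>nc x $ i\<bar> \<le> r" unfolding r_def by (rule component_le_norm_cart)
  moreover have "r\<^sup>2 \<le> r / 16" using r mult_left_mono[OF r(2) r(1)] by (simp add: power2_eq_square)
  ultimately have "\<bar>radius2 x - 1\<bar> \<le> 3 * r" "(\<Sum>k\<in>- {i, j}. (nc x $ k)\<^sup>2) \<le> r / 16"
    using r sum_power2_ge_zero[of "nc x $ i" "nc x $ j"] by linarith+
  moreover from this(1) have "(radius2 x - 1)\<^sup>2 \<le> (3 / 16)\<^sup>2"
    using r by (intro abs_le_square_iff[THEN iffD1]) auto
  ultimately show ?thesis using r by (simp add: tube_def power2_eq_square)
qed

lemma tube_outer:
  assumes "tube x \<le> 3 / 16"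
  shows "norm (x - m) < 3 * L"
proof -
  have "(nc x $ i + 1)\<^sup>2 + (nc x $ j)\<^sup>2 \<le> 3 / 2"
    using tube_small(1)[OF assms] unfolding radius2_def[symmetric] by linarith
  moreover have "(nc x $ i)\<^sup>2 \<le> 2 * (nc x $ i + 1)\<^sup>2 + 2"
    using zero_le_power2[of "nc x $ i + 2"] by (simp add: power2_eq_square algebra_simps)
  ultimately have "(norm (nc x))\<^sup>2 \<le> 6"
    unfolding norm_split using tube_small(2)[OF assms] zero_le_power2[of "nc x $ j"] by linarith
  then have "(norm (nc x))\<^sup>2 < 3\<^sup>2" by simp
  then have "norm (nc x) < 3" by (rule power_less_imp_less_base) simp
  then show ?thesis using L_pos by (simp add: norm_nc field_simps)
qed

lemma collar_metric_inner: "tube x \<le> 1 / 16 \<Longrightarrow> collar_metric x = (\<chi> a b. if a = b then c else 0)"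
  using log_growth_inner[OF N_ge, of "tube x"]
  by (simp add: collar_metric_def base_exp_def circle_exp_def vec_eq_iff)

lemma outer_exp:
  assumes "3 / 16 \<le> \<xi>"
  shows "base_exp \<xi> = 2 * (p + 1) * ln (1 + 2 * N)" "circle_exp \<xi> = base_exp \<xi>"
  using log_growth_outer[OF N_ge assms] ln_ge_1
  by (simp_all add: base_exp_def circle_exp_def power2_eq_square algebra_simps)

lemma exp_ln_N: "exp (2 * (p + 1) * ln (1 + 2 * N)) = (1 + 2 * N) ^ (2 * (p + 1))"
proof -
  have "exp (real (2 * (p + 1)) * ln (1 + 2 * N)) = exp (ln (1 + 2 * N)) ^ (2 * (p + 1))"
    by (rule exp_of_nat_mult)
  then show ?thesis using N_ge by simp
qed

lemma collar_metric_outer: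
  "3 / 16 \<le> tube x \<Longrightarrow> collar_metric x = (\<chi> a b. if a = b then c * (1 + 2 * N) ^ (2 * (p + 1)) else 0)"
  using outer_exp[of "tube x"] exp_ln_N
  by (simp add: collar_metric_def vec_eq_iff)

lemma det_collar_metric:
  "det (collar_metric x) = c ^ CARD('n) * exp (base_exp (tube x)) ^ (CARD('n) - 1) * exp (circle_exp (tube x))"
proof -
  define P R where "P = exp (base_exp (tube x))" and "R = exp (circle_exp (tube x))"
  have n: "x ^ CARD('n) = x ^ (CARD('n) - 1) * x" for x :: real
    by (rule power_minus_mult[symmetric]) simp
  have "\<exists>w. norm w = 1 \<and> collar_metric x = (\<chi> a b. c * P * (if a = b then 1 else 0) + c * (R - P) * w $ a * w $ b)"
  proof (cases "radius2 x = 0")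
    case True
    \<comment> \<open>On the axis the two eigenvalues coincide, so any unit vector can serve as
      \<open>w\<close>.\<close>
    then have "tube x \<ge> 3 / 16" by (simp add: tube_def sum_nonneg)
    then have "R = P" using outer_exp by (simp add: R_def P_def)
    then have "collar_metric x = (\<chi> a b. c * P * (if a = b then 1 else 0) + c * (R - P) * axis i 1 $ a * axis i 1 $ b)"
      unfolding collar_metric_def P_def[symmetric] R_def[symmetric] by (simp add: vec_eq_iff)
    then show ?thesis using norm_axis_1 by blast
  next
    case False
    define w where "w = (1 / sqrt (radius2 x)) *\<^sub>R angular x"
    have "norm (angular x) = sqrt (radius2 x)"
      using norm_angular[of x] real_sqrt_unique by fastforce
    then have "norm w = 1" using False radius2_nonneg[of x] by (simp add: w_def)
    moreover have "w $ a * w $ b = angular x $ a * angular x $ b / radius2 x" for a b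
      using radius2_nonneg[of x] by (simp add: w_def)
    then have "collar_metric x = (\<chi> a b. c * P * (if a = b then 1 else 0) + c * (R - P) * w $ a * w $ b)"
      unfolding collar_metric_def P_def[symmetric] R_def[symmetric] vec_eq_iff vec_lambda_beta mult.assoc
      by (simp add: algebra_simps)
    ultimately show ?thesis by blast
  qed
  then obtain w where w: "norm w = 1"
    "collar_metric x = (\<chi> a b. c * P * (if a = b then 1 else 0) + c * (R - P) * w $ a * w $ b)" by blast
  show ?thesis
    unfolding w(2) det_rank_one_update[OF w(1)] P_def[symmetric] R_def[symmetric]
    by (simp add: n power_mult_distrib algebra_simps)
qed

lemma nc_component: "nc x $ k = (1 / L) * (x $ k - m $ k)"
  by (simp add: nc_def)

lemma smooth_nc: "smooth_on U (\<lambda>x. nc x $ k)"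
proof -
  have "smooth_on UNIV (\<lambda>x. nc x $ k)"
    unfolding nc_component by (intro smooth_on_mult smooth_on_diff) auto
  then show ?thesis by (rule smooth_on_subset) simp
qed

lemma smooth_radius2: "smooth_on UNIV radius2"
  unfolding radius2_def[abs_def] by (intro smooth_on_add smooth_on_power smooth_nc) auto

lemma smooth_tube: "smooth_on UNIV tube"
  unfolding tube_def[abs_def]
  by (intro smooth_on_add smooth_on_power smooth_on_diff smooth_on_sum smooth_nc smooth_radius2) auto

lemma rsmooth_base_exp: "rsmooth UNIV base_exp"
  unfolding base_exp_def[abs_def] by (intro rsmooth_mult rsmooth_log_growth[OF N_ge]) auto

lemma rsmooth_circle_exp: "rsmooth UNIV circle_exp"
  unfolding circle_exp_def[abs_def] divide_inverse power2_eq_square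
  by (intro rsmooth_add rsmooth_mult rsmooth_log_growth[OF N_ge]) auto

lemma smooth_exp_tube:
  assumes "rsmooth UNIV f"
  shows "smooth_on UNIV (\<lambda>x. exp (f (tube x)))"
  by (rule smooth_on_compose[OF _ rsmooth_exp[of UNIV] smooth_on_compose[OF _ assms smooth_tube]]) auto

lemma open_tube: "open {x. tube x < r}" "open {x. r < tube x}"
  using smooth_on_continuous[OF smooth_tube] by (auto intro: open_Collect_less continuous_intros)

text \<open>Two open sets cover the space: where \<open>tube x < 1\<close> the axis is avoided and
  the formula is smooth; where \<open>tube x > 3 / 16\<close> the metric is constant.\<close>

lemma smooth_collar_metric: "smooth_on UNIV (\<lambda>x. collar_metric x $ a $ b)"
proof (rule smooth_on_locally)
  fix x
  show "\<exists>V. open V \<and> x \<in> V \<and> smooth_on V (\<lambda>x. collar_metric x $ a $ b)"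
  proof (cases "tube x < 1")
    case True
    let ?V = "{x. tube x < 1}"
    have V: "open ?V" by (rule open_tube)
    have nz: "radius2 x \<noteq> 0" if "x \<in> ?V" for x
      using that sum_nonneg[of "- {i, j}" "\<lambda>k. (nc x $ k)\<^sup>2"] by (auto simp: tube_def)
    have sub: "smooth_on ?V f" if "smooth_on UNIV f" for f
      using that smooth_on_subset by blast
    have ang: "smooth_on ?V (\<lambda>x. angular x $ k)" for k
      unfolding angular_def vec_lambda_beta
      using smooth_on_uminus[OF V smooth_nc[of ?V j]] smooth_on_add[OF V smooth_nc[of ?V i], of "\<lambda>_. 1"]
      by (cases "k = i"; cases "k = j") simp_all
    have "smooth_on ?V (\<lambda>x. collar_metric x $ a $ b)"
      unfolding collar_metric_def vec_lambda_beta
      by (intro smooth_on_mult smooth_on_add smooth_on_diff smooth_on_divide V ang nz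
          smooth_exp_tube[THEN sub] smooth_radius2[THEN sub] rsmooth_base_exp rsmooth_circle_exp smooth_on_const)
    then show ?thesis using V True by blast
  next
    case False
    let ?V = "{x. 3 / 16 < tube x}"
    have "smooth_on ?V (\<lambda>x. collar_metric x $ a $ b) \<longleftrightarrow>
        smooth_on ?V (\<lambda>x. if a = b then c * (1 + 2 * N) ^ (2 * (p + 1)) else 0)"
      by (rule smooth_on_cong[OF open_tube(2)]) (simp add: collar_metric_outer)
    moreover have "smooth_on ?V (\<lambda>x. if a = b then c * (1 + 2 * N) ^ (2 * (p + 1)) else 0)"
      by (cases "a = b") auto
    moreover have "x \<in> ?V" using False by simp
    ultimately show ?thesis using open_tube(2) by blast
  qed
qed

end

section \<open>A function of slope at most 1 on a collar, and polar coordinates\<close>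

context collar
begin

abbreviation "growth x \<equiv> log_growth N (tube x)"

lemma has_derivative_nc: "((\<lambda>x. nc x $ k) has_derivative (\<lambda>v. v $ k / L)) (at x)"
  unfolding nc_component using L_pos by (auto intro!: derivative_eq_intros bounded_linear.has_derivative[OF bounded_linear_vec_nth])

lemma dd_tube: "dd v tube x = (4 * (radius2 x - 1) * ((nc x $ i + 1) * v $ i + nc x $ j * v $ j)
    + 2 * (\<Sum>k\<in>- {i, j}. nc x $ k * v $ k)) / L"
proof -
  have r: "(radius2 has_derivative (\<lambda>v. (2 * (nc x $ i + 1) * v $ i + 2 * nc x $ j * v $ j) / L)) (at x)"
    unfolding radius2_def[abs_def]
    by (auto intro!: derivative_eq_intros has_derivative_nc simp: fun_eq_iff add_divide_distrib algebra_simps)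
  have S: "((\<lambda>x. \<Sum>k\<in>- {i, j}. (nc x $ k)\<^sup>2) has_derivative (\<lambda>v. \<Sum>k\<in>- {i, j}. 2 * nc x $ k * v $ k / L)) (at x)"
    by (auto intro!: derivative_eq_intros has_derivative_nc sum.cong simp: fun_eq_iff mult_ac)
  have "(tube has_derivative (\<lambda>v. 2 * (radius2 x - 1) * ((2 * (nc x $ i + 1) * v $ i + 2 * nc x $ j * v $ j) / L)
      + (\<Sum>k\<in>- {i, j}. 2 * nc x $ k * v $ k / L))) (at x)"
    unfolding tube_def[abs_def]
    by (rule has_derivative_eq_rhs[OF has_derivative_add[OF has_derivative_power[OF
          has_derivative_diff[OF r has_derivative_const]] S]]) (simp add: fun_eq_iff algebra_simps)
  from dd_eqI[OF this]
  have "dd v tube x = 2 * (radius2 x - 1) * ((2 * (nc x $ i + 1) * v $ i + 2 * nc x $ j * v $ j) / L)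
      + (\<Sum>k\<in>- {i, j}. 2 * nc x $ k * v $ k / L)" .
  moreover have "(\<Sum>k\<in>- {i, j}. 2 * nc x $ k * v $ k / L) = 2 * (\<Sum>k\<in>- {i, j}. nc x $ k * v $ k) / L"
    by (simp add: sum_distrib_left sum_divide_distrib mult.assoc)
  ultimately show ?thesis using L_pos by (simp add: field_simps)
qed

text \<open>\<open>tube\<close> is invariant under the rotation, so only the component of
  \<open>v\<close> orthogonal to the orbit counts. The 12 is \<open>32 * (1 / 4) * (3 / 2)\<close>,
  from \<open>q\<^sup>2 \<le> 1 / 4\<close> and \<open>s \<le> 3 / 2\<close>.\<close>

lemma tube_gradient:
  assumes "tube x \<le> 3 / 16"
  shows "(dd v tube x)\<^sup>2 \<le> 12 / L\<^sup>2 * ((norm v)\<^sup>2 - (angular x \<bullet> v)\<^sup>2 / radius2 x)"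
proof -
  define q r s V y a where "q = radius2 x - 1" and "r = (nc x $ i + 1) * v $ i + nc x $ j * v $ j"
    and "s = radius2 x" and "V = (\<Sum>k\<in>- {i, j}. (v $ k)\<^sup>2)"
    and "y = (\<Sum>k\<in>- {i, j}. nc x $ k * v $ k)" and "a = angular x \<bullet> v"
  have q: "\<bar>q\<bar> \<le> 1 / 2" using tube_small(1)[OF assms] by (simp add: q_def)
  then have s: "1 / 2 \<le> s" "s \<le> 3 / 2" unfolding q_def s_def by linarith+
  have V: "V \<ge> 0" by (simp add: V_def sum_nonneg)
  have "r\<^sup>2 + a\<^sup>2 = s * ((v $ i)\<^sup>2 + (v $ j)\<^sup>2)"
    unfolding r_def a_def angular_inner s_def radius2_def by (simp add: power2_eq_square algebra_simps)
  then have "(v $ i)\<^sup>2 + (v $ j)\<^sup>2 - a\<^sup>2 / s = r\<^sup>2 / s"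
    using s by (simp add: field_simps)
  then have nv: "(norm v)\<^sup>2 - a\<^sup>2 / s = r\<^sup>2 / s + V"
    unfolding norm_split V_def by linarith
  have "y\<^sup>2 \<le> (\<Sum>k\<in>- {i, j}. (nc x $ k)\<^sup>2) * V"
    unfolding y_def V_def by (rule Cauchy_Schwarz_ineq_sum)
  also have "\<dots> \<le> 1 / 4 * V" using tube_small(2)[OF assms] V by (intro mult_right_mono)
  finally have y: "y\<^sup>2 \<le> 1 / 4 * V" .
  have "q\<^sup>2 \<le> (1 / 2)\<^sup>2" using q by (intro abs_le_square_iff[THEN iffD1]) simp
  then have "q\<^sup>2 * r\<^sup>2 \<le> 1 / 4 * r\<^sup>2" by (intro mult_right_mono) (auto simp: power2_eq_square)
  moreover have "r\<^sup>2 \<le> 3 / 2 * (r\<^sup>2 / s)"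
    using s mult_right_mono[OF s(2), of "r\<^sup>2"] by (simp add: field_simps)
  ultimately have qr: "32 * (q\<^sup>2 * r\<^sup>2) \<le> 12 * (r\<^sup>2 / s)" by linarith
  have "(4 * q * r + 2 * y)\<^sup>2 \<le> 32 * (q\<^sup>2 * r\<^sup>2) + 8 * y\<^sup>2"
    using zero_le_power2[of "4 * q * r - 2 * y"] by (simp add: power2_eq_square algebra_simps)
  also have "\<dots> \<le> 12 * (r\<^sup>2 / s + V)" using qr y V by simp
  finally have "(4 * q * r + 2 * y)\<^sup>2 / L\<^sup>2 \<le> 12 * (r\<^sup>2 / s + V) / L\<^sup>2"
    by (rule divide_right_mono) simp
  then show ?thesis
    unfolding dd_tube unfolding q_def[symmetric] r_def[symmetric] y_def[symmetric] a_def[symmetric]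
    unfolding s_def[symmetric] nv by (simp add: power_divide)
qed

text \<open>Matches the upper bound for the distance from \<open>m\<close> up to a constant factor.
  The normalisation makes the slope at most 1: \<open>p * l'\<close> contributes
  \<open>p * growth_const * exp l\<close> and the gradient of \<open>tube\<close> contributes
  \<open>sqrt 12 / L\<close>, and \<open>sqrt 12 < 4\<close>.\<close>

definition height :: "real^'n \<Rightarrow> real" where
  "height x = sqrt c * L / (4 * real p * growth_const) * exp (real p * growth x)"

lemma smooth_height: "smooth_on UNIV height"
  unfolding height_def[abs_def]
  by (intro smooth_on_mult smooth_on_const smooth_exp_tube rsmooth_mult rsmooth_log_growth[OF N_ge] rsmooth_const) simp

lemma dd_height: "dd v height x = height x * real p * deriv (log_growth N) (tube x) * dd v tube x"
proof -
  define A where "A = sqrt c * L / (4 * real p * growth_const)"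
  have "((\<lambda>\<xi>. A * exp (real p * log_growth N \<xi>)) has_real_derivative
      A * (exp (real p * log_growth N (tube x)) * (real p * deriv (log_growth N) (tube x)))) (at (tube x))"
    by (auto intro!: derivative_eq_intros rsmooth_has_deriv(1)[OF rsmooth_log_growth[OF N_ge]])
  from dd_real_compose[OF this smooth_UNIV_differentiable[OF smooth_tube], of v]
  show ?thesis by (simp add: height_def[abs_def] A_def mult_ac)
qed

lemma height_gradient:
  assumes "tube x \<le> 3 / 16"
  shows "(dd v height x)\<^sup>2 \<le> riem_inner collar_metric x v v"
proof -
  define e w where "e = exp (growth x)" and "w = (norm v)\<^sup>2 - (angular x \<bullet> v)\<^sup>2 / radius2 x"
  have w: "0 \<le> w" using angular_cauchy[of x v] by (simp add: w_def)
  have ep: "exp (real p * growth x) = e ^ p" unfolding e_def by (rule exp_of_nat_mult)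
  have eP: "exp (base_exp (tube x)) = (e ^ p)\<^sup>2 * e\<^sup>2"
  proof -
    have "exp (base_exp (tube x)) = e ^ (2 * (p + 1))"
      unfolding e_def base_exp_def by (rule exp_of_nat_mult)
    also have "e ^ (2 * (p + 1)) = (e ^ (p + 1))\<^sup>2" by (subst mult.commute) (rule power_mult)
    also have "\<dots> = (e ^ p)\<^sup>2 * e\<^sup>2" by (simp add: power_mult_distrib mult.commute)
    finally show ?thesis .
  qed
  have C: "growth_const \<ge> 1" by (rule growth_const)
  have "(deriv (log_growth N) (tube x))\<^sup>2 \<le> (growth_const * e)\<^sup>2"
    using growth_const(2)[OF N_ge, of "tube x"] unfolding e_def[symmetric]
    by (intro abs_le_square_iff[THEN iffD1]) simp
  then have "(deriv (log_growth N) (tube x))\<^sup>2 * (dd v tube x)\<^sup>2 \<le> (growth_const * e)\<^sup>2 * (12 / L\<^sup>2 * w)"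
    unfolding w_def by (intro mult_mono tube_gradient[OF assms]) auto
  then have "(height x * real p)\<^sup>2 * ((deriv (log_growth N) (tube x))\<^sup>2 * (dd v tube x)\<^sup>2)
      \<le> (height x * real p)\<^sup>2 * ((growth_const * e)\<^sup>2 * (12 / L\<^sup>2 * w))"
    by (intro mult_left_mono) auto
  also have "\<dots> = 3 / 4 * (c * ((e ^ p)\<^sup>2 * e\<^sup>2) * w)"
    using C c_pos L_pos p_pos by (simp add: height_def ep power_mult_distrib power_divide field_simps)
  also have "\<dots> \<le> 1 * (c * ((e ^ p)\<^sup>2 * e\<^sup>2) * w)"
    using c_pos w by (intro mult_right_mono) auto
  also have "\<dots> \<le> riem_inner collar_metric x v v"
    using collar_metric_bounds(3)[of x v] unfolding eP w_def by simp
  finally show ?thesis by (simp add: dd_height power_mult_distrib mult_ac)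
qed

lemma deriv_growth_0:
  assumes "\<xi> < 1 / 16 \<or> 3 / 16 < \<xi>"
  shows "deriv (log_growth N) \<xi> = 0"
  using assms
proof
  assume "\<xi> < 1 / 16"
  have "((\<lambda>_. 0) has_real_derivative 0) (at \<xi>)" by simp
  then have "(log_growth N has_real_derivative 0) (at \<xi>)"
    by (rule has_field_derivative_transform_within_open[of _ _ _ "{..<1/16}"])
      (use \<open>\<xi> < 1 / 16\<close> log_growth_inner[OF N_ge] in auto)
  then show ?thesis by (rule DERIV_imp_deriv)
next
  assume "3 / 16 < \<xi>"
  have "((\<lambda>_. ln (1 + 2 * N)) has_real_derivative 0) (at \<xi>)" by simp
  then have "(log_growth N has_real_derivative 0) (at \<xi>)"
    by (rule has_field_derivative_transform_within_open[of _ _ _ "{3/16<..}"])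
      (use \<open>3 / 16 < \<xi>\<close> log_growth_outer[OF N_ge] in auto)
  then show ?thesis by (rule DERIV_imp_deriv)
qed

lemma height_gradient_0: "tube x < 1 / 16 \<or> 3 / 16 < tube x \<Longrightarrow> dd v height x = 0"
  by (simp add: dd_height deriv_growth_0)

text \<open>Polar coordinates around the axis of rotation; the angle is scaled by \<open>\<kappa>\<close> so that
  at a given point the metric becomes a multiple of the identity.\<close>

definition polar :: "real \<Rightarrow> real^'n \<Rightarrow> real^'n" where
  "polar \<kappa> z = (\<chi> k. m $ k + L * (if k = i then z $ i * cos (\<kappa> * z $ j) - 1
      else if k = j then z $ i * sin (\<kappa> * z $ j) else z $ k))"

lemma nc_polar: "nc (polar \<kappa> z) $ k = (if k = i then z $ i * cos (\<kappa> * z $ j) - 1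
      else if k = j then z $ i * sin (\<kappa> * z $ j) else z $ k)"
  using L_pos by (simp add: nc_component polar_def)

lemma radius2_polar: "radius2 (polar \<kappa> z) = (z $ i)\<^sup>2"
proof -
  have "radius2 (polar \<kappa> z) = (z $ i)\<^sup>2 * (cos (\<kappa> * z $ j))\<^sup>2 + (z $ i)\<^sup>2 * (sin (\<kappa> * z $ j))\<^sup>2"
    using ij by (simp add: radius2_def nc_polar power_mult_distrib)
  then show ?thesis by (simp add: distrib_left[symmetric])
qed

definition polar_tube :: "real^'n \<Rightarrow> real" where
  "polar_tube z = ((z $ i)\<^sup>2 - 1)\<^sup>2 + (\<Sum>k\<in>- {i, j}. (z $ k)\<^sup>2)"

lemma tube_polar: "tube (polar \<kappa> z) = polar_tube z"
  by (simp add: tube_def polar_tube_def radius2_polar nc_polar)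

lemma smooth_polar: "smooth_field (polar \<kappa>)"
  unfolding smooth_field_def
proof
  fix k
  have s: "smooth_on UNIV (\<lambda>z::real^'n. \<kappa> * z $ j)" by (intro smooth_on_mult) auto
  have "smooth_on UNIV (\<lambda>z::real^'n. cos (\<kappa> * z $ j))" "smooth_on UNIV (\<lambda>z::real^'n. sin (\<kappa> * z $ j))"
    by (rule smooth_on_compose[of UNIV UNIV, OF _ _ s]; simp)+
  then show "smooth_on UNIV (\<lambda>z. polar \<kappa> z $ k)"
    unfolding polar_def vec_lambda_beta
    by (cases "k = i"; cases "k = j") (auto intro!: smooth_on_add smooth_on_mult smooth_on_diff)
qed

lemma pushforward_polar:
  "pushforward (polar \<kappa>) a z $ k = L * (if k = i then a $ i * cos (\<kappa> * z $ j) - z $ i * (\<kappa> * a $ j) * sin (\<kappa> * z $ j)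
      else if k = j then a $ i * sin (\<kappa> * z $ j) + z $ i * (\<kappa> * a $ j) * cos (\<kappa> * z $ j) else a $ k)"
proof -
  have n: "((\<lambda>z. z $ k) has_derivative (\<lambda>v. v $ k)) (at z)" for k
    by (rule bounded_linear.has_derivative[OF bounded_linear_vec_nth]) simp
  have "((\<lambda>z. polar \<kappa> z $ k) has_derivative (\<lambda>a. L * (if k = i then a $ i * cos (\<kappa> * z $ j) - z $ i * (\<kappa> * a $ j) * sin (\<kappa> * z $ j)
      else if k = j then a $ i * sin (\<kappa> * z $ j) + z $ i * (\<kappa> * a $ j) * cos (\<kappa> * z $ j) else a $ k))) (at z)"
    unfolding polar_def vec_lambda_beta
    by (cases "k = i"; cases "k = j") (auto intro!: derivative_eq_intros n simp: fun_eq_iff algebra_simps)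
  from dd_eqI[OF this] show ?thesis by (simp add: pushforward_def)
qed

text \<open>Rotations are isometries and their orbits are orthogonal to the other coordinate lines,
  so the metric is diagonal with coefficients that do not depend on the angle \<open>z $ j\<close>.
  This is the form that \<open>sectional_curvature_bound\<close> expects.\<close>

lemma pull_polar:
  assumes "z $ i \<noteq> 0"
  shows "riem_inner collar_metric (polar \<kappa> z) (pushforward (polar \<kappa>) a z) (pushforward (polar \<kappa>) b z) =
    c * L\<^sup>2 * exp (base_exp (polar_tube z)) * (a \<bullet> b - a $ j * b $ j)
    + c * L\<^sup>2 * \<kappa>\<^sup>2 * (z $ i)\<^sup>2 * exp (circle_exp (polar_tube z)) * (a $ j * b $ j)"
proof -
  let ?J = "\<lambda>a. pushforward (polar \<kappa>) a z"
  define s k where "s = sin (\<kappa> * z $ j)" and "k = cos (\<kappa> * z $ j)"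
  have sk: "s * s + k * k = 1" using sin_cos_squared_add[of "\<kappa> * z $ j"] by (simp add: s_def k_def power2_eq_square)
  have ang: "angular (polar \<kappa> z) \<bullet> ?J a = L * \<kappa> * (z $ i)\<^sup>2 * a $ j" for a
  proof -
    have "angular (polar \<kappa> z) \<bullet> ?J a = L * \<kappa> * (z $ i)\<^sup>2 * a $ j * (s * s + k * k)"
      unfolding angular_inner nc_polar pushforward_polar s_def[symmetric] k_def[symmetric] using ij by (simp add: power2_eq_square algebra_simps)
    then show ?thesis by (simp add: sk)
  qed
  have inn: "?J a \<bullet> ?J b = L\<^sup>2 * (a \<bullet> b - a $ j * b $ j + (z $ i)\<^sup>2 * \<kappa>\<^sup>2 * (a $ j * b $ j))"
  proof -
    have "?J a \<bullet> ?J b = L\<^sup>2 * ((a $ i * b $ i + (z $ i)\<^sup>2 * \<kappa>\<^sup>2 * (a $ j * b $ j)) * (s * s + k * k)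
        + (\<Sum>k\<in>- {i, j}. a $ k * b $ k))"
      unfolding inner_split[of "?J a"] pushforward_polar s_def[symmetric] k_def[symmetric]
      using ij by (simp add: power2_eq_square algebra_simps sum_distrib_left)
    then show ?thesis unfolding sk by (simp add: inner_split[of a b] algebra_simps)
  qed
  show ?thesis
    unfolding collar_metric_form tube_polar radius2_polar ang inn using assms
    by (simp add: power2_eq_square field_simps)
qed

lemma dd_polar_tube:
  "dd a polar_tube z = 4 * z $ i * ((z $ i)\<^sup>2 - 1) * a $ i + 2 * (\<Sum>k\<in>- {i, j}. z $ k * a $ k)"
  "dd b (dd a polar_tube) z = (12 * (z $ i)\<^sup>2 - 4) * a $ i * b $ i + 2 * (\<Sum>k\<in>- {i, j}. a $ k * b $ k)"
proof -
  have n: "((\<lambda>z. z $ k) has_derivative (\<lambda>v. v $ k)) (at z)" for k and z :: "real^'n"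
    by (rule bounded_linear.has_derivative[OF bounded_linear_vec_nth]) simp
  have "(polar_tube has_derivative (\<lambda>a. 4 * z $ i * ((z $ i)\<^sup>2 - 1) * a $ i + 2 * (\<Sum>k\<in>- {i, j}. z $ k * a $ k))) (at z)" for z
    unfolding polar_tube_def[abs_def]
    by (auto intro!: derivative_eq_intros n simp: fun_eq_iff sum_distrib_left algebra_simps)
  from dd_eqI[OF this] show 1: "dd a polar_tube z = 4 * z $ i * ((z $ i)\<^sup>2 - 1) * a $ i + 2 * (\<Sum>k\<in>- {i, j}. z $ k * a $ k)" for a z .
  have "((\<lambda>z. 4 * z $ i * ((z $ i)\<^sup>2 - 1) * a $ i + 2 * (\<Sum>k\<in>- {i, j}. z $ k * a $ k)) has_derivative
     (\<lambda>b. (12 * (z $ i)\<^sup>2 - 4) * a $ i * b $ i + 2 * (\<Sum>k\<in>- {i, j}. a $ k * b $ k))) (at z)"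
    by (auto intro!: derivative_eq_intros n simp: fun_eq_iff sum_distrib_left algebra_simps power2_eq_square)
  moreover have "dd a polar_tube = (\<lambda>z. 4 * z $ i * ((z $ i)\<^sup>2 - 1) * a $ i + 2 * (\<Sum>k\<in>- {i, j}. z $ k * a $ k))"
    using 1 by blast
  ultimately show "dd b (dd a polar_tube) z = (12 * (z $ i)\<^sup>2 - 4) * a $ i * b $ i + 2 * (\<Sum>k\<in>- {i, j}. a $ k * b $ k)"
    by (simp only: dd_eqI)
qed

end

text \<open>Relative to the value of \<open>A * exp u\<close>, its derivatives are \<open>u'\<close>
  and \<open>u'' + u' * u'\<close>; bounds \<open>a\<close> and \<open>a\<^sup>2\<close> on those of
  the exponent therefore suffice, at the price of doubling \<open>a\<close>.\<close>

lemma exp_derivative_bounds: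
  assumes V: "open V" "z \<in> V" and u: "smooth_on V u" and F: "F = (\<lambda>z. A * exp (u z))" and "F z = \<mu>" "\<mu> > 0" "a \<ge> 0"
    and u1: "\<And>c. \<bar>dd c u z\<bar> \<le> a * norm c" and u2: "\<And>c d. \<bar>dd d (dd c u) z\<bar> \<le> a\<^sup>2 * norm c * norm d"
  shows "smooth_on V F" "\<bar>dd c F z\<bar> \<le> \<mu> * (2 * a) * norm c"
    "\<bar>dd d (dd c F) z\<bar> \<le> \<mu> * (2 * a)\<^sup>2 * norm c * norm d"
proof -
  show sF: "smooth_on V F"
    unfolding F using smooth_on_compose[OF V(1) rsmooth_exp[of UNIV] u] by (intro smooth_on_mult V(1)) auto
  have D: "dd c F y = F y * dd c u y" if "y \<in> V" for y c
  proof -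
    have "((\<lambda>t. A * exp t) has_real_derivative A * exp (u y)) (at (u y))"
      by (auto intro!: derivative_eq_intros)
    from dd_real_compose[OF this smooth_on_differentiable[OF u that]] show ?thesis by (simp add: F)
  qed
  have D2: "dd d (dd c F) z = F z * dd d (dd c u) z + F z * dd d u z * dd c u z"
  proof -
    have "dd d (dd c F) z = dd d (\<lambda>y. F y * dd c u y) z"
      by (rule dd_cong_open[OF V]) (rule D)
    then show ?thesis
      using dd_mult[OF smooth_on_differentiable[OF sF V(2)] smooth_on_differentiable[OF smooth_on_dd[OF V(1) u] V(2)], of d c]
      by (simp add: D[OF V(2)])
  qed
  have "\<bar>dd c F z\<bar> \<le> \<mu> * (a * norm c)"
    unfolding D[OF V(2)] \<open>F z = \<mu>\<close> abs_mult using u1[of c] \<open>\<mu> > 0\<close> by simp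
  also have "\<dots> \<le> \<mu> * (2 * a * norm c)"
    using \<open>\<mu> > 0\<close> \<open>a \<ge> 0\<close> by (intro mult_left_mono mult_right_mono) auto
  finally show "\<bar>dd c F z\<bar> \<le> \<mu> * (2 * a) * norm c" by simp
  have "\<bar>dd d u z * dd c u z\<bar> \<le> (a * norm d) * (a * norm c)"
    unfolding abs_mult using u1 \<open>a \<ge> 0\<close> by (intro mult_mono) auto
  then have "\<bar>dd d (dd c u) z + dd d u z * dd c u z\<bar> \<le> 2 * (a\<^sup>2 * norm c * norm d)"
    using u2[of d c] by (simp add: power2_eq_square mult_ac)
  also have "\<dots> \<le> (2 * a)\<^sup>2 * norm c * norm d" using \<open>a \<ge> 0\<close> by (simp add: power2_eq_square)
  finally have "\<mu> * \<bar>dd d (dd c u) z + dd d u z * dd c u z\<bar> \<le> \<mu> * ((2 * a)\<^sup>2 * norm c * norm d)"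
    using \<open>\<mu> > 0\<close> by (intro mult_left_mono) auto
  moreover have "\<bar>dd d (dd c F) z\<bar> = \<mu> * \<bar>dd d (dd c u) z + dd d u z * dd c u z\<bar>"
    unfolding D2 \<open>F z = \<mu>\<close> using \<open>\<mu> > 0\<close> by (simp add: abs_mult distrib_left[symmetric] mult.assoc)
  ultimately show "\<bar>dd d (dd c F) z\<bar> \<le> \<mu> * (2 * a)\<^sup>2 * norm c * norm d" by (simp add: mult.assoc)
qed

section \<open>The curvature of a collar\<close>

context collar
begin

text \<open>Depends on \<open>p\<close> alone and not on \<open>c\<close>, \<open>L\<close> or
  \<open>N\<close>, so that one curvature constant serves all collars.\<close>

definition exponent_const :: real where
  "exponent_const = (2 + 8 * real p) * growth_const\<^sup>2"

lemma exponent_const_ge: "exponent_const \<ge> 2"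
proof -
  have "1 \<le> growth_const\<^sup>2" using growth_const(1) by (rule one_le_power)
  then have "2 * 1 \<le> (2 + 8 * real p) * growth_const\<^sup>2" by (intro mult_mono) auto
  then show ?thesis by (simp add: exponent_const_def)
qed

text \<open>Because of \<open>0 \<le> l / M \<le> 1\<close> and \<open>M \<ge> 1\<close> the
  quadratic term of \<open>circle_exp\<close> does no harm for large \<open>M\<close>. The 8 arises
  from its second derivative: \<open>4 * p\<close> times two terms of size
  \<open>growth_const\<^sup>2 * e\<^sup>2\<close>.\<close>

lemma exponent_deriv_bounds:
  fixes \<xi> :: real
  defines "e \<equiv> exp (log_growth N \<xi>)"
  shows "\<bar>deriv base_exp \<xi>\<bar> \<le> exponent_const * e" "\<bar>deriv (deriv base_exp) \<xi>\<bar> \<le> exponent_const * e\<^sup>2"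
    "\<bar>deriv circle_exp \<xi>\<bar> \<le> exponent_const * e" "\<bar>deriv (deriv circle_exp) \<xi>\<bar> \<le> exponent_const * e\<^sup>2"
proof -
  define l l1 l2 M C where "l = log_growth N" and "l1 = deriv (log_growth N)" and "l2 = deriv (deriv (log_growth N))"
    and "M = ln (1 + 2 * N)" and "C = growth_const"
  note rs = rsmooth_log_growth[OF N_ge]
  have d: "(l has_real_derivative l1 \<xi>) (at \<xi>)" "(l1 has_real_derivative l2 \<xi>) (at \<xi>)" for \<xi>
    unfolding l_def l1_def l2_def using rsmooth_has_deriv(1)[OF rs] rsmooth_has_deriv(1)[OF rsmooth_has_deriv(2)[OF rs]] by auto
  have M: "1 \<le> M" unfolding M_def by (rule ln_ge_1)
  have C: "1 \<le> C" unfolding C_def by (rule growth_const)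
  have CC: "C \<le> C\<^sup>2" using C by (simp add: power2_eq_square)
  have e: "1 \<le> e" unfolding e_def using growth_nonneg[of \<xi>] by simp
  have b: "\<bar>l1 \<xi>\<bar> \<le> C * e" "\<bar>l2 \<xi>\<bar> \<le> C * e\<^sup>2"
    unfolding l1_def l2_def C_def e_def using growth_const(2,3)[OF N_ge] by auto
  have CCe: "C * e \<le> C\<^sup>2 * e" "C * e\<^sup>2 \<le> C\<^sup>2 * e\<^sup>2" using CC e by (intro mult_right_mono; simp)+
  have b2: "(l1 \<xi>)\<^sup>2 \<le> C\<^sup>2 * e\<^sup>2"
    using b(1) abs_le_square_iff[of "l1 \<xi>" "C * e"] C e by (simp add: power_mult_distrib)
  have lM: "0 \<le> l \<xi> / M" "l \<xi> / M \<le> 1"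
    using growth_nonneg[of \<xi>] growth_le[of \<xi>] M by (auto simp: l_def M_def)
  have K: "exponent_const = 2 * C\<^sup>2 + 8 * (real p * C\<^sup>2)" by (simp add: exponent_const_def C_def algebra_simps)
  have K': "exponent_const * y = (2 + 8 * real p) * (C\<^sup>2 * y)" for y by (simp add: exponent_const_def C_def)
  have pp: "real (2 * (p + 1)) \<le> 2 + 8 * real p" by simp
  have aux: "\<bar>2 * q + 4 * r\<bar> \<le> 2 * Q + 8 * T" if "\<bar>q\<bar> \<le> Q" "\<bar>r\<bar> \<le> 2 * T" for q r Q T :: real
    using that by linarith
  have aux': "\<bar>2 * q + 4 * r\<bar> \<le> 2 * Q + 8 * T" if "\<bar>q\<bar> \<le> Q" "\<bar>r\<bar> \<le> T" "0 \<le> T" for q r Q T :: real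
    using that by linarith
  have B1: "deriv base_exp = (\<lambda>\<xi>. 2 * (p + 1) * l1 \<xi>)"
  proof
    fix \<xi> show "deriv base_exp \<xi> = 2 * (p + 1) * l1 \<xi>"
      unfolding base_exp_def[abs_def] l_def[symmetric]
      by (rule DERIV_imp_deriv) (auto intro!: derivative_eq_intros d)
  qed
  have B2: "deriv (deriv base_exp) \<xi> = 2 * (p + 1) * l2 \<xi>"
    unfolding B1 by (rule DERIV_imp_deriv) (auto intro!: derivative_eq_intros d)
  have R1: "deriv circle_exp = (\<lambda>\<xi>. 2 * l1 \<xi> + 4 * p * (l \<xi> / M) * l1 \<xi>)"
  proof
    fix \<xi> show "deriv circle_exp \<xi> = 2 * l1 \<xi> + 4 * p * (l \<xi> / M) * l1 \<xi>"
      unfolding circle_exp_def[abs_def] l_def[symmetric] M_def[symmetric] 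
      by (rule DERIV_imp_deriv) (use M in \<open>auto intro!: derivative_eq_intros d simp: field_simps\<close>)
  qed
  have R2: "deriv (deriv circle_exp) \<xi> = 2 * l2 \<xi> + 4 * p * ((l \<xi> / M) * l2 \<xi> + (l1 \<xi>)\<^sup>2 / M)"
    unfolding R1 by (rule DERIV_imp_deriv)
      (use M in \<open>auto intro!: derivative_eq_intros d simp: field_simps power2_eq_square\<close>)
  have "\<bar>2 * (p + 1) * l1 \<xi>\<bar> \<le> 2 * (p + 1) * (C\<^sup>2 * e)"
    unfolding abs_mult using b(1) CCe(1) by simp
  then show "\<bar>deriv base_exp \<xi>\<bar> \<le> exponent_const * e"
    unfolding B1 K' using mult_right_mono[OF pp, of "C\<^sup>2 * e"] e by simp
  have "\<bar>2 * (p + 1) * l2 \<xi>\<bar> \<le> 2 * (p + 1) * (C\<^sup>2 * e\<^sup>2)"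
    unfolding abs_mult using b(2) CCe(2) by simp
  then show "\<bar>deriv (deriv base_exp) \<xi>\<bar> \<le> exponent_const * e\<^sup>2"
    unfolding B2 K' using mult_right_mono[OF pp, of "C\<^sup>2 * e\<^sup>2"] by simp
  have "\<bar>(l \<xi> / M) * l1 \<xi>\<bar> \<le> 1 * (C\<^sup>2 * e)"
    unfolding abs_mult[of "l \<xi> / M"] using lM b(1) CCe(1) by (intro mult_mono) auto
  then have "real p * \<bar>(l \<xi> / M) * l1 \<xi>\<bar> \<le> real p * (C\<^sup>2 * e)" by (intro mult_left_mono) auto
  then have "\<bar>real p * ((l \<xi> / M) * l1 \<xi>)\<bar> \<le> real p * (C\<^sup>2 * e)" by (simp only: abs_mult[of "real p"] abs_of_nat)
  moreover have "0 \<le> real p * (C\<^sup>2 * e)" using e by simp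
  ultimately have "\<bar>2 * l1 \<xi> + 4 * (real p * ((l \<xi> / M) * l1 \<xi>))\<bar> \<le> 2 * (C\<^sup>2 * e) + 8 * (real p * (C\<^sup>2 * e))"
    by (intro aux' order_trans[OF b(1) CCe(1)])
  then show "\<bar>deriv circle_exp \<xi>\<bar> \<le> exponent_const * e"
    unfolding R1 K by (simp add: algebra_simps)
  have "\<bar>(l \<xi> / M) * l2 \<xi>\<bar> \<le> 1 * (C\<^sup>2 * e\<^sup>2)"
    unfolding abs_mult[of "l \<xi> / M"] using lM b(2) CCe(2) by (intro mult_mono) auto
  moreover have "(l1 \<xi>)\<^sup>2 / M \<le> C\<^sup>2 * e\<^sup>2 / 1" using b2 M by (intro frac_le) auto
  moreover have "0 \<le> (l1 \<xi>)\<^sup>2 / M" using M by simp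
  ultimately have "\<bar>(l \<xi> / M) * l2 \<xi> + (l1 \<xi>)\<^sup>2 / M\<bar> \<le> 2 * (C\<^sup>2 * e\<^sup>2)" by linarith
  then have "real p * \<bar>(l \<xi> / M) * l2 \<xi> + (l1 \<xi>)\<^sup>2 / M\<bar> \<le> real p * (2 * (C\<^sup>2 * e\<^sup>2))" by (intro mult_left_mono) auto
  then have "\<bar>real p * ((l \<xi> / M) * l2 \<xi> + (l1 \<xi>)\<^sup>2 / M)\<bar> \<le> 2 * (real p * (C\<^sup>2 * e\<^sup>2))"
    by (simp only: abs_mult[of "real p"] abs_of_nat mult.left_commute)
  then have "\<bar>2 * l2 \<xi> + 4 * (real p * ((l \<xi> / M) * l2 \<xi> + (l1 \<xi>)\<^sup>2 / M))\<bar> \<le> 2 * (C\<^sup>2 * e\<^sup>2) + 8 * (real p * (C\<^sup>2 * e\<^sup>2))"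
    by (intro aux order_trans[OF b(2) CCe(2)])
  then show "\<bar>deriv (deriv circle_exp) \<xi>\<bar> \<le> exponent_const * e\<^sup>2"
    unfolding R2 K by (simp add: algebra_simps)
qed

lemma smooth_polar_tube: "smooth_on UNIV polar_tube"
  unfolding polar_tube_def[abs_def]
  by (intro smooth_on_add smooth_on_power smooth_on_diff smooth_on_sum) auto

text \<open>In the tube \<open>(z $ i)\<^sup>2\<close> differs from 1 by at most 1/2. Then 5 = 4 + 1
  and 16 = 14 + 2, with the first summand from the radial coordinate \<open>i\<close> and the second
  from the coordinates other than \<open>i\<close> and \<open>j\<close>.\<close>

lemma polar_tube_bounds:
  assumes "polar_tube z \<le> 3 / 16"
  shows "1 / 2 \<le> (z $ i)\<^sup>2" "\<bar>dd a polar_tube z\<bar> \<le> 5 * norm a"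
    "\<bar>dd b (dd a polar_tube) z\<bar> \<le> 16 * norm a * norm b"
proof -
  define q Y where "q = (z $ i)\<^sup>2 - 1" and "Y = (\<Sum>k\<in>- {i, j}. (z $ k)\<^sup>2)"
  have qY: "q\<^sup>2 + Y \<le> 3 / 16" "0 \<le> Y" "0 \<le> q\<^sup>2" using assms by (auto simp: polar_tube_def q_def Y_def sum_nonneg)
  then have Y: "Y \<le> 1 / 4" and "q\<^sup>2 \<le> 1 / 4" by linarith+
  then have "q\<^sup>2 \<le> (1 / 2)\<^sup>2" by (simp add: power_divide)
  then have q: "\<bar>q\<bar> \<le> 1 / 2" by (subst (asm) abs_le_square_iff[symmetric]) simp
  then have z: "1 / 2 \<le> (z $ i)\<^sup>2" "(z $ i)\<^sup>2 \<le> 3 / 2" unfolding q_def by linarith+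
  show "1 / 2 \<le> (z $ i)\<^sup>2" by (rule z)
  have z2: "\<bar>z $ i\<bar> \<le> 2"
  proof -
    have "(z $ i)\<^sup>2 \<le> 2\<^sup>2" using z by simp
    then show ?thesis by (subst (asm) abs_le_square_iff[symmetric]) simp
  qed
  have cs: "\<bar>\<Sum>k\<in>- {i, j}. w $ k * a $ k\<bar> \<le> sqrt (\<Sum>k\<in>- {i, j}. (w $ k)\<^sup>2) * norm a" for w a
  proof -
    have "(\<Sum>k\<in>- {i, j}. w $ k * a $ k)\<^sup>2 \<le> (\<Sum>k\<in>- {i, j}. (w $ k)\<^sup>2) * (\<Sum>k\<in>- {i, j}. (a $ k)\<^sup>2)"
      by (rule Cauchy_Schwarz_ineq_sum)
    also have "\<dots> \<le> (\<Sum>k\<in>- {i, j}. (w $ k)\<^sup>2) * (norm a)\<^sup>2"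
      unfolding norm_split by (intro mult_left_mono) (auto intro: sum_nonneg)
    also have "\<dots> = (sqrt (\<Sum>k\<in>- {i, j}. (w $ k)\<^sup>2) * norm a)\<^sup>2"
      by (simp add: power_mult_distrib sum_nonneg)
    finally show ?thesis
      by (subst (asm) abs_le_square_iff[symmetric]) (simp add: sum_nonneg)
  qed
  have "sqrt Y \<le> sqrt ((1 / 2)\<^sup>2)" using Y by (intro real_sqrt_le_mono) (simp add: power2_eq_square)
  then have "sqrt Y \<le> 1 / 2" by simp
  then have t1: "\<bar>\<Sum>k\<in>- {i, j}. z $ k * a $ k\<bar> \<le> 1 / 2 * norm a"
    using cs[of z a] mult_right_mono[of "sqrt Y" "1 / 2" "norm a"] unfolding Y_def by simp
  have "\<bar>4 * z $ i * q * a $ i\<bar> \<le> 4 * 2 * (1 / 2) * norm a"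
    unfolding abs_mult using z2 q component_le_norm_cart[of a i] by (intro mult_mono) auto
  then show "\<bar>dd a polar_tube z\<bar> \<le> 5 * norm a"
    unfolding dd_polar_tube q_def[symmetric] using t1 by linarith
  have "sqrt (\<Sum>k\<in>- {i, j}. (a $ k)\<^sup>2) \<le> sqrt ((norm a)\<^sup>2)"
    unfolding norm_split by (intro real_sqrt_le_mono) auto
  then have "\<bar>\<Sum>k\<in>- {i, j}. a $ k * b $ k\<bar> \<le> norm a * norm b"
    using cs[of a b] mult_right_mono[of "sqrt (\<Sum>k\<in>- {i, j}. (a $ k)\<^sup>2)" "norm a" "norm b"] by simp
  moreover have "\<bar>(12 * (z $ i)\<^sup>2 - 4) * a $ i * b $ i\<bar> \<le> 14 * norm a * norm b"
    unfolding abs_mult using z component_le_norm_cart[of a i] component_le_norm_cart[of b i]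
    by (intro mult_mono) auto
  ultimately show "\<bar>dd b (dd a polar_tube) z\<bar> \<le> 16 * norm a * norm b"
    unfolding dd_polar_tube by linarith
qed

lemma dd_profile:
  assumes f: "rsmooth UNIV f"
  shows "dd a (\<lambda>z. f (polar_tube z)) = (\<lambda>z. deriv f (polar_tube z) * dd a polar_tube z)"
    "dd b (dd a (\<lambda>z. f (polar_tube z))) z =
      deriv (deriv f) (polar_tube z) * dd b polar_tube z * dd a polar_tube z
      + deriv f (polar_tube z) * dd b (dd a polar_tube) z"
proof -
  note dp = smooth_UNIV_differentiable[OF smooth_polar_tube]
  show 1: "dd a (\<lambda>z. f (polar_tube z)) = (\<lambda>z. deriv f (polar_tube z) * dd a polar_tube z)"
    using dd_real_compose[OF rsmooth_has_deriv(1)[OF f] dp] by blast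
  have "smooth_on UNIV (\<lambda>z. deriv f (polar_tube z))"
    by (rule smooth_on_compose[OF _ rsmooth_has_deriv(2)[OF f] smooth_polar_tube]) auto
  moreover have "smooth_on UNIV (dd a polar_tube)" by (rule smooth_on_dd[OF _ smooth_polar_tube]) simp
  ultimately show "dd b (dd a (\<lambda>z. f (polar_tube z))) z =
      deriv (deriv f) (polar_tube z) * dd b polar_tube z * dd a polar_tube z
      + deriv f (polar_tube z) * dd b (dd a polar_tube) z"
    unfolding 1
    by (simp add: dd_mult smooth_UNIV_differentiable
        dd_real_compose[OF rsmooth_has_deriv(1)[OF rsmooth_has_deriv(2)[OF f]] dp])
qed

lemma profile_bounds:
  assumes f: "rsmooth UNIV f" and z: "polar_tube z \<le> 3 / 16"
    and e: "1 \<le> e" and B: "1 \<le> B" and f1: "\<bar>deriv f (polar_tube z)\<bar> \<le> B * e" and f2: "\<bar>deriv (deriv f) (polar_tube z)\<bar> \<le> B * e\<^sup>2"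
  shows "\<bar>dd a (\<lambda>z. f (polar_tube z)) z\<bar> \<le> 5 * B * e * norm a"
    "\<bar>dd b (dd a (\<lambda>z. f (polar_tube z))) z\<bar> \<le> 41 * B * e\<^sup>2 * norm a * norm b"
proof -
  note pb = polar_tube_bounds[OF z]
  have "\<bar>dd a (\<lambda>z. f (polar_tube z)) z\<bar> \<le> (B * e) * (5 * norm a)"
    unfolding dd_profile(1)[OF f] abs_mult using f1 pb(2) B e by (intro mult_mono) auto
  then show "\<bar>dd a (\<lambda>z. f (polar_tube z)) z\<bar> \<le> 5 * B * e * norm a" by (simp add: mult_ac)
  have 1: "\<bar>deriv (deriv f) (polar_tube z) * dd b polar_tube z * dd a polar_tube z\<bar> \<le> (B * e\<^sup>2) * (5 * norm b) * (5 * norm a)"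
    unfolding abs_mult using f2 pb(2)[of a] pb(2)[of b] B e by (intro mult_mono) auto
  have "\<bar>deriv f (polar_tube z) * dd b (dd a polar_tube) z\<bar> \<le> (B * e) * (16 * norm a * norm b)"
    unfolding abs_mult using f1 pb(3) B e by (intro mult_mono) auto
  also have "\<dots> \<le> (B * e\<^sup>2) * (16 * norm a * norm b)"
    using B e self_le_power[of e 2] by (intro mult_right_mono mult_left_mono) auto
  finally have "\<bar>deriv f (polar_tube z) * dd b (dd a polar_tube) z\<bar> \<le> 16 * (B * e\<^sup>2 * (norm a * norm b))"
    by (simp add: mult_ac)
  moreover have "(B * e\<^sup>2) * (5 * norm b) * (5 * norm a) = 25 * (B * e\<^sup>2 * (norm a * norm b))" by simp
  ultimately have "\<bar>dd b (dd a (\<lambda>z. f (polar_tube z))) z\<bar> \<le> 41 * (B * e\<^sup>2 * (norm a * norm b))"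
    unfolding dd_profile(2)[OF f] using 1 by linarith
  then show "\<bar>dd b (dd a (\<lambda>z. f (polar_tube z))) z\<bar> \<le> 41 * B * e\<^sup>2 * norm a * norm b"
    by (simp add: mult_ac)
qed

lemma radius2_pos: "tube x \<le> 3 / 16 \<Longrightarrow> 0 < radius2 x"
  using tube_small(1)[of x] by linarith

lemma polar_surj:
  assumes "tube x \<le> 3 / 16" "\<kappa> > 0"
  obtains z where "polar \<kappa> z = x" "z $ i = sqrt (radius2 x)"
proof -
  define s where "s = sqrt (radius2 x)"
  have s: "s > 0" "s\<^sup>2 = radius2 x" using radius2_pos[OF assms(1)] by (auto simp: s_def)
  then have "(nc x $ i + 1)\<^sup>2 + (nc x $ j)\<^sup>2 = s\<^sup>2" by (simp add: radius2_def)
  then have "((nc x $ i + 1) / s)\<^sup>2 + (nc x $ j / s)\<^sup>2 = 1"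
    using s(1) by (simp add: power_divide add_divide_distrib[symmetric])
  then obtain t where t: "(nc x $ i + 1) / s = cos t" "nc x $ j / s = sin t"
    using sincos_total_2pi by metis
  define z where "z = (\<chi> k. if k = i then s else if k = j then t / \<kappa> else nc x $ k)"
  have "polar \<kappa> z $ k = x $ k" for k
    using t s(1) ij assms(2) L_pos unfolding polar_def z_def
    by (auto simp: field_simps nc_component)
  then show thesis using that[of z] by (simp add: vec_eq_iff z_def s_def)
qed

text \<open>In suitably scaled polar coordinates both coefficients of the metric are exponentials
  whose exponents have derivatives of order \<open>exp l\<close>. Agreement with the collar metric
  is required only near \<open>x\<close>, as this is what the glued metric satisfies.\<close>

lemma curvature_bound:
  assumes g: "riemannian_metric g" and V: "open V" "x \<in> V" "\<And>y. y \<in> V \<Longrightarrow> g y = collar_metric y"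
    and x: "tube x \<le> 3 / 16"
  shows "\<bar>sectional_curvature g x u v\<bar> \<le> 47 * (100 * exponent_const)\<^sup>2 / (sqrt c * L * exp (p * growth x))\<^sup>2"
proof -
  define P R e s where "P = base_exp (tube x)" and "R = circle_exp (tube x)" and "e = exp (growth x)"
    and "s = sqrt (radius2 x)"
  have s: "s > 0" using radius2_pos[OF x] by (simp add: s_def)
  \<comment> \<open>Chosen so that \<open>\<kappa>\<^sup>2 * s\<^sup>2 * exp R = exp P\<close>: at
    the given point the coefficient of the circle then equals the other one.\<close>
  define \<kappa> where "\<kappa> = exp ((P - R) / 2) / s"
  have \<kappa>: "\<kappa> > 0" using s by (simp add: \<kappa>_def)
  obtain z where z: "polar \<kappa> z = x" "z $ i = s" using polar_surj[OF x \<kappa>] by (metis s_def)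
  have tz: "polar_tube z = tube x" using tube_polar[of \<kappa> z] z(1) by simp
  interpret coordinate_change g "polar \<kappa>"
    by unfold_locales (rule g, rule smooth_polar)
  define W where "W = {z. 0 < z $ i} \<inter> polar \<kappa> -` V"
  have cont: "continuous_on UNIV (polar \<kappa>)"
    using has_derivative_continuous[OF has_derivative_pushforward[OF smooth_polar]]
    by (simp add: continuous_on_eq_continuous_within)
  have W: "open W" "z \<in> W"
    using open_vimage[OF V(1) cont] z s V(2)
    by (auto simp: W_def intro!: open_Int open_Collect_less continuous_intros)
  define \<mu> where "\<mu> = c * L\<^sup>2 * exp P"
  have \<mu>: "\<mu> > 0" using c_pos L_pos by (simp add: \<mu>_def)
  \<comment> \<open>The factor \<open>(z $ i)\<^sup>2\<close> of the circle coefficient is moved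
    into the exponent as \<open>2 * ln (z $ i)\<close>, which is legitimate on
    \<open>W\<close>.\<close>
  define uE uK where "uE z = base_exp (polar_tube z)" and "uK z = circle_exp (polar_tube z) + 2 * ln (z $ i)" for z :: "real^'n"
  define E K where "E = (\<lambda>z. c * L\<^sup>2 * exp (uE z))" and "K = (\<lambda>z. c * L\<^sup>2 * \<kappa>\<^sup>2 * exp (uK z))"
  have e: "1 \<le> e" using growth_nonneg by (simp add: e_def)
  \<comment> \<open>50 absorbs the 5 and 41 from the profile together with the 4 from the
    logarithm.\<close>
  define B a where "B = exponent_const" and "a = 50 * B * e"
  have B: "2 \<le> B" unfolding B_def by (rule exponent_const_ge)
  have Be: "2 * 1 \<le> B * e" "2 * 1 \<le> B * e\<^sup>2" using B e by (intro mult_mono; simp)+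
  have a0: "a \<ge> 0" using Be by (simp add: a_def)
  have a2: "50 * B * e\<^sup>2 \<le> a\<^sup>2"
  proof -
    have "50 * B * e\<^sup>2 * 1 \<le> 50 * B * e\<^sup>2 * (50 * B)" using B e by (intro mult_left_mono) auto
    then show ?thesis by (simp add: a_def power2_eq_square mult_ac)
  qed
  have zt: "polar_tube z \<le> 3 / 16" using x tz by simp
  have B1: "1 \<le> B" using B by simp
  have smE: "smooth_on UNIV uE"
    unfolding uE_def[abs_def] by (rule smooth_on_compose[OF _ rsmooth_base_exp smooth_polar_tube]) auto
  have smC: "smooth_on UNIV (\<lambda>z. circle_exp (polar_tube z))"
    by (rule smooth_on_compose[OF _ rsmooth_circle_exp smooth_polar_tube]) auto
  have smln: "smooth_on W (\<lambda>z. 2 * ln (z $ i))"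
    by (intro smooth_on_mult W smooth_on_const smooth_on_compose[OF W(1) rsmooth_ln]) (auto simp: W_def)
  have smK: "smooth_on W uK"
    unfolding uK_def[abs_def] by (intro smooth_on_add W smln smooth_on_subset[OF smC]) auto
  have pr: "\<bar>dd q uE z\<bar> \<le> 5 * B * e * norm q" "\<bar>dd r (dd q uE) z\<bar> \<le> 41 * B * e\<^sup>2 * norm q * norm r"
    "\<bar>dd q (\<lambda>z. circle_exp (polar_tube z)) z\<bar> \<le> 5 * B * e * norm q"
    "\<bar>dd r (dd q (\<lambda>z. circle_exp (polar_tube z))) z\<bar> \<le> 41 * B * e\<^sup>2 * norm q * norm r" for q r
    unfolding uE_def[abs_def]
    by (rule profile_bounds[OF rsmooth_base_exp zt e B1] profile_bounds[OF rsmooth_circle_exp zt e B1];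
        unfold tz e_def B_def; rule exponent_deriv_bounds)+
  have uE1: "\<bar>dd q uE z\<bar> \<le> a * norm q" for q
    using pr(1)[of q] mult_right_mono[of "5 * B * e" a "norm q"] Be by (simp add: a_def)
  have mr2: "A * norm q * norm r \<le> a\<^sup>2 * norm q * norm r" if "A \<le> 50 * B * e\<^sup>2" for A :: real and q r :: "real^'n"
    using that a2 by (intro mult_right_mono) auto
  have uE2: "\<bar>dd r (dd q uE) z\<bar> \<le> a\<^sup>2 * norm q * norm r" for q r
    using pr(2)[of r q] mr2[of "41 * B * e\<^sup>2" q r] Be by simp
  have dln: "dd q (\<lambda>z. 2 * ln (z $ i)) y = 2 * q $ i / y $ i" if "y \<in> W" for q y
  proof -
    have "((\<lambda>t. 2 * ln t) has_real_derivative 2 / y $ i) (at (y $ i))"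
      using that by (auto intro!: derivative_eq_intros simp: W_def)
    from dd_real_compose[OF this smooth_UNIV_differentiable[OF smooth_on_component]] show ?thesis by simp
  qed
  have dln2: "dd r (dd q (\<lambda>z. 2 * ln (z $ i))) z = - (2 * q $ i * r $ i / (z $ i)\<^sup>2)" for q r
  proof -
    have "dd r (dd q (\<lambda>z. 2 * ln (z $ i))) z = dd r (\<lambda>z. 2 * q $ i / z $ i) z"
      by (rule dd_cong_open[OF W]) (rule dln)
    moreover have "((\<lambda>t. 2 * q $ i / t) has_real_derivative - (2 * q $ i / (z $ i)\<^sup>2)) (at (z $ i))"
      using s z(2) by (auto intro!: derivative_eq_intros simp: power2_eq_square)
    from dd_real_compose[OF this smooth_UNIV_differentiable[OF smooth_on_component], of r]
    have "dd r (\<lambda>z. 2 * q $ i / z $ i) z = - (2 * q $ i * r $ i / (z $ i)\<^sup>2)" by simp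
    ultimately show ?thesis by simp
  qed
  have s2: "1 / 2 \<le> s\<^sup>2" using polar_tube_bounds(1)[OF zt] z(2) by simp
  have sh: "1 / 2 \<le> s"
  proof (rule ccontr)
    assume "\<not> 1 / 2 \<le> s"
    then have "s * s \<le> 1 / 2 * (1 / 2)" using s by (intro mult_mono) auto
    then show False using s2 by (simp add: power2_eq_square)
  qed
  have cmp: "\<bar>q $ i\<bar> \<le> norm q" for q :: "real^'n" by (rule component_le_norm_cart)
  have l1: "\<bar>2 * q $ i / z $ i\<bar> \<le> 4 * norm q" for q
  proof -
    have "\<bar>2 * q $ i\<bar> / s \<le> (2 * norm q) / (1 / 2)" using cmp[of q] sh by (intro frac_le) auto
    then show ?thesis using s z(2) by (simp add: abs_divide)
  qed
  have l2: "\<bar>2 * q $ i * r $ i / (z $ i)\<^sup>2\<bar> \<le> 4 * norm q * norm r" for q r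
  proof -
    have "\<bar>2 * q $ i * r $ i\<bar> \<le> 2 * norm q * norm r"
      unfolding abs_mult using cmp by (intro mult_mono) auto
    then have "\<bar>2 * q $ i * r $ i\<bar> / s\<^sup>2 \<le> (2 * norm q * norm r) / (1 / 2)" using s2 by (intro frac_le) auto
    then show ?thesis using z(2) by (simp add: abs_divide)
  qed
  have dK: "dd q uK y = dd q (\<lambda>z. circle_exp (polar_tube z)) y + dd q (\<lambda>z. 2 * ln (z $ i)) y" if "y \<in> W" for q y
    unfolding uK_def[abs_def]
    by (rule dd_add[OF smooth_UNIV_differentiable[OF smC] smooth_on_differentiable[OF smln that]])
  have uK1: "\<bar>dd q uK z\<bar> \<le> a * norm q" for q
  proof -
    have "\<bar>dd q uK z\<bar> \<le> 5 * B * e * norm q + 4 * norm q"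
      unfolding dK[OF W(2)] dln[OF W(2)] using pr(3)[of q] l1[of q] by linarith
    also have "\<dots> = (5 * B * e + 4) * norm q" by (simp add: algebra_simps)
    also have "\<dots> \<le> a * norm q" using Be by (intro mult_right_mono) (auto simp: a_def)
    finally show ?thesis .
  qed
  have uK2: "\<bar>dd r (dd q uK) z\<bar> \<le> a\<^sup>2 * norm q * norm r" for q r
  proof -
    have "dd r (dd q uK) z = dd r (\<lambda>y. dd q (\<lambda>z. circle_exp (polar_tube z)) y + dd q (\<lambda>z. 2 * ln (z $ i)) y) z"
      by (rule dd_cong_open[OF W]) (rule dK)
    also have "\<dots> = dd r (dd q (\<lambda>z. circle_exp (polar_tube z))) z + dd r (dd q (\<lambda>z. 2 * ln (z $ i))) z"
      using smooth_on_differentiable[OF smooth_on_dd[OF W(1) smln] W(2), of q]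
        smooth_UNIV_differentiable[OF smooth_on_dd[OF open_UNIV smC], of q z]
      by (intro dd_add)
    finally have "\<bar>dd r (dd q uK) z\<bar> \<le> 41 * B * e\<^sup>2 * norm q * norm r + 4 * norm q * norm r"
      unfolding dln2 using pr(4)[of r q] l2[of q r] by linarith
    also have "\<dots> = (41 * B * e\<^sup>2 + 4) * norm q * norm r" by (simp add: algebra_simps)
    also have "\<dots> \<le> a\<^sup>2 * norm q * norm r" using Be by (intro mr2) auto
    finally show ?thesis .
  qed
  have EK: "E z = \<mu>" "K z = \<mu>"
  proof -
    show "E z = \<mu>" by (simp add: E_def uE_def tz \<mu>_def P_def)
    have "exp (uK z) = exp R * s\<^sup>2"
      using s z(2) by (simp add: uK_def tz R_def exp_add exp_of_nat_mult[of 2 "ln s", simplified])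
    moreover have "\<kappa>\<^sup>2 = exp (P - R) / s\<^sup>2"
      by (simp add: \<kappa>_def power_divide exp_of_nat_mult[of 2 "(P - R) / 2", symmetric])
    ultimately show "K z = \<mu>" using s by (simp add: K_def \<mu>_def exp_diff)
  qed
  note bE = exp_derivative_bounds[OF W smooth_on_subset[OF smE subset_UNIV] E_def EK(1) \<mu> a0 uE1 uE2]
  note bK = exp_derivative_bounds[OF W smK K_def EK(2) \<mu> a0 uK1 uK2]
  have "\<bar>sectional_curvature g (polar \<kappa> z) u v\<bar> \<le> 47 * (2 * a)\<^sup>2 / \<mu>"
  proof (rule sectional_curvature_bound[where E = E and K = K and j = j and V = W])
    fix y b d assume y: "y \<in> W"
    then have "y $ i > 0" "g (polar \<kappa> y) = collar_metric (polar \<kappa> y)" using V(3) by (auto simp: W_def)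
    then show "pull b d y = E y * (b \<bullet> d - b $ j * d $ j) + K y * (b $ j * d $ j)"
      using pull_polar[of y \<kappa> b d]
      by (simp add: riem_inner_def E_def K_def uE_def uK_def exp_add exp_of_nat_mult[of 2 "ln (y $ i)", simplified] mult_ac)
  qed (use W bE bK EK \<mu> a0 in auto)
  also have "\<dots> = 47 * (100 * B)\<^sup>2 * (e\<^sup>2 / \<mu>)" by (simp add: a_def power_mult_distrib)
  \<comment> \<open>The \<open>e\<^sup>2\<close> of the squared derivatives cancels the surplus
    \<open>exp (2 * l)\<close> in the conformal factor \<open>exp (2 * (p + 1) * l)\<close>.\<close>
  also have "e\<^sup>2 / \<mu> = 1 / (sqrt c * L * exp (p * growth x))\<^sup>2"
  proof -
    have "exp P = e\<^sup>2 * (exp (p * growth x))\<^sup>2"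
      unfolding e_def P_def base_exp_def
      by (simp add: exp_of_nat_mult[of 2, symmetric, simplified] exp_add[symmetric] algebra_simps)
    then show ?thesis using c_pos e by (simp add: \<mu>_def power_mult_distrib)
  qed
  finally show ?thesis by (simp add: z(1) B_def)
qed

end

section \<open>The upper bound for the distance from the centre\<close>

lemma has_vector_derivative_vec:
  fixes f :: "real \<Rightarrow> real^'n::finite"
  assumes "\<And>k. ((\<lambda>t. f t $ k) has_real_derivative f' $ k) (at t)"
  shows "(f has_vector_derivative f') (at t)"
proof -
  have "(*) (f' $ k) = (\<lambda>h. (h *\<^sub>R f') $ k)" for k by (simp add: fun_eq_iff mult.commute)
  then have "((\<lambda>t. f t $ k) has_derivative (\<lambda>h. (h *\<^sub>R f') $ k)) (at t)" for k
    using assms[of k] by (simp only: has_field_derivative_def)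
  then have "(f has_derivative (\<lambda>h. h *\<^sub>R f')) (at t within UNIV)"
    unfolding has_derivative_componentwise_within[of f]
    by (auto simp: Basis_vec_def inner_axis)
  then show ?thesis by (simp add: has_vector_derivative_def)
qed

lemma power_decay_integral:
  fixes H A :: real
  assumes "0 < H" "0 \<le> A" "p > 0"
  shows "(\<integral>\<^sup>+t\<in>{0..1}. ennreal (A * (1 / (H + (1 - t))) ^ (p + 1)) \<partial>lborel) \<le> ennreal (A * (1 / H) ^ p)"
proof -
  define F where "F t = A / real p * (1 / (H + (1 - t))) ^ p" for t
  have "(F has_real_derivative A * (1 / (H + (1 - t))) ^ (p + 1)) (at t)" if "t \<in> {0..1}" for t
  proof -
    have nz: "H + (1 - t) \<noteq> 0" using assms that by auto
    have "((\<lambda>t. 1 / (H + (1 - t))) has_real_derivative (1 / (H + (1 - t)))\<^sup>2) (at t)"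
      using nz by (auto intro!: derivative_eq_intros simp: power2_eq_square)
    from DERIV_cmult[OF DERIV_power[OF this, of p], of "A / real p"]
    have "(F has_real_derivative A / real p * (real p * ((1 / (H + (1 - t)))\<^sup>2 * (1 / (H + (1 - t))) ^ (p - Suc 0)))) (at t)"
      unfolding F_def[abs_def] by simp
    moreover have "(1 / (H + (1 - t)))\<^sup>2 * (1 / (H + (1 - t))) ^ (p - Suc 0) = (1 / (H + (1 - t))) ^ (p + 1)"
      using assms(3) by (cases p) (auto simp: power2_eq_square)
    ultimately show ?thesis using assms(3) by simp
  qed
  then have "((\<lambda>t. A * (1 / (H + (1 - t))) ^ (p + 1)) has_integral (F 1 - F 0)) {0..1}"
    by (intro fundamental_theorem_of_calculus)
      (auto simp: has_real_derivative_iff_has_vector_derivative[symmetric] intro: DERIV_subset)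
  then have "(\<integral>\<^sup>+t. ennreal (A * (1 / (H + (1 - t))) ^ (p + 1)) * indicator {0..1} t \<partial>lborel) = ennreal (F 1 - F 0)"
    using assms by (intro nn_integral_has_integral_lebesgue') auto
  moreover have "F 1 - F 0 \<le> A * (1 / H) ^ p"
  proof -
    have "0 \<le> F 0" using assms by (simp add: F_def)
    moreover have "A / real p \<le> A / 1" using assms by (intro divide_left_mono) auto
    then have "F 1 \<le> A * (1 / H) ^ p" using assms(1) mult_right_mono[of "A / real p" A "(1 / H) ^ p"] by (simp add: F_def)
    ultimately show ?thesis by linarith
  qed
  ultimately show ?thesis by (simp add: ennreal_leI)
qed

context collar
begin

lemma norm_pushforward_polar:
  "(norm (pushforward (polar \<kappa>) a z))\<^sup>2 =
     L\<^sup>2 * ((a $ i)\<^sup>2 + (z $ i)\<^sup>2 * \<kappa>\<^sup>2 * (a $ j)\<^sup>2 + (\<Sum>k\<in>- {i, j}. (a $ k)\<^sup>2))"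
proof -
  define s k where "s = sin (\<kappa> * z $ j)" and "k = cos (\<kappa> * z $ j)"
  have sk: "s\<^sup>2 + k\<^sup>2 = 1" by (simp add: s_def k_def)
  have "(norm (pushforward (polar \<kappa>) a z))\<^sup>2 = L\<^sup>2 * (((a $ i)\<^sup>2 + (z $ i)\<^sup>2 * \<kappa>\<^sup>2 * (a $ j)\<^sup>2) * (s\<^sup>2 + k\<^sup>2)
      + (\<Sum>k\<in>- {i, j}. (a $ k)\<^sup>2))"
    unfolding norm_split pushforward_polar s_def[symmetric] k_def[symmetric]
    using ij by (simp add: power2_eq_square algebra_simps sum_distrib_left)
  then show ?thesis unfolding sk by simp
qed

text \<open>The centre \<open>m\<close> is joined to \<open>x\<close> by a path along which \<open>tube\<close> grows
  quadratically from 0 to its value at \<open>x\<close>.\<close>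

lemma riem_dist_upper:
  assumes g: "riemannian_metric g" and x: "tube x \<le> 3 / 16"
    and upper: "\<And>y v. tube y \<le> 3 / 16 \<Longrightarrow> riem_inner g y v v \<le> c * exp (base_exp (tube y)) * (norm v)\<^sup>2"
  shows "riem_dist g m x \<le> 10 * 4 ^ (p + 1) * (sqrt c * L * exp (real p * growth x))"
proof -
  define q where "q = radius2 x - 1"
  have q: "\<bar>q\<bar> \<le> 1 / 2" "radius2 x = 1 + q" using tube_small(1)[OF x] by (auto simp: q_def)
  define s where "s = sqrt (radius2 x)"
  have s: "s > 0" "s\<^sup>2 = radius2 x" using radius2_pos[OF x] by (auto simp: s_def)
  then have "(nc x $ i + 1)\<^sup>2 + (nc x $ j)\<^sup>2 = s\<^sup>2" by (simp add: radius2_def)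
  then have "((nc x $ i + 1) / s)\<^sup>2 + (nc x $ j / s)\<^sup>2 = 1"
    using s(1) by (simp add: power_divide add_divide_distrib[symmetric])
  then obtain \<theta> where \<theta>: "0 \<le> \<theta>" "\<theta> < 2 * pi" "(nc x $ i + 1) / s = cos \<theta>" "nc x $ j / s = sin \<theta>"
    using sincos_total_2pi by metis
  \<comment> \<open>\<open>radius2 - 1\<close> and the coordinates other than \<open>i\<close>,
    \<open>j\<close> are scaled by \<open>t\<close>, which multiplies \<open>tube\<close> by
    \<open>t\<^sup>2\<close>; the angle runs from 0, the angle of \<open>m\<close>, to
    \<open>\<theta>\<close>.\<close>
  define \<sigma> where "\<sigma> t = sqrt (1 + t * q)" for t
  define \<zeta> where "\<zeta> t = (\<chi> k. if k = i then \<sigma> t else if k = j then t * \<theta> else t * nc x $ k)" for t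
  define \<zeta>' where "\<zeta>' t = (\<chi> k. if k = i then q / (2 * \<sigma> t) else if k = j then \<theta> else nc x $ k)" for t
  define \<gamma> where "\<gamma> t = polar 1 (\<zeta> t)" for t
  define D where "D t = pushforward (polar 1) (\<zeta>' t) (\<zeta> t)" for t
  have tq: "1 / 2 \<le> 1 + t * q" "1 + t * q \<le> 3 / 2" if "t \<in> {0..1}" for t
  proof -
    have "\<bar>t * q\<bar> \<le> 1 * (1 / 2)" unfolding abs_mult using that q by (intro mult_mono) auto
    then show "1 / 2 \<le> 1 + t * q" "1 + t * q \<le> 3 / 2" by linarith+
  qed
  have \<sigma>: "0 < \<sigma> t" "(\<sigma> t)\<^sup>2 = 1 + t * q" if "t \<in> {0..1}" for t
  proof -
    have "0 < 1 + t * q" using tq[OF that] by linarith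
    then show "0 < \<sigma> t" "(\<sigma> t)\<^sup>2 = 1 + t * q" unfolding \<sigma>_def by auto
  qed
  have d\<sigma>: "(\<sigma> has_real_derivative q / (2 * \<sigma> t)) (at t)" if "t \<in> {0..1}" for t
  proof -
    have pos: "0 < 1 + t * q" using tq[OF that] by linarith
    have "((\<lambda>t. 1 + t * q) has_real_derivative q) (at t)" by (auto intro!: derivative_eq_intros)
    from DERIV_chain2[OF DERIV_real_sqrt[OF pos] this]
    have "(\<sigma> has_real_derivative inverse (\<sigma> t) / 2 * q) (at t)" by (simp only: \<sigma>_def[abs_def])
    moreover have "inverse (\<sigma> t) / 2 * q = q / (2 * \<sigma> t)" using \<sigma>(1)[OF that] by (simp add: field_simps)
    ultimately show ?thesis by (simp only:)
  qed
  have d\<zeta>: "(\<zeta> has_vector_derivative \<zeta>' t) (at t)" if "t \<in> {0..1}" for t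
  proof (rule has_vector_derivative_vec)
    fix k
    show "((\<lambda>t. \<zeta> t $ k) has_real_derivative \<zeta>' t $ k) (at t)"
      unfolding \<zeta>_def \<zeta>'_def vec_lambda_beta
      using d\<sigma>[OF that] by (cases "k = i"; cases "k = j") (auto intro!: derivative_eq_intros)
  qed
  have d\<gamma>: "(\<gamma> has_vector_derivative D t) (at t)" if "t \<in> {0..1}" for t
  proof -
    have "(\<gamma> has_derivative (\<lambda>h. pushforward (polar 1) (h *\<^sub>R \<zeta>' t) (\<zeta> t))) (at t)"
      unfolding \<gamma>_def[abs_def]
      by (rule has_derivative_compose[OF d\<zeta>[OF that, unfolded has_vector_derivative_def]
          has_derivative_pushforward[OF smooth_polar]])
    moreover have "pushforward (polar 1) (h *\<^sub>R \<zeta>' t) (\<zeta> t) = h *\<^sub>R D t" for h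
      unfolding D_def using linear_cmul[OF has_derivative_linear[OF has_derivative_pushforward[OF smooth_polar]]]
      by simp
    ultimately show ?thesis by (simp add: has_vector_derivative_def)
  qed
  have c\<sigma>: "continuous_on {0..1} \<sigma>" unfolding \<sigma>_def[abs_def] by (intro continuous_intros)
  have c\<zeta>: "continuous_on {0..1} (\<lambda>t. \<zeta> t $ k)" "continuous_on {0..1} (\<lambda>t. \<zeta>' t $ k)" for k
    unfolding \<zeta>_def \<zeta>'_def vec_lambda_beta using \<sigma>(1)
    by (cases "k = i"; cases "k = j"; force intro!: continuous_intros c\<sigma>)+
  have "continuous_on {0..1} (\<lambda>t. D t $ k)" for k
    unfolding D_def pushforward_polar
    by (cases "k = i"; cases "k = j") (auto intro!: continuous_intros c\<zeta>)
  then have "continuous_on {0..1} (\<lambda>t. \<chi> k. D t $ k)" by (rule continuous_on_vec_lambda)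
  then have cD: "continuous_on {0..1} D" by simp
  have c\<gamma>: "continuous_on {0..1} \<gamma>"
    by (rule continuous_at_imp_continuous_on) (use d\<gamma> has_vector_derivative_continuous in blast)
  have vp: "valid_path \<gamma>"
    unfolding valid_path_def piecewise_C1_differentiable_on_def C1_differentiable_on_def
    using c\<gamma> d\<gamma> cD by (intro conjI exI[of _ "{}"] exI[of _ D]) auto
  have "\<gamma> 0 $ k = m $ k" for k
    using ij by (simp add: \<gamma>_def polar_def \<zeta>_def \<sigma>_def)
  then have ps: "pathstart \<gamma> = m" by (simp add: pathstart_def vec_eq_iff)
  have "\<gamma> 1 $ k = x $ k" for k
    using \<theta>(3,4) s(1) ij L_pos q(2) s_def unfolding \<gamma>_def polar_def \<zeta>_def \<sigma>_def
    by (auto simp: field_simps nc_component)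
  then have pf: "pathfinish \<gamma> = x" by (simp add: pathfinish_def vec_eq_iff)
  have tube\<gamma>: "tube (\<gamma> t) = t\<^sup>2 * tube x" if "t \<in> {0..1}" for t
  proof -
    have "tube (\<gamma> t) = (t * q)\<^sup>2 + (\<Sum>k\<in>- {i, j}. (t * nc x $ k)\<^sup>2)"
      unfolding \<gamma>_def tube_polar polar_tube_def using \<sigma>(2)[OF that] by (simp add: \<zeta>_def)
    also have "\<dots> = t\<^sup>2 * tube x"
      by (simp add: tube_def q_def power_mult_distrib distrib_left sum_distrib_left)
    finally show ?thesis .
  qed
  \<comment> \<open>The squared Euclidean speed is at most
    \<open>L\<^sup>2 * (1 + 96 + 1 / 4)\<close>, where 96 is \<open>3 / 2 * 8\<^sup>2\<close> and 8
    bounds the angle \<open>\<theta> < 2 * pi\<close>.\<close>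
  have normD: "norm (D t) \<le> 10 * L" if "t \<in> {0..1}" for t
  proof -
    have "(q / (2 * \<sigma> t))\<^sup>2 = q\<^sup>2 / (4 * (1 + t * q))"
      using \<sigma>(2)[OF that] by (simp add: power_divide power_mult_distrib)
    also have "\<dots> \<le> (1 / 2)\<^sup>2 / (4 * (1 / 2))"
      using tq[OF that] q(1) by (intro frac_le mult_left_mono abs_le_square_iff[THEN iffD1]) auto
    finally have 1: "(q / (2 * \<sigma> t))\<^sup>2 \<le> 1" by (simp add: power_divide)
    have "\<theta> \<le> 8" using \<theta>(2) pi_less_4 by linarith
    then have "\<theta>\<^sup>2 \<le> 8\<^sup>2" using \<theta>(1) by (intro power_mono) auto
    then have "(\<sigma> t)\<^sup>2 * \<theta>\<^sup>2 \<le> 3 / 2 * 64" unfolding \<sigma>(2)[OF that] using tq[OF that] by (intro mult_mono) auto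
    then have "(\<zeta>' t $ i)\<^sup>2 + (\<zeta> t $ i)\<^sup>2 * 1\<^sup>2 * (\<zeta>' t $ j)\<^sup>2 + (\<Sum>k\<in>- {i, j}. (\<zeta>' t $ k)\<^sup>2) \<le> 100"
      using 1 tube_small(2)[OF x] ij by (simp add: \<zeta>_def \<zeta>'_def)
    then have "(norm (D t))\<^sup>2 \<le> L\<^sup>2 * 100"
      unfolding D_def norm_pushforward_polar by (intro mult_left_mono) auto
    then have "(norm (D t))\<^sup>2 \<le> (10 * L)\<^sup>2" by (simp add: power_mult_distrib)
    then show ?thesis by (rule power2_le_imp_le) (use L_pos in simp)
  qed
  define H where "H = exp (- growth x)"
  have H: "H > 0" by (simp add: H_def)
  define A where "A = sqrt c * (10 * L) * 4 ^ (p + 1)"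
  have A: "A \<ge> 0" using c_pos L_pos by (simp add: A_def)
  have sp: "speed g \<gamma> t \<le> A * (1 / (H + (1 - t))) ^ (p + 1)" if t: "t \<in> {0..1}" for t
  proof -
    have ts: "t\<^sup>2 * tube x \<le> 3 / 16"
    proof -
      have "t\<^sup>2 * tube x \<le> 1 * tube x" using t tube_nonneg by (intro mult_right_mono) (auto simp: power_le_one)
      then show ?thesis using x by simp
    qed
    define e where "e = exp (log_growth N (t\<^sup>2 * tube x))"
    have "e \<le> 4 / (H + (1 - t))"
      unfolding e_def H_def using t x tube_nonneg by (intro log_growth_decay N_ge) auto
    then have ee: "e ^ (p + 1) \<le> (4 / (H + (1 - t))) ^ (p + 1)" by (intro power_mono) (auto simp: e_def)
    have be: "exp (base_exp (t\<^sup>2 * tube x)) = (e ^ (p + 1))\<^sup>2"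
    proof -
      have "exp (base_exp (t\<^sup>2 * tube x)) = e ^ (2 * (p + 1))"
        unfolding e_def base_exp_def by (rule exp_of_nat_mult)
      also have "\<dots> = (e ^ (p + 1))\<^sup>2" by (subst mult.commute) (rule power_mult)
      finally show ?thesis .
    qed
    have "riem_inner g (\<gamma> t) (D t) (D t) \<le> c * (e ^ (p + 1))\<^sup>2 * (norm (D t))\<^sup>2"
      using upper[of "\<gamma> t" "D t"] ts unfolding tube\<gamma>[OF t] be by simp
    also have "\<dots> = (sqrt c * e ^ (p + 1) * norm (D t))\<^sup>2"
      using c_pos by (simp add: power_mult_distrib)
    finally have "speed g \<gamma> t \<le> sqrt c * e ^ (p + 1) * norm (D t)"
      unfolding speed_def vector_derivative_at[OF d\<gamma>[OF t]]
      using c_pos by (intro real_le_lsqrt) (auto simp: e_def)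
    also have "\<dots> \<le> sqrt c * (4 / (H + (1 - t))) ^ (p + 1) * (10 * L)"
      using ee normD[OF t] c_pos H t by (intro mult_mono mult_left_mono) (auto simp: e_def)
    also have "\<dots> = A * (1 / (H + (1 - t))) ^ (p + 1)"
      by (simp add: A_def power_divide)
    finally show ?thesis .
  qed
  have "riem_length g \<gamma> \<le> (\<integral>\<^sup>+t\<in>{0..1}. ennreal (A * (1 / (H + (1 - t))) ^ (p + 1)) \<partial>lborel)"
    unfolding riem_length_speed
  proof (intro nn_integral_mono)
    fix t :: real
    show "ennreal (speed g \<gamma> t) * indicator {0..1} t \<le> ennreal (A * (1 / (H + (1 - t))) ^ (p + 1)) * indicator {0..1} t"
      using ennreal_leI[OF sp[of t]] by (cases "t \<in> {0..1}") (simp_all del: power_Suc)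
  qed
  also have "\<dots> \<le> ennreal (A * (1 / H) ^ p)"
    by (rule power_decay_integral[OF H A p_pos])
  finally have "riem_dist g m x \<le> A * (1 / H) ^ p"
    using riem_dist_le_length[OF vp] A H unfolding ps pf by simp
  also have "(1 / H) ^ p = exp (real p * growth x)"
    by (simp add: H_def exp_minus exp_of_nat_mult inverse_eq_divide)
  finally show ?thesis by (simp add: A_def mult_ac)
qed

end

subsection \<open>Gluing the collars\<close>

locale collar_sequence =
  fixes i j :: "'n::finite" and m :: "real^'n"
  assumes ij': "i \<noteq> j"
begin

text \<open>The divergence of the widths drives the volume ratio at the necks to 0.\<close>

definition width :: "nat \<Rightarrow> real" where "width k = real k + 1"
text \<open>With ratio 64, collar \<open>k\<close> lies in the ball of radius
  \<open>3 * 64 ^ k\<close>, which is inside the ball of radius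
  \<open>64 ^ Suc k / 16 = 4 * 64 ^ k\<close> where the next collar metric is still
  constant.\<close>

definition scale :: "nat \<Rightarrow> real" where "scale k = 64 ^ k"

text \<open>The flat factor outside collar \<open>k\<close> is the one inside collar
  \<open>Suc k\<close>; the exponent is \<open>2 * (p + 1)\<close> with
  \<open>p = 4 * CARD('n)\<close>.\<close>

primrec coeff :: "nat \<Rightarrow> real" where
  "coeff 0 = 1"
| "coeff (Suc k) = coeff k * (1 + 2 * width k) ^ (2 * (4 * CARD('n) + 1))"

lemma width_ge: "1 \<le> width k" by (simp add: width_def)

lemma scale_pos: "0 < scale k" by (simp add: scale_def)

lemma coeff_ge: "1 \<le> coeff k"
proof (induction k)
  case (Suc k)
  have "1 \<le> (1 + 2 * width k) ^ (2 * (4 * CARD('n) + 1))"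
    using width_ge[of k] by (intro one_le_power) simp
  then show ?case using Suc mult_mono[of 1 "coeff k" 1] by simp
qed simp

lemma coeff_mono: "k \<le> l \<Longrightarrow> coeff k \<le> coeff l"
proof (rule lift_Suc_mono_le)
  fix k
  have "1 \<le> (1 + 2 * width k) ^ (2 * (4 * CARD('n) + 1))"
    using width_ge[of k] by (intro one_le_power) simp
  then show "coeff k \<le> coeff (Suc k)"
    using coeff_ge[of k] mult_left_mono[of 1 "(1 + 2 * width k) ^ (2 * (4 * CARD('n) + 1))" "coeff k"] by simp
qed

sublocale col: collar i j m "coeff k" "scale k" "width k" "4 * CARD('n)" for k
proof
  show "0 < coeff k" using coeff_ge[of k] by linarith
qed (use ij' scale_pos width_ge in auto)

definition index :: "real^'n \<Rightarrow> nat" where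
  "index x = (LEAST k. norm (x - m) < scale (Suc k) / 16)"

definition metric :: "real^'n \<Rightarrow> real^'n^'n" where
  "metric x = col.collar_metric (index x) x"

text \<open>The sets of constant \<open>index\<close> are not open in general. The shells are open
  and overlap in regions where the collar metrics involved coincide, so smoothness and curvature can
  be computed on a shell.\<close>

definition shell :: "nat \<Rightarrow> (real^'n) set" where
  "shell k = {x. norm (x - m) < scale (Suc k) / 16 \<and> (k = 0 \<or> 3 * scale (k - 1) < norm (x - m))}"

lemma open_shell: "open (shell k)"
proof (cases "k = 0")
  case True
  then show ?thesis by (auto simp: shell_def intro!: open_Collect_less continuous_intros)
next
  case False
  then show ?thesis by (auto simp: shell_def intro!: open_Collect_conj open_Collect_less continuous_intros)
qed

lemma index_less: "norm (x - m) < scale (Suc (index x)) / 16"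
proof -
  obtain k where "norm (x - m) < 64 ^ k" using real_arch_pow[of 64] by auto
  also have "\<dots> \<le> scale (Suc k) / 16" by (simp add: scale_def)
  finally have "norm (x - m) < scale (Suc k) / 16" .
  then show ?thesis unfolding index_def by (rule LeastI)
qed

lemma index_le: "norm (x - m) < scale (Suc k) / 16 \<Longrightarrow> index x \<le> k"
  unfolding index_def by (rule Least_le)

lemma shell_index: "x \<in> shell (index x)"
proof (cases "index x")
  case 0
  then show ?thesis using index_less[of x] by (simp add: shell_def)
next
  case (Suc l)
  then have "\<not> norm (x - m) < scale (Suc l) / 16" using index_le[of x l] by auto
  then have "4 * scale l \<le> norm (x - m)" by (simp add: scale_def)
  then have "3 * scale l < norm (x - m)" using scale_pos[of l] by linarith
  then show ?thesis using index_less[of x] Suc by (simp add: shell_def)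
qed

text \<open>A point of shell \<open>k\<close> has index \<open>k\<close> or \<open>k - 1\<close>. In
  the latter case it lies outside tube \<open>k - 1\<close> and in the flat interior of tube
  \<open>k\<close>, and both metrics have the factor \<open>coeff k\<close>.\<close>

lemma metric_shell:
  assumes x: "x \<in> shell k"
  shows "metric x = col.collar_metric k x"
proof (cases "index x = k")
  case False
  define l where "l = index x"
  have lk: "l < k" using x index_le[of x k] False by (auto simp: shell_def l_def)
  have less: "norm (x - m) < scale (Suc l) / 16" using index_less by (simp add: l_def)
  have gt: "3 * scale (k - 1) < norm (x - m)" using x lk by (auto simp: shell_def)
  have k: "k = Suc l"
  proof (rule ccontr)
    assume "k \<noteq> Suc l"
    then have "scale (Suc l) \<le> scale (k - 1)"
      unfolding scale_def using lk by (intro power_increasing) auto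
    then show False using less gt scale_pos[of "k - 1"] by linarith
  qed
  have "3 / 16 \<le> col.tube l x"
    using col.tube_outer[of l x] gt k by force
  then have "col.collar_metric l x = (\<chi> a b. if a = b then coeff k else 0)"
    by (simp only: col.collar_metric_outer k coeff.simps)
  moreover have "col.collar_metric k x = (\<chi> a b. if a = b then coeff k else 0)"
    using col.tube_inner[of x k] less k by (intro col.collar_metric_inner) simp
  ultimately show ?thesis by (simp add: metric_def l_def[symmetric])
qed (simp add: metric_def)

lemma metric_inner: "riem_inner metric x u v = riem_inner (col.collar_metric (index x)) x u v"
  by (simp add: riem_inner_def metric_def)

lemma metric_lower: "(norm v)\<^sup>2 \<le> riem_inner metric x v v"
proof -
  have "1 * (norm v)\<^sup>2 \<le> coeff (index x) * (norm v)\<^sup>2" using coeff_ge by (intro mult_right_mono) auto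
  then show ?thesis using col.collar_metric_bounds(1)[of "index x" v x] by (simp add: metric_inner)
qed

lemma metric_riemannian: "riemannian_metric metric"
  unfolding riemannian_metric_def smooth_fun_iff
proof (intro conjI allI impI)
  show "smooth_on UNIV (\<lambda>x. metric x $ a $ b)" for a b
  proof (rule smooth_on_locally)
    fix x
    have "smooth_on (shell (index x)) (\<lambda>x. metric x $ a $ b)"
      using smooth_on_cong[OF open_shell, of "index x" "\<lambda>x. metric x $ a $ b" "\<lambda>y. col.collar_metric (index x) y $ a $ b"]
        metric_shell smooth_on_subset[OF col.smooth_collar_metric] by auto
    then show "\<exists>V. open V \<and> x \<in> V \<and> smooth_on V (\<lambda>x. metric x $ a $ b)"
      using open_shell shell_index by blast
  qed
  show "transpose (metric x) = metric x" for x
    unfolding metric_def col.collar_metric_def transpose_def vec_eq_iff by (auto simp: mult_ac)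
  show "0 < v \<bullet> (metric x *v v)" if "v \<noteq> 0" for x v
  proof -
    have "0 < (norm v)\<^sup>2" using that by simp
    then show ?thesis using metric_lower[of v x] unfolding riem_inner_def by linarith
  qed
qed

lemma complete: "complete_metric metric"
  by (rule complete_metricI[OF metric_riemannian metric_lower])

lemma metric_upper_coeff:
  "coeff l * exp (col.base_exp l \<xi>) \<le> coeff (Suc l)"
proof -
  have "col.base_exp l \<xi> \<le> 2 * (4 * CARD('n) + 1) * ln (1 + 2 * width l)"
    unfolding col.base_exp_def using col.growth_le[of l \<xi>] by (intro mult_left_mono) auto
  then have "exp (col.base_exp l \<xi>) \<le> (1 + 2 * width l) ^ (2 * (4 * CARD('n) + 1))"
    unfolding col.exp_ln_N[symmetric] by (rule exp_le_cancel_iff[THEN iffD2])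
  then show ?thesis using coeff_ge[of l] by (simp add: mult_left_mono)
qed

text \<open>A path from \<open>m\<close> inside tube \<open>k\<close> may cross the smaller collars;
  their largest factor is at most \<open>coeff k\<close>, so the estimate for collar
  \<open>k\<close> covers them. This supplies a hypothesis of
  \<open>riem_dist_upper\<close>.\<close>

lemma metric_upper:
  assumes "col.tube k y \<le> 3 / 16"
  shows "riem_inner metric y v v \<le> coeff k * exp (col.base_exp k (col.tube k y)) * (norm v)\<^sup>2"
proof -
  have "norm (y - m) < 3 * scale k" by (rule col.tube_outer[OF assms])
  also have "\<dots> < scale (Suc k) / 16" by (simp add: scale_def)
  finally have le: "index y \<le> k" by (rule index_le)
  show ?thesis
  proof (cases "index y = k")
    case True
    then show ?thesis using col.collar_metric_bounds(2)[of k y v] by (simp add: metric_inner)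
  next
    case False
    then have "coeff (Suc (index y)) \<le> coeff k" using le by (intro coeff_mono) simp
    then have "coeff (index y) * exp (col.base_exp (index y) (col.tube (index y) y)) \<le> coeff k * 1"
      using metric_upper_coeff[of "index y" "col.tube (index y) y"] by simp
    also have "\<dots> \<le> coeff k * exp (col.base_exp k (col.tube k y))"
      using coeff_ge[of k] order_trans[OF col.exp_order(1) col.exp_order(2), of k "col.tube k y"]
      by (intro mult_left_mono) auto
    finally have "coeff (index y) * exp (col.base_exp (index y) (col.tube (index y) y)) * (norm v)\<^sup>2
        \<le> coeff k * exp (col.base_exp k (col.tube k y)) * (norm v)\<^sup>2"
      by (rule mult_right_mono) simp
    then show ?thesis using col.collar_metric_bounds(2)[of "index y" y v] by (simp add: metric_inner)
  qed
qed

lemma curvature_decay: "quadratic_curvature_decay metric m"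
  unfolding quadratic_curvature_decay_def
proof (intro exI conjI allI impI)
  let ?B = "10 * 4 ^ (4 * CARD('n) + 1) :: real"
  let ?C = "47 * (100 * col.exponent_const)\<^sup>2 * ?B\<^sup>2"
  show "?C > 0" using col.exponent_const_ge by simp
  fix x u v :: "real^'n" assume "x \<noteq> m \<and> u \<noteq> v \<and> independent {u, v}"
  then have "0 < norm (x - m)" by simp
  then have d: "0 < riem_dist metric m x"
    using riem_dist_ge_norm[OF metric_riemannian metric_lower, of x m] by linarith
  define k where "k = index x"
  have sh: "x \<in> shell k" using shell_index by (simp add: k_def)
  show "\<bar>sectional_curvature metric x u v\<bar> \<le> ?C / (riem_dist metric m x)\<^sup>2"
  proof (cases "col.tube k x \<le> 3 / 16")
    case True
    \<comment> \<open>\<open>Q\<close> links the two estimates: the distance is at most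
      \<open>?B * Q\<close>, the curvature at most a constant over \<open>Q\<^sup>2\<close>, and
      neither constant depends on \<open>k\<close>.\<close>
    define Q where "Q = sqrt (coeff k) * scale k * exp (real (4 * CARD('n)) * log_growth (width k) (col.tube k x))"
    have Q: "Q > 0" using coeff_ge[of k] scale_pos[of k] by (simp add: Q_def)
    have "riem_dist metric m x \<le> ?B * Q"
      unfolding Q_def by (rule col.riem_dist_upper[OF metric_riemannian True metric_upper])
    then have "(riem_dist metric m x)\<^sup>2 \<le> (?B * Q)\<^sup>2" using d by (intro power_mono) auto
    then have "47 * (100 * col.exponent_const)\<^sup>2 * ?B\<^sup>2 / (?B * Q)\<^sup>2 \<le> ?C / (riem_dist metric m x)\<^sup>2"
      by (intro divide_left_mono mult_pos_pos) (use d Q in auto)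
    moreover have "47 * (100 * col.exponent_const)\<^sup>2 * ?B\<^sup>2 / (?B * Q)\<^sup>2 = 47 * (100 * col.exponent_const)\<^sup>2 / Q\<^sup>2"
      by (simp add: power_mult_distrib)
    moreover have "\<bar>sectional_curvature metric x u v\<bar> \<le> 47 * (100 * col.exponent_const)\<^sup>2 / Q\<^sup>2"
      unfolding Q_def by (rule col.curvature_bound[OF metric_riemannian open_shell sh metric_shell True])
    ultimately show ?thesis by linarith
  next
    case False
    \<comment> \<open>Beyond tube \<open>k\<close> and up to the end of the shell the metric is
      constant.\<close>
    let ?V = "shell k \<inter> {y. 3 / 16 < col.tube k y}"
    have "open ?V" using open_shell col.open_tube(2) by (rule open_Int)
    moreover have "x \<in> ?V" using sh False by simp
    ultimately have "sectional_curvature metric x u v = 0"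
      by (rule sectional_curvature_locally_constant[OF metric_riemannian,
            where A = "\<chi> a b. if a = b then coeff k * (1 + 2 * width k) ^ (2 * (4 * CARD('n) + 1)) else 0"])
        (simp add: metric_shell[of _ k] col.collar_metric_outer)
    then show ?thesis using d by simp
  qed
qed

section \<open>Balls up to the necks: their position and their volume\<close>

lemma height_gradient: "(dd v (col.height k) x)\<^sup>2 \<le> riem_inner metric x v v"
proof (cases "col.tube k x < 1 / 16 \<or> 3 / 16 < col.tube k x")
  case True
  then show ?thesis using riem_inner_nonneg[OF metric_riemannian] by (simp add: col.height_gradient_0)
next
  case False
  \<comment> \<open>Where the height can vary, the point lies in shell \<open>k\<close>, on which
    the glued metric is the collar metric.\<close>
  have "norm (x - m) < 3 * scale k" using False by (intro col.tube_outer) simp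
  moreover have "scale k / 16 < norm (x - m)" using False col.tube_inner[of x k] by force
  ultimately have "x \<in> shell k" by (cases k) (auto simp: shell_def scale_def)
  then show ?thesis
    using col.height_gradient[of k x v] False by (simp add: riem_inner_def metric_shell)
qed

text \<open>The radius at which the circles of the \<open>k\<close>-th collar are shortest relative to the
  distance from \<open>m\<close>.\<close>

definition neck :: "nat \<Rightarrow> real" where
  "neck k = col.height k m * ((1 + 2 * width k) ^ (2 * CARD('n)) - 1)"

lemma height_centre: "col.height k m = sqrt (coeff k) * scale k / (4 * real (4 * CARD('n)) * growth_const)"
proof -
  have "col.tube k m < 1 / 16" by (rule col.tube_inner) (use scale_pos[of k] in simp)
  then show ?thesis by (simp add: col.height_def log_growth_inner[OF width_ge])
qed

lemma height_pos: "0 < col.height k y"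
  using coeff_ge[of k] scale_pos[of k] growth_const(1) by (simp add: col.height_def)

text \<open>On the ball the height changes by less than \<open>neck k\<close>, which is its increase
  from \<open>m\<close> to the level \<open>l = M / 2\<close>: with \<open>p = 4 * n\<close> and
  \<open>W = 1 + 2 * width k\<close>, \<open>exp (p * M / 2) = W ^ (2 * n)\<close>. So
  \<open>l\<close> stays below \<open>M / 2\<close>, and the ball stays within tube
  \<open>k\<close>.\<close>

lemma ball_neck:
  assumes "y \<in> riem_ball metric m (neck k)"
  shows "2 * log_growth (width k) (col.tube k y) < ln (1 + 2 * width k)" "norm (y - m) < 3 * scale k"
proof -
  let ?W = "1 + 2 * width k" and ?l = "log_growth (width k) (col.tube k y)"
  have W: "1 < ?W" using width_ge[of k] by simp
  have "\<bar>col.height k y - col.height k m\<bar> \<le> riem_dist metric m y"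
    by (rule riem_dist_ge[OF metric_riemannian col.smooth_height height_gradient])
  then have "col.height k y < col.height k m * ?W ^ (2 * CARD('n))"
    using assms by (simp add: riem_ball_def neck_def algebra_simps)
  moreover have "col.height k y = col.height k m * exp (real (4 * CARD('n)) * ?l)"
    unfolding height_centre unfolding col.height_def ..
  ultimately have "exp (real (4 * CARD('n)) * ?l) < ?W ^ (2 * CARD('n))"
    using height_pos[of k m] by simp
  also have "?W ^ (2 * CARD('n)) = exp (real (2 * CARD('n)) * ln ?W)"
    using W by (simp add: exp_of_nat_mult del: of_nat_mult)
  finally have "real (2 * CARD('n)) * (2 * ?l) < real (2 * CARD('n)) * ln ?W" by simp
  then show l: "2 * ?l < ln ?W" by (subst (asm) mult_less_cancel_left_pos) auto
  have "0 < ln ?W" using W by simp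
  then have "col.tube k y \<le> 3 / 16"
    using l log_growth_outer[OF width_ge, of "col.tube k y" k] by force
  then show "norm (y - m) < 3 * scale k" by (rule col.tube_outer)
qed

text \<open>From \<open>2 * l \<le> M\<close> follows \<open>l\<^sup>2 / M \<le> l / 2\<close>, so
  the circle direction contributes at most \<open>2 * l + p * l\<close> instead of
  \<open>2 * (p + 1) * l\<close>. In smaller collars the density is at most
  \<open>coeff k ^ n\<close> anyway.\<close>

lemma density_neck:
  assumes y: "y \<in> riem_ball metric m (neck k)"
  shows "det (metric y) \<le> coeff k ^ CARD('n) * (1 + 2 * width k) ^ (4 * CARD('n) * CARD('n) - CARD('n))"
proof -
  let ?W = "1 + 2 * width k" and ?n = "CARD('n)"
  have W: "1 < ?W" using width_ge[of k] by simp
  have n: "1 \<le> ?n" by (simp add: Suc_leI)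
  have nn: "?n \<le> 4 * ?n * ?n" by simp
  have ck: "0 \<le> coeff k" using coeff_ge[of k] by simp
  have det: "det (metric y) = coeff (index y) ^ ?n * exp (col.base_exp (index y) (col.tube (index y) y)) ^ (?n - 1)
      * exp (col.circle_exp (index y) (col.tube (index y) y))"
    unfolding metric_def by (rule col.det_collar_metric)
  have "norm (y - m) < 3 * scale k" by (rule ball_neck(2)[OF y])
  also have "\<dots> < scale (Suc k) / 16" by (simp add: scale_def)
  finally have le: "index y \<le> k" by (rule index_le)
  show ?thesis
  proof (cases "index y = k")
    case True
    define l M where "l = log_growth (width k) (col.tube k y)" and "M = ln ?W"
    have M: "0 < M" "2 * l \<le> M" "0 \<le> l"
      using W ball_neck(1)[OF y] col.growth_nonneg[of k "col.tube k y"] by (auto simp: l_def M_def)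
    have "l * l / M \<le> l / 2" using M mult_left_mono[of "2 * l" M l] by (simp add: field_simps)
    then have c: "col.circle_exp k (col.tube k y) \<le> 2 * l + 8 * real ?n * (l / 2)"
      unfolding col.circle_exp_def l_def[symmetric] M_def[symmetric] using mult_left_mono[of "l * l / M" "l / 2" "8 * real ?n"]
      by (simp add: power2_eq_square)
    have "exp (col.base_exp k (col.tube k y)) ^ (?n - 1) * exp (col.circle_exp k (col.tube k y))
        = exp (real (?n - 1) * (2 * (4 * real ?n + 1) * l) + col.circle_exp k (col.tube k y))"
      by (simp add: exp_add exp_of_nat_mult[symmetric] col.base_exp_def l_def)
    also have "\<dots> \<le> exp (real (4 * ?n * ?n - ?n) * M)"
    proof -
      \<comment> \<open>The value of \<open>p\<close> enters here:
        \<open>(n - 1) * 2 * (p + 1) + 2 + p = 2 * (4 * n * n - n)\<close> for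
        \<open>p = 4 * n\<close>.\<close>
      have "real (?n - 1) * (2 * (4 * real ?n + 1) * l) + (2 * l + 8 * real ?n * (l / 2))
          = (4 * real ?n * real ?n - real ?n) * (2 * l)"
        using n by (simp add: of_nat_diff algebra_simps)
      also have "\<dots> \<le> (4 * real ?n * real ?n - real ?n) * M"
      proof -
        have "1 \<le> real ?n" using n by simp
        then have "0 \<le> (4 * real ?n - 1) * real ?n" by (intro mult_nonneg_nonneg; linarith)
        then show ?thesis using M by (intro mult_left_mono) (auto simp: algebra_simps)
      qed
      finally show ?thesis using c nn by (simp add: of_nat_diff)
    qed
    also have "\<dots> = ?W ^ (4 * ?n * ?n - ?n)" unfolding exp_of_nat_mult M_def using W by simp
    finally show ?thesis
      unfolding det True mult.assoc using ck by (intro mult_left_mono) auto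
  next
    case False
    let ?l = "index y"
    have e: "coeff ?l * exp (col.circle_exp ?l (col.tube ?l y)) \<le> coeff (Suc ?l)"
      "coeff ?l * exp (col.base_exp ?l (col.tube ?l y)) \<le> coeff (Suc ?l)"
    proof -
      have "coeff ?l * exp (col.circle_exp ?l (col.tube ?l y)) \<le> coeff ?l * exp (col.base_exp ?l (col.tube ?l y))"
        using col.exp_order(2) coeff_ge[of ?l] by (intro mult_left_mono) auto
      then show "coeff ?l * exp (col.circle_exp ?l (col.tube ?l y)) \<le> coeff (Suc ?l)"
        "coeff ?l * exp (col.base_exp ?l (col.tube ?l y)) \<le> coeff (Suc ?l)"
        using metric_upper_coeff[of ?l "col.tube ?l y"] by linarith+
    qed
    have "coeff ?l ^ ?n = coeff ?l ^ (?n - 1) * coeff ?l" by (rule power_minus_mult[symmetric]) simp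
    then have "det (metric y) = (coeff ?l * exp (col.base_exp ?l (col.tube ?l y))) ^ (?n - 1)
        * (coeff ?l * exp (col.circle_exp ?l (col.tube ?l y)))"
      unfolding det by (simp add: power_mult_distrib)
    also have "\<dots> \<le> coeff (Suc ?l) ^ (?n - 1) * coeff (Suc ?l)"
      using e coeff_ge[of ?l] coeff_ge[of "Suc ?l"] by (intro mult_mono power_mono) auto
    also have "\<dots> = coeff (Suc ?l) ^ ?n" by (rule power_minus_mult) simp
    also have "\<dots> \<le> coeff k ^ ?n"
      using le False coeff_ge[of "Suc ?l"] by (intro power_mono coeff_mono) auto
    also have "\<dots> \<le> coeff k ^ ?n * ?W ^ (4 * ?n * ?n - ?n)"
      using ck W mult_left_mono[of 1 "?W ^ (4 * ?n * ?n - ?n)" "coeff k ^ ?n"] by (simp add: one_le_power)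
    finally show ?thesis .
  qed
qed

definition volume_const :: real where
  "volume_const = unit_ball_vol (real CARD('n)) * (3 * (8 * real (4 * CARD('n)) * growth_const)) ^ CARD('n)"

text \<open>The largest density is multiplied by the volume of a Euclidean ball of radius
  \<open>3 * scale k\<close>. With \<open>W = 1 + 2 * width k\<close>, the root of the density
  contributes \<open>W\<close> to the power \<open>2 * n * n - n / 2\<close>, against
  \<open>2 * n * n\<close> in \<open>neck k ^ n\<close>; the powers of \<open>coeff k\<close> and
  \<open>scale k\<close> cancel, and \<open>W\<close> to the power \<open>- n / 2\<close>
  remains.\<close>

lemma volume_neck:
  "riem_volume metric (riem_ball metric m (neck k)) / ennreal (neck k ^ CARD('n))
    \<le> ennreal (volume_const / sqrt (1 + 2 * width k))"
proof -
  let ?W = "1 + 2 * width k" and ?n = "CARD('n)"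
  let ?B = "riem_ball metric m (neck k)"
  define U where "U = unit_ball_vol (real ?n)"
  have U: "0 \<le> U" by (simp add: U_def)
  have W: "1 < ?W" using width_ge[of k] by simp
  have n: "1 \<le> ?n" by (simp add: Suc_leI)
  define D where "D = sqrt (coeff k ^ ?n * ?W ^ (4 * ?n * ?n - ?n))"
  have D: "0 \<le> D" using coeff_ge[of k] W by (simp add: D_def)
  have "riem_volume metric ?B \<le> (\<integral>\<^sup>+x. ennreal D * indicator (cball m (3 * scale k)) x \<partial>lborel)"
    unfolding riem_volume_def
  proof (intro nn_integral_mono)
    fix x
    show "ennreal (sqrt (det (metric x))) * indicator ?B x \<le> ennreal D * indicator (cball m (3 * scale k)) x"
    proof (cases "x \<in> ?B")
      case True
      then have "x \<in> cball m (3 * scale k)"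
        using ball_neck(2)[OF True] by (simp add: dist_norm norm_minus_commute)
      then show ?thesis
        using True density_neck[OF True] by (simp add: D_def ennreal_leI)
    qed simp
  qed
  also have "\<dots> = ennreal D * ennreal (U * (3 * scale k) ^ ?n)"
    using scale_pos[of k] by (simp add: nn_integral_cmult_indicator emeasure_cball U_def)
  also have "\<dots> = ennreal (D * (U * (3 * scale k) ^ ?n))"
    using D U by (simp add: ennreal_mult')
  finally have vol: "riem_volume metric ?B \<le> ennreal (D * (U * (3 * scale k) ^ ?n))" .
  define G where "G = 4 * real (4 * ?n) * growth_const"
  have G: "G > 0" using growth_const(1) n by (simp add: G_def)
  have neck: "neck k = sqrt (coeff k) * scale k / G * (?W ^ (2 * ?n) - 1)"
    by (simp add: neck_def height_centre G_def)
  \<comment> \<open>As \<open>?W \<ge> 3\<close>, omitting the subtracted 1 costs at most a factor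
    2, which turns the 4 in \<open>G\<close> into the 8 of \<open>volume_const\<close>.\<close>
  have W2: "?W ^ (2 * ?n) / 2 \<le> ?W ^ (2 * ?n) - 1"
  proof -
    have "3 \<le> ?W" using width_ge[of k] by simp
    also have "?W \<le> ?W ^ (2 * ?n)" using W n by (intro self_le_power) auto
    finally show ?thesis by simp
  qed
  define T where "T = sqrt (coeff k) * scale k / G * (?W ^ (2 * ?n) / 2)"
  have T: "0 < T" using coeff_ge[of k] scale_pos[of k] G W by (simp add: T_def)
  have "T \<le> neck k"
    unfolding T_def neck using W2 coeff_ge[of k] scale_pos[of k] G by (intro mult_left_mono) auto
  then have TN: "T ^ ?n \<le> neck k ^ ?n" using T by (intro power_mono) auto
  have npos: "0 < neck k ^ ?n" using TN T by (meson less_le_trans zero_less_power)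
  have "riem_volume metric ?B / ennreal (neck k ^ ?n) \<le> ennreal (D * (U * (3 * scale k) ^ ?n)) / ennreal (neck k ^ ?n)"
    using vol by (rule divide_right_mono_ennreal)
  also have "\<dots> = ennreal (D * (U * (3 * scale k) ^ ?n) / neck k ^ ?n)"
    using D U scale_pos[of k] npos by (intro divide_ennreal) auto
  also have "\<dots> \<le> ennreal (volume_const / sqrt ?W)"
  proof (rule ennreal_leI)
    have "D * (U * (3 * scale k) ^ ?n) / neck k ^ ?n \<le> D * (U * (3 * scale k) ^ ?n) / T ^ ?n"
      using TN T D U scale_pos[of k] npos by (intro divide_left_mono) auto
    also have "\<dots> = volume_const / sqrt (?W ^ ?n)"
    proof -
      have DW: "D * sqrt (?W ^ ?n) = sqrt (coeff k) ^ ?n * (?W ^ (2 * ?n)) ^ ?n"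
      proof -
        have "D * sqrt (?W ^ ?n) = sqrt (coeff k ^ ?n * (?W ^ (4 * ?n * ?n - ?n) * ?W ^ ?n))"
          by (simp add: D_def real_sqrt_mult mult.assoc)
        also have "?W ^ (4 * ?n * ?n - ?n) * ?W ^ ?n = ?W ^ (4 * ?n * ?n)"
          by (simp add: power_add[symmetric])
        also have "?W ^ (4 * ?n * ?n) = ((?W ^ (2 * ?n)) ^ ?n)\<^sup>2"
          by (simp add: power_mult[symmetric] mult_ac)
        also have "sqrt (coeff k ^ ?n * y\<^sup>2) = sqrt (coeff k) ^ ?n * y" if "0 \<le> y" for y
          using that by (simp add: real_sqrt_mult real_sqrt_power)
        finally show ?thesis using W by simp
      qed
      have s: "sqrt (?W ^ ?n) > 0" using W by simp
      have V: "volume_const = U * (3 * (2 * G)) ^ ?n" by (simp add: volume_const_def U_def G_def)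
      have "D * (U * (3 * scale k) ^ ?n) * sqrt (?W ^ ?n) = volume_const * T ^ ?n"
      proof -
        have "3 * (2 * G) * T = 3 * scale k * (sqrt (coeff k) * ?W ^ (2 * ?n))"
          using G by (simp add: T_def)
        then have "(3 * (2 * G)) ^ ?n * T ^ ?n = (3 * scale k) ^ ?n * (sqrt (coeff k) ^ ?n * (?W ^ (2 * ?n)) ^ ?n)"
          by (simp only: power_mult_distrib[symmetric])
        then have "volume_const * T ^ ?n = U * (3 * scale k) ^ ?n * (D * sqrt (?W ^ ?n))"
          unfolding V DW by (simp only: mult.assoc)
        then show ?thesis by (simp only: mult_ac)
      qed
      moreover have "T ^ ?n \<noteq> 0" using T by simp
      moreover have "sqrt (?W ^ ?n) \<noteq> 0" by (rule less_imp_neq[OF s, symmetric])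
      ultimately show ?thesis using frac_eq_eq by blast
    qed
    also have "\<dots> \<le> volume_const / sqrt ?W"
    proof -
      have "?W \<le> ?W ^ ?n" using W n by (intro self_le_power) auto
      moreover have "0 \<le> volume_const" using growth_const(1) by (simp add: volume_const_def)
      ultimately show ?thesis using W by (intro divide_left_mono) auto
    qed
    finally show "D * (U * (3 * scale k) ^ ?n) / neck k ^ ?n \<le> volume_const / sqrt ?W" .
  qed
  finally show ?thesis .
qed

lemma neck_at_top: "filterlim neck at_top sequentially"
proof -
  define G where "G = 4 * real (4 * CARD('n)) * growth_const"
  have G: "G > 0" using growth_const(1) by (simp add: G_def)
  have ge: "(1 / G) * real k \<le> neck k" for k
  proof -
    have "real k \<le> scale k"
      unfolding scale_def using of_nat_less_two_power[of k, where 'a = real] power_mono[of 2 64 k] by simp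
    moreover have "1 \<le> sqrt (coeff k)" using coeff_ge by simp
    ultimately have "1 * real k \<le> sqrt (coeff k) * scale k" by (intro mult_mono) auto
    moreover have "1 \<le> (1 + 2 * width k) ^ (2 * CARD('n)) - 1"
    proof -
      have "2 \<le> 1 + 2 * width k" using width_ge[of k] by simp
      also have "1 + 2 * width k \<le> (1 + 2 * width k) ^ (2 * CARD('n))"
        using width_ge[of k] by (intro self_le_power) auto
      finally show ?thesis by simp
    qed
    ultimately have "real k * 1 \<le> sqrt (coeff k) * scale k * ((1 + 2 * width k) ^ (2 * CARD('n)) - 1)"
      by (intro mult_mono) auto
    then have "real k / G \<le> sqrt (coeff k) * scale k * ((1 + 2 * width k) ^ (2 * CARD('n)) - 1) / G"
      using G by (simp add: divide_right_mono)
    then show ?thesis by (simp add: neck_def height_centre G_def)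
  qed
  have "filterlim (\<lambda>k. (1 / G) * real k) at_top sequentially"
    using G by (intro filterlim_tendsto_pos_mult_at_top[OF tendsto_const]) (auto intro: filterlim_real_sequentially)
  then show ?thesis by (rule filterlim_at_top_mono[OF _ always_eventually]) (use ge in blast)
qed

lemma slow_growth: "slow_volume_growth metric m"
proof -
  let ?F = "\<lambda>t::real. riem_volume metric (riem_ball metric m t) / ennreal (t ^ CARD('n))"
  \<comment> \<open>A positive limit inferior would bound \<open>?F\<close> away from 0 for all
    large \<open>t\<close>, in particular at the necks, which tend to infinity and where the ratio
    tends to 0.\<close>
  have "Liminf at_top ?F \<le> 0"
  proof (rule ccontr)
    assume "\<not> Liminf at_top ?F \<le> 0"
    then have "0 < Liminf at_top ?F" by (simp only: not_le)
    from dense[OF this] obtain y where y: "0 < y" "y < Liminf at_top ?F" by blast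
    have ev: "eventually (\<lambda>k. y < ?F (neck k)) sequentially"
      by (rule eventually_compose_filterlim[OF less_LiminfD[OF y(2)] neck_at_top])
    have "(\<lambda>k. ennreal (volume_const / sqrt (1 + 2 * width k))) \<longlonglongrightarrow> ennreal 0"
    proof (rule tendsto_ennrealI)
      have "filterlim (\<lambda>k. 1 + 2 * width k) at_top sequentially"
        unfolding width_def by real_asymp
      then show "(\<lambda>k. volume_const / sqrt (1 + 2 * width k)) \<longlonglongrightarrow> 0"
        by (intro real_tendsto_divide_at_top[OF tendsto_const] filterlim_compose[OF sqrt_at_top])
    qed
    then have "eventually (\<lambda>k. ennreal (volume_const / sqrt (1 + 2 * width k)) < y) sequentially"
      using y(1) by (auto intro: order_tendstoD)
    with ev have "eventually (\<lambda>k::nat. False) sequentially"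
    proof eventually_elim
      case (elim k)
      then show ?case using volume_neck[of k] by (meson less_le_trans less_irrefl less_trans not_le)
    qed
    then show False by simp
  qed
  then show ?thesis by (simp add: slow_volume_growth_def)
qed

end

theorem proposition1p4:
  fixes m0 :: "real^'n::finite"
  assumes "1 < CARD('n)"
  shows "\<exists>g :: real^'n \<Rightarrow> real^'n^'n.
           riemannian_metric g \<and> complete_metric g \<and>
           quadratic_curvature_decay g m0 \<and> slow_volume_growth g m0"
proof -
  \<comment> \<open>Two different axes span the plane of the core circles; this is where the
    dimension must exceed 1.\<close>
  obtain i j :: 'n where "i \<noteq> j"
    using assms by (metis (full_types) One_nat_def UNIV_eq_I card_1_singleton_iff less_irrefl singletonI)
  then interpret collar_sequence i j m0 by unfold_locales
  show ?thesis
    using metric_riemannian complete curvature_decay slow_growth by blast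
qed

end
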